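(* Let $n\ge2$ and $0<c<n$ be integers, let $s_0=1,s_1,\dots,s_n$ be complex numbers with $s_n\ne0$, set $s_i=0$ for $i<0$ or $i>n$, and let $A=(s_{j-i})_{i,j\ge1}$. Let $c<\gamma_1<\gamma_2<\dots<\gamma_d$ be integers ($d\ge0$), put ${\boldsymbol\alpha}=(\gamma_1,\dots,\gamma_d)$ and ${\boldsymbol\beta}=(1,2,\dots,c,\gamma_1,\dots,\gamma_d)$, and let $D^k_{{\boldsymbol\alpha},{\boldsymbol\beta}}$ be the leading $k\times k$ submatrix of the matrix obtained from $A$ by deleting the rows indexed by ${\boldsymbol\alpha}$ and the columns indexed by ${\boldsymbol\beta}$. Let $B$ be the set of $v\in\mathbb{C}$ for which there is a sequence $(v_k)$ with $\det(D^k_{{\boldsymbol\alpha},{\boldsymbol\beta}}-v_kI_k)=0$ and $v_k\to v$ as $k\to\infty$. Let $f(z)=\sum_{i=0}^n s_iz^{i-c}$ and $Q(v,z)=z^c(f(z)-v)$, and for each $v$ let $0<\rho_1(v)\le\rho_2(v)\le\dots\le\rho_n(v)$ be the moduli of the zeros of $Q(v,\cdot)$, listed with multiplicity. Let $C=\{v\in\mathbb{C}:\rho_c(v)=\rho_{c+1}(v)\}$. Then $B=C\cup W$ for some finite set $W\subset\mathbb{C}$.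
   Context: $I_k$ is the $k\times k$ identity matrix. *)

theory Defs
  imports
    Complex_Main
    "HOL-Library.Infinite_Set"
    "HOL-Computational_Algebra.Computational_Algebra"
    "Jordan_Normal_Form.Determinant"
begin

text \<open>The coefficients form a two-sided sequence \<open>s :: int \<Rightarrow> complex\<close>. Row and column indices
  of infinite matrices start at 1; the value of \<open>toeplitz s\<close> at index 0 is never used.\<close>

definition toeplitz :: "(int \<Rightarrow> complex) \<Rightarrow> nat \<Rightarrow> nat \<Rightarrow> complex" where
  "toeplitz s i j = s (int j - int i)"

text \<open>\<open>enumerate S i\<close> is the \<open>i\<close>-th smallest element of \<open>S\<close>, counted from 0, which matches the
  0-based indices of \<open>mat\<close>.\<close>

definition leading_submatrix ::
    "(nat \<Rightarrow> nat \<Rightarrow> complex) \<Rightarrow> nat list \<Rightarrow> nat list \<Rightarrow> nat \<Rightarrow> complex mat" where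
  "leading_submatrix A \<alpha> \<beta> k =
     mat k k (\<lambda>(i, j). A (enumerate ({1..} - set \<alpha>) i) (enumerate ({1..} - set \<beta>) j))"

definition limit_eigenvalues :: "(nat \<Rightarrow> complex mat) \<Rightarrow> complex set" where
  "limit_eigenvalues D =
     {v. \<exists>u. (\<forall>k\<ge>1. det (D k - u k \<cdot>\<^sub>m 1\<^sub>m k) = 0) \<and> u \<longlonglongrightarrow> v}"

definition symbol :: "nat \<Rightarrow> nat \<Rightarrow> (int \<Rightarrow> complex) \<Rightarrow> complex \<Rightarrow> complex" where
  "symbol n c s z = (\<Sum>i=0..n. s (int i) * z powi (int i - int c))"

text \<open>\<open>Q(v, z) = z\<^sup>c (f(z) - v)\<close> as a polynomial in \<open>z\<close>, with \<open>f = symbol n c s\<close>; see \<open>poly_Qpoly\<close>.\<close>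

definition Qpoly :: "nat \<Rightarrow> nat \<Rightarrow> (int \<Rightarrow> complex) \<Rightarrow> complex \<Rightarrow> complex poly" where
  "Qpoly n c s v = (\<Sum>i=0..n. monom (s (int i)) i) - monom v c"

lemma poly_Qpoly:
  assumes "z \<noteq> 0"
  shows "poly (Qpoly n c s v) z = z ^ c * (symbol n c s z - v)"
proof -
  have "z ^ c * (s (int i) * z powi (int i - int c)) = s (int i) * z ^ i" for i
    using assms by (simp add: power_int_diff)
  then have "z ^ c * symbol n c s z = (\<Sum>i=0..n. s (int i) * z ^ i)"
    unfolding symbol_def sum_distrib_left by (intro sum.cong) auto
  then show ?thesis
    by (simp add: Qpoly_def poly_sum poly_monom right_diff_distrib)
qed

text \<open>\<open>root_modulus n c s v i\<close> is \<open>\<rho>\<^sub>i(v)\<close>, for \<open>1 \<le> i \<le> n\<close>.\<close>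

definition root_moduli :: "nat \<Rightarrow> nat \<Rightarrow> (int \<Rightarrow> complex) \<Rightarrow> complex \<Rightarrow> real list" where
  "root_moduli n c s v = sorted_list_of_multiset (image_mset cmod (proots (Qpoly n c s v)))"

definition root_modulus :: "nat \<Rightarrow> nat \<Rightarrow> (int \<Rightarrow> complex) \<Rightarrow> complex \<Rightarrow> nat \<Rightarrow> real" where
  "root_modulus n c s v i = root_moduli n c s v ! (i - 1)"

lemma
  assumes "0 < c" "c < n" "s 0 = 1" "s (int n) \<noteq> 0"
  shows degree_Qpoly: "degree (Qpoly n c s v) = n"
    and poly_Qpoly_0: "poly (Qpoly n c s v) 0 = 1"
    and length_root_moduli: "length (root_moduli n c s v) = n"
    and root_moduli_pos: "\<forall>x\<in>set (root_moduli n c s v). 0 < x"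
proof -
  have coeff: "coeff (Qpoly n c s v) m
      = (if m \<le> n then s (int m) else 0) - (if m = c then v else 0)" for m
    by (auto simp: Qpoly_def coeff_sum coeff_monom)
  show deg: "degree (Qpoly n c s v) = n"
  proof (rule antisym)
    show "degree (Qpoly n c s v) \<le> n"
      using assms by (intro degree_le) (auto simp: coeff)
    show "n \<le> degree (Qpoly n c s v)"
      using assms by (intro le_degree) (auto simp: coeff)
  qed
  show p0: "poly (Qpoly n c s v) 0 = 1"
    using assms by (simp add: poly_0_coeff_0 coeff)
  have size: "size (proots (Qpoly n c s v)) = n"
    by (simp add: size_proots_complex deg)
  show "length (root_moduli n c s v) = n"
    by (metis mset_sorted_list_of_multiset root_moduli_def size size_image_mset size_mset)
  show "\<forall>x\<in>set (root_moduli n c s v). 0 < x"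
  proof -
    have "Qpoly n c s v \<noteq> 0"
      using p0 by auto
    then show ?thesis
      using p0 by (auto simp: root_moduli_def)
  qed
qed

end

theory Submission
  imports "HOL-Complex_Analysis.Complex_Analysis" "Jordan_Normal_Form.Spectral_Radius" Defs
begin

text \<open>Write \<open>p k v\<close> for the determinant of \<open>D k - v\<close>. Up to a sign, \<open>p k v\<close> times a Vandermonde
  determinant times \<open>(x\<^sub>1 \<cdots> x\<^sub>n)\<^sup>k\<close> is an \<open>n \<times> n\<close> determinant in the zeros \<open>x\<^sub>l\<close> of \<open>Q(v, \<cdot>)\<close>: its
  last \<open>n - c\<close> rows are powers \<open>x\<^sub>l\<^bsup>k+i\<^esup>\<close>, and its first \<open>c\<close> rows, which encode the deleted rows and
  columns, do not depend on \<open>k\<close>. If \<open>\<rho>\<^sub>c(v) < \<rho>\<^bsub>c+1\<^esub>(v)\<close>, then \<open>|p k v| (\<rho>\<^sub>1 \<cdots> \<rho>\<^sub>c)\<^sup>k\<close> has, even along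
  \<open>v\<^sub>k \<longlonglongrightarrow> v\<close>, a limit proportional to the modulus of a \<open>c \<times> c\<close> determinant \<open>E\<close>, so \<open>v\<close> can be a limit of
  eigenvalues only if \<open>E = 0\<close> or \<open>Q(v, \<cdot>)\<close> has a multiple zero. For every choice of \<open>c\<close> zeros \<open>E\<close> is nonzero
  for large \<open>v\<close>, and by analytic continuation in \<open>v\<close> it vanishes at finitely many \<open>v\<close> only. Conversely, if
  \<open>\<rho>\<^sub>c(v) = \<rho>\<^bsub>c+1\<^esub>(v)\<close> and \<open>v\<close> is not a limit of eigenvalues, then \<open>1 / (\<rho>\<^sub>1 \<cdots> \<rho>\<^sub>c)\<close> is near \<open>v\<close> the modulus of a
  holomorphic function, and the maximum principle forces \<open>\<rho>\<^sub>c = \<rho>\<^bsub>c+1\<^esub>\<close> in a whole neighbourhood, which is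
  impossible.\<close>

text \<open>The set of the \<open>c\<close> smallest zeros does not vary analytically: the selection
  jumps across ties, and branches are permuted around multiple zeros. Degeneracy is therefore tested
  on all choices of \<open>c\<close> distinct zeros at once, which makes it a property of
  \<open>v\<close> alone; locally there are finitely many choices, each holomorphic in a root of
  \<open>v - v0\<close>. If one choice degenerated on a whole disc, degeneracy would spread over the
  plane up to isolated points, against the estimate for large \<open>v\<close>. That estimate also
  prevents accumulation at infinity, so the exceptional set is finite and not merely discrete. At
  ties \<open>E\<close> may vanish and the limit formula breaks down, yet every tie belongs to
  \<open>B\<close>. The asymptotics are used only at generic points nearby, and normal families
  supply a holomorphic function on a full disc. Two facts make this work: ties have empty interior,
  by a divisibility count, and \<open>u k\<close> can be taken as the zero of \<open>p k\<close>
  closest to \<open>v\<close>, so that a failure of convergence leaves infinitely many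
  \<open>p k\<close> without zeros on one disc.\<close>

hide_const (open) Determinants.det

section \<open>Determinants\<close>

lemma det_eq_0_imp_kernel:
  fixes f :: "nat \<times> nat \<Rightarrow> 'a::field"
  assumes "det (mat m m f) = 0"
  obtains \<kappa> where "\<exists>j<m. \<kappa> j \<noteq> 0" "\<And>i. i < m \<Longrightarrow> (\<Sum>j<m. f (i, j) * \<kappa> j) = 0"
proof -
  have A: "mat m m f \<in> carrier_mat m m"
    by simp
  obtain w where w: "w \<in> carrier_vec m" "w \<noteq> 0\<^sub>v m" "mat m m f *\<^sub>v w = 0\<^sub>v m"
    using assms det_0_iff_vec_prod_zero_field[OF A] by auto
  show ?thesis
  proof
    show "\<exists>j<m. vec_index w j \<noteq> 0"
      using w(1,2) by (metis carrier_vecD dim_vec eq_vecI index_zero_vec(1) index_zero_vec(2))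
  next
    fix i assume "i < m"
    then have "vec_index (mat m m f *\<^sub>v w) i = (\<Sum>j<m. f (i, j) * vec_index w j)"
      using w(1) by (simp add: scalar_prod_def lessThan_atLeast0)
    then show "(\<Sum>j<m. f (i, j) * vec_index w j) = 0"
      using w(3) \<open>i < m\<close> by simp
  qed
qed

text \<open>A dependency between the rows consists of the coefficients of a nonzero polynomial of
  degree below \<open>m\<close> with the \<open>m\<close> distinct zeros \<open>x l\<close>.\<close>

lemma det_vandermonde_nonzero:
  fixes x :: "nat \<Rightarrow> 'a::field"
  assumes "inj_on x {..<m}"
  shows "det (mat m m (\<lambda>(i, l). x l ^ i)) \<noteq> 0"
proof
  let ?V = "mat m m (\<lambda>(i, l). x l ^ i)"
  assume "det ?V = 0"
  moreover have "transpose_mat ?V = mat m m (\<lambda>(l, i). x l ^ i)"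
    by (intro eq_matI) auto
  ultimately have "det (mat m m (\<lambda>(l, i). x l ^ i)) = 0"
    by (metis det_transpose mat_carrier)
  then obtain \<kappa> where \<kappa>: "\<exists>j<m. \<kappa> j \<noteq> 0" "\<And>l. l < m \<Longrightarrow> (\<Sum>i<m. x l ^ i * \<kappa> i) = 0"
    by (rule det_eq_0_imp_kernel) auto
  define q where "q = (\<Sum>i<m. monom (\<kappa> i) i)"
  have coeff: "coeff q i = (if i < m then \<kappa> i else 0)" for i
    by (simp add: q_def coeff_sum coeff_monom)
  have "q \<noteq> 0"
    using \<kappa>(1) coeff by (metis coeff_0)
  have "degree q < m"
    using \<kappa>(1) \<open>q \<noteq> 0\<close> coeff by (metis leading_coeff_0_iff)
  have "x ` {..<m} \<subseteq> {z. poly q z = 0}"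
    using \<kappa>(2) by (auto simp: q_def poly_sum poly_monom mult.commute)
  then have "m \<le> card {z. poly q z = 0}"
    using card_mono[OF poly_roots_finite[OF \<open>q \<noteq> 0\<close>], of "x ` {..<m}"] card_image[OF assms]
    by simp
  then show False
    using card_poly_roots_bound[OF \<open>q \<noteq> 0\<close>] \<open>degree q < m\<close> by simp
qed

lemma tendsto_det:
  fixes f :: "'b \<Rightarrow> nat \<times> nat \<Rightarrow> 'a::{real_normed_field}"
  assumes "\<And>i j. i < m \<Longrightarrow> j < m \<Longrightarrow> ((\<lambda>k. f k (i, j)) \<longlongrightarrow> g (i, j)) F"
  shows "((\<lambda>k. det (mat m m (f k))) \<longlongrightarrow> det (mat m m g)) F"
proof -
  have eq: "det (mat m m h) = (\<Sum>p | p permutes {0..<m}. signof p * (\<Prod>i = 0..<m. h (i, p i)))"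
    for h :: "nat \<times> nat \<Rightarrow> 'a"
  proof -
    have "(\<Prod>i = 0..<m. mat m m h $$ (i, q i)) = (\<Prod>i = 0..<m. h (i, q i))" if "q permutes {0..<m}" for q
    proof (rule prod.cong)
      fix i assume "i \<in> {0..<m}"
      moreover from this have "q i \<in> {0..<m}"
        using permutes_in_image[OF that] by blast
      ultimately show "mat m m h $$ (i, q i) = h (i, q i)"
        by simp
    qed simp
    then show ?thesis
      unfolding det_def'[OF mat_carrier] by (intro sum.cong refl) simp
  qed
  show ?thesis
    unfolding eq
    by (intro tendsto_sum tendsto_mult tendsto_const tendsto_prod assms)
      (auto dest: permutes_in_image)
qed

lemma det_scale_rows_cols:
  fixes f :: "nat \<times> nat \<Rightarrow> 'a::comm_ring_1"
  shows "det (mat m m (\<lambda>(i, j). a i * f (i, j) * b j)) = (\<Prod>i<m. a i) * det (mat m m f) * (\<Prod>j<m. b j)"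
proof -
  have D: "det (mat_diag m h) = (\<Prod>i<m. h i)" for h :: "nat \<Rightarrow> 'a"
    by (subst det_upper_triangular[of _ m])
      (auto simp: mat_diag_def diag_mat_def prod.list_conv_set_nth lessThan_atLeast0)
  have "mat m m (\<lambda>(i, j). a i * f (i, j) * b j) = mat_diag m a * mat m m f * mat_diag m b"
    by (subst mat_diag_mult_left[of _ m m], simp, subst mat_diag_mult_right[of _ m m], simp)
      (intro eq_matI, auto)
  also have "det \<dots> = det (mat_diag m a * mat m m f) * det (mat_diag m b)"
    by (rule det_mult[of _ m]) (auto intro!: mult_carrier_mat)
  also have "det (mat_diag m a * mat m m f) = det (mat_diag m a) * det (mat m m f)"
    by (rule det_mult[of _ m]) auto
  finally show ?thesis
    by (simp add: D)
qed

text \<open>The base varies with \<open>k\<close> because the zeros move along with the eigenvalues;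
  a fixed \<open>q\<close> between \<open>norm l\<close> and 1 eventually dominates it.\<close>

lemma power_seq_tendsto_0:
  fixes a :: "nat \<Rightarrow> 'a::real_normed_field"
  assumes "a \<longlonglongrightarrow> l" "norm l < 1"
  shows "(\<lambda>k. a k ^ k) \<longlonglongrightarrow> 0"
proof -
  obtain q where q: "norm l < q" "q < 1"
    using assms(2) dense by blast
  have "eventually (\<lambda>k. norm (a k) < q) sequentially"
    using order_tendstoD(2)[OF tendsto_norm[OF assms(1)] q(1)] .
  then have "eventually (\<lambda>k. norm (a k ^ k) \<le> q ^ k) sequentially"
    by eventually_elim (simp add: norm_power power_mono)
  moreover have "(\<lambda>k. q ^ k) \<longlonglongrightarrow> 0"
    using q norm_ge_zero[of l] by (intro LIMSEQ_realpow_zero) linarith+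
  ultimately show ?thesis
    by (rule Lim_null_comparison)
qed

section \<open>Compressed banded Toeplitz matrices\<close>

text \<open>Here \<open>e i\<close> is the \<open>i\<close>-th index (from 0) that is not deleted, \<open>g\<close> is the position right after the
  last deleted index, and \<open>d\<close> is the constant shift from there on. The first \<open>c\<close> indices are never
  deleted, so the \<open>j\<close>-th remaining column is \<open>e (j + c)\<close>, and subtracting \<open>v\<close> on the diagonal of the
  submatrix means subtracting it on the \<open>c\<close>-th superdiagonal of \<open>T\<close>.\<close>

locale banded_toeplitz =
  fixes n c g d :: nat and s :: "int \<Rightarrow> complex" and e :: "nat \<Rightarrow> nat"
  assumes c_pos: "0 < c" and c_less: "c < n"
    and s_0: "s 0 = 1" and s_n: "s (int n) \<noteq> 0"
    and s_out: "\<And>i. i < 0 \<or> i > int n \<Longrightarrow> s i = 0"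
    and e_mono: "strict_mono e" and e_tail: "\<And>i. g \<le> i \<Longrightarrow> e i = i + d"
    and gap: "g = 0 \<or> c \<le> g \<and> e (g - 1) + 2 \<le> e g"
begin

abbreviation Q :: "complex \<Rightarrow> complex poly" where
  "Q \<equiv> Qpoly n c s"

text \<open>The first \<open>c\<close> columns, which \<open>D k\<close> lacks, are kept: this makes
  the matrix upper triangular with unit diagonal, so that solutions can be continued
  backwards.\<close>

definition T :: "complex \<Rightarrow> nat \<Rightarrow> nat \<Rightarrow> complex" where
  "T v i j = s (int (e j) - int (e i)) - (if j = i + c then v else 0)"

definition p :: "nat \<Rightarrow> complex \<Rightarrow> complex" where
  "p k v = det (mat k k (\<lambda>(i, j). T v i (j + c)))"

text \<open>The solution of \<open>T y = 0\<close> that is \<open>i \<mapsto> z\<^sup>i\<close> behind the last deleted index, continued backwards by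
  the recurrence; it is a solution at all rows when \<open>z\<close> is a zero of \<open>Q v\<close>.\<close>

function sol :: "complex \<Rightarrow> complex \<Rightarrow> nat \<Rightarrow> complex" where
  "sol v z i = (if g \<le> i then z ^ i else - (\<Sum>l=1..n. T v i (i + l) * sol v z (i + l)))"
  by auto
termination by (relation "Wellfounded.measure (\<lambda>(v, z, i). g - i)") auto

declare sol.simps[simp del]

lemma sol_tail: "g \<le> i \<Longrightarrow> sol v z i = z ^ i"
  by (simp add: sol.simps)

lemma e_add_le: "e i + l \<le> e (i + l)"
proof (induction l)
  case (Suc l)
  have "e (i + l) < e (i + Suc l)"
    using e_mono by (simp add: strict_mono_def)
  then show ?case
    using Suc by simp
qed auto

lemma T_diag [simp]: "T v i i = 1"
  using c_pos by (simp add: T_def s_0)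

lemma T_lower: "j < i \<Longrightarrow> T v i j = 0"
  using e_mono by (auto simp: T_def strict_mono_def intro!: s_out)

text \<open>Deleting indices only spreads the remaining ones apart, so the band never grows wider
  than \<open>n\<close>.\<close>

lemma T_upper: "i + n < j \<Longrightarrow> T v i j = 0"
  using e_add_le[of i "j - i"] c_less by (auto simp: T_def intro!: s_out)

lemma T_tail: "g \<le> i \<Longrightarrow> T v i (i + l) = s (int l) - (if l = c then v else 0)"
  by (simp add: T_def e_tail)

lemma poly_Q: "poly (Q v) z = (\<Sum>l=0..n. (s (int l) - (if l = c then v else 0)) * z ^ l)"
proof -
  have "(\<Sum>l=0..n. (if l = c then v else 0) * z ^ l) = v * z ^ c"
    using c_less by (subst sum.remove[of _ c]) (auto intro!: sum.neutral)
  then show ?thesis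
    by (simp add: Qpoly_def poly_sum poly_monom left_diff_distrib sum_subtractf)
qed

lemma Q_nonzero [simp]: "Q v \<noteq> 0"
  using degree_Qpoly[OF c_pos c_less s_0 s_n, of v] c_less by auto

lemma poly_Q_0 [simp]: "poly (Q v) 0 = 1"
  by (rule poly_Qpoly_0[OF c_pos c_less s_0 s_n])

lemma T_sol:
  assumes "poly (Q v) z = 0"
  shows "(\<Sum>l=0..n. T v i (i + l) * sol v z (i + l)) = 0"
proof (cases "g \<le> i")
  case True
  then have "(\<Sum>l=0..n. T v i (i + l) * sol v z (i + l)) = z ^ i * poly (Q v) z"
    unfolding poly_Q sum_distrib_left
    by (intro sum.cong) (auto simp: T_tail sol_tail power_add)
  then show ?thesis
    using assms by simp
next
  case False
  then show ?thesis
    by (simp add: sum.atLeast_Suc_atMost[of 0 n] sol.simps[of v z i])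
qed

lemma T_sol':
  assumes "poly (Q v) z = 0" "i + n < N"
  shows "(\<Sum>j<N. T v i j * sol v z j) = 0"
proof -
  have "(\<Sum>j<N. T v i j * sol v z j) = (\<Sum>j\<in>{i..i+n}. T v i j * sol v z j)"
    using assms(2) T_lower T_upper
    by (intro sum.mono_neutral_right) (auto simp: not_le)
  also have "\<dots> = (\<Sum>l=0..n. T v i (i + l) * sol v z (i + l))"
    by (rule sum.reindex_bij_witness[of _ "\<lambda>l. i + l" "\<lambda>j. j - i"]) auto
  finally show ?thesis
    using T_sol[OF assms(1)] by simp
qed

text \<open>Multiply the first \<open>k\<close> rows of \<open>T\<close>, completed by unit rows that select the coordinates \<open>< c\<close> and
  \<open>\<ge> k + c\<close>, by the matrix whose columns are the first \<open>k\<close> unit vectors and the \<open>n\<close> solutions belonging to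
  the zeros of \<open>Q v\<close>. Both factors and the product are block triangular.\<close>

lemma det_identity:
  assumes "g \<le> k" and roots: "\<And>l. l < n \<Longrightarrow> poly (Q v) (x l) = 0"
  shows "(-1) ^ (k * c) * p k v * (\<Prod>l<n. x l ^ k) * det (mat n n (\<lambda>(i, l). x l ^ i))
    = det (mat n n (\<lambda>(i, l). if i < c then sol v (x l) i else x l ^ (k + i)))"
proof -
  define M where "M = mat (k + n) (k + n) (\<lambda>(i, j). if i < k then T v i j
    else if i < k + c then (if j = i - k then 1 else 0) else (if j = i then 1 else 0))"
  define Y where "Y = mat (k + n) (k + n) (\<lambda>(i, j). if j < k then (if i = j then 1 else 0)
    else sol v (x (j - k)) i)"
  define H where "H = mat n n (\<lambda>(i, l). if i < c then sol v (x l) i else x l ^ (k + i))"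
  have M [simp]: "M \<in> carrier_mat (k + n) (k + n)" and Y [simp]: "Y \<in> carrier_mat (k + n) (k + n)"
    by (auto simp: M_def Y_def)
  have detM: "det M = (-1) ^ (k * c) * p k v"
  proof -
    define M1 where "M1 = four_block_mat (1\<^sub>m c) (0\<^sub>m c k) (mat k c (\<lambda>(i, j). T v i j))
      (mat k k (\<lambda>(i, j). T v i (j + c)))"
    have M1 [simp]: "M1 \<in> carrier_mat (c + k) (c + k)"
      by (auto simp: M1_def)
    \<comment> \<open>Moving the \<open>c\<close> unit rows above the first \<open>k\<close> rows
      costs the sign; expanding along them then removes the first \<open>c\<close> columns of
      \<open>T\<close>.\<close>
    have "det M = (-1) ^ (k * c) * det (mat (k + n) (k + n)
        (\<lambda>(i, j). M $$ (if i < c then i + k else if i < k + c then i - c else i, j)))"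
      using c_less by (intro det_swap_initial_rows) auto
    also have "mat (k + n) (k + n)
        (\<lambda>(i, j). M $$ (if i < c then i + k else if i < k + c then i - c else i, j))
      = four_block_mat M1 (mat (c + k) (n - c) (\<lambda>(i, j). if i < c then 0 else T v (i - c) (j + c + k)))
        (0\<^sub>m (n - c) (c + k)) (1\<^sub>m (n - c))"
      using c_less by (intro eq_matI) (auto simp: M_def M1_def add.commute)
    also have "det \<dots> = det M1 * det (1\<^sub>m (n - c))"
      by (rule det_four_block_mat_lower_left_zero[of _ "c + k" _ "n - c"]) auto
    also have "det M1 = det (1\<^sub>m c) * p k v"
      unfolding M1_def p_def by (rule det_four_block_mat_upper_right_zero[of _ c _ k]) auto
    finally show ?thesis
      by simp
  qed
  have detY: "det Y = (\<Prod>l<n. x l ^ k) * det (mat n n (\<lambda>(i, l). x l ^ i))"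
  proof -
    have "Y = four_block_mat (1\<^sub>m k) (mat k n (\<lambda>(i, l). sol v (x l) i)) (0\<^sub>m n k)
        (mat n n (\<lambda>(i, l). 1 * (x l ^ i) * x l ^ k))"
      using \<open>g \<le> k\<close> by (intro eq_matI) (auto simp: Y_def sol_tail simp flip: power_add)
    then have "det Y = det (1\<^sub>m k) * det (mat n n (\<lambda>(i, l). 1 * (x l ^ i) * x l ^ k))"
      by (metis (no_types, lifting) det_four_block_mat_lower_left_zero mat_carrier one_carrier_mat)
    also have "det (mat n n (\<lambda>(i, l). 1 * (x l ^ i) * x l ^ k)) =
        (\<Prod>l<n. x l ^ k) * det (mat n n (\<lambda>(i, l). x l ^ i))"
      using det_scale_rows_cols[of n "\<lambda>_. 1" "\<lambda>(i, l). x l ^ i" "\<lambda>l. x l ^ k"] by simp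
    finally show ?thesis
      by simp
  qed
  have prod: "M * Y = four_block_mat (mat k k (\<lambda>(i, j). T v i j)) (0\<^sub>m k n)
      (mat n k (\<lambda>(i, j). if i < c \<and> j = i then 1 else 0)) H" (is "_ = ?R")
  proof (rule eq_matI)
    fix i j assume "i < dim_row ?R" "j < dim_col ?R"
    then have i: "i < k + n" and j: "j < k + n"
      by (auto simp: H_def)
    have entry: "(M * Y) $$ (i, j) = (\<Sum>m<k+n. M $$ (i, m) * Y $$ (m, j))"
      using i j by (simp add: M_def Y_def scalar_prod_def lessThan_atLeast0)
    have pick: "(\<Sum>m<k+n. M $$ (i, m) * Y $$ (m, j)) = Y $$ (a, j)"
      if "a < k + n" "\<And>m. m < k + n \<Longrightarrow> M $$ (i, m) = (if m = a then 1 else 0)" for a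
    proof -
      have "(\<Sum>m<k+n. M $$ (i, m) * Y $$ (m, j)) = (\<Sum>m<k+n. if m = a then Y $$ (m, j) else 0)"
        by (intro sum.cong) (auto simp: that(2))
      then show ?thesis
        using that(1) by simp
    qed
    consider "i < k" "j < k" | "i < k" "k \<le> j" | "k \<le> i" "i < k + c" | "k + c \<le> i"
      by linarith
    then show "(M * Y) $$ (i, j) = ?R $$ (i, j)"
    proof cases
      case 1
      have "(\<Sum>m<k+n. M $$ (i, m) * Y $$ (m, j)) = (\<Sum>m<k+n. if m = j then T v i m else 0)"
        using 1 by (intro sum.cong) (auto simp: M_def Y_def)
      then show ?thesis
        using 1 entry by (simp add: H_def)
    next
      case 2
      have "(\<Sum>m<k+n. M $$ (i, m) * Y $$ (m, j)) = (\<Sum>m<k+n. T v i m * sol v (x (j - k)) m)"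
        using 2 i j by (intro sum.cong) (auto simp: M_def Y_def)
      also have "\<dots> = 0"
        using 2 i j by (intro T_sol' roots) auto
      finally show ?thesis
        using 2 i j entry by (simp add: H_def)
    next
      case 3
      then have "(M * Y) $$ (i, j) = Y $$ (i - k, j)"
        unfolding entry using i by (intro pick) (auto simp: M_def)
      then show ?thesis
        using 3 i j c_less by (auto simp: H_def Y_def)
    next
      case 4
      then have "(M * Y) $$ (i, j) = Y $$ (i, j)"
        unfolding entry using i by (intro pick) (auto simp: M_def)
      then show ?thesis
        using 4 i j c_less \<open>g \<le> k\<close> by (auto simp: H_def Y_def sol_tail)
    qed
  qed (auto simp: M_def Y_def H_def)
  have "det (mat k k (\<lambda>(i, j). T v i j)) = 1"
    by (subst det_upper_triangular[of _ k])
      (auto simp: upper_triangular_def T_lower diag_mat_def prod.list_conv_set_nth)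
  then have "det (M * Y) = det H"
    unfolding prod
    by (subst det_four_block_mat_upper_right_zero[of _ k _ n]) (auto simp: H_def)
  then have "det M * det Y = det H"
    by (simp add: det_mult[OF M Y])
  then show ?thesis
    by (simp add: detM detY H_def mult.assoc)
qed

section \<open>Asymptotics of \<open>p k\<close> for separated moduli\<close>

lemma sol_tendsto:
  assumes "(u \<longlongrightarrow> v) F" "(z \<longlongrightarrow> w) F"
  shows "((\<lambda>k. sol (u k) (z k) i) \<longlongrightarrow> sol v w i) F"
proof (induction "g - i" arbitrary: i rule: less_induct)
  case less
  show ?case
  proof (cases "g \<le> i")
    case True
    then show ?thesis
      by (simp add: sol_tail tendsto_power assms)
  next
    case False
    have "((\<lambda>k. sol (u k) (z k) (i + l)) \<longlongrightarrow> sol v w (i + l)) F" if "l \<in> {1..n}" for l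
      using False that by (intro less) auto
    then have "((\<lambda>k. - (\<Sum>l=1..n. T (u k) i (i + l) * sol (u k) (z k) (i + l)))
        \<longlongrightarrow> - (\<Sum>l=1..n. T v i (i + l) * sol v w (i + l))) F"
      unfolding T_def using assms by (intro tendsto_intros) (auto intro: tendsto_intros)
    then show ?thesis
      using False by (simp add: sol.simps[of _ _ i])
  qed
qed

text \<open>Vanishes iff a nontrivial combination of the \<open>c\<close> solutions is zero at the
  first \<open>c\<close> places, the boundary condition imposed by the missing columns. For
  \<open>g = 0\<close> it is a Vandermonde determinant.\<close>

definition E :: "complex \<Rightarrow> (nat \<Rightarrow> complex) \<Rightarrow> complex" where
  "E v x = det (mat c c (\<lambda>(i, j). sol v (x j) i))"

text \<open>Scaling rows and columns of the right-hand side of \<open>det_identity\<close> by \<open>k\<close>-th powers makes it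
  converge to a block diagonal matrix with blocks \<open>E v x\<close> and a Vandermonde matrix.\<close>

lemma p_asymptotics:
  assumes u: "u \<longlonglongrightarrow> v" and X: "\<And>l. l < n \<Longrightarrow> (\<lambda>k. X k l) \<longlonglongrightarrow> x l"
    and roots: "\<And>k l. l < n \<Longrightarrow> poly (Q (u k)) (X k l) = 0"
    and small: "\<And>l. l < c \<Longrightarrow> cmod (x l) < r" and large: "\<And>l. c \<le> l \<Longrightarrow> l < n \<Longrightarrow> r < cmod (x l)"
    and r: "0 < r" and inj: "inj_on x {c..<n}" and E: "E v x \<noteq> 0"
  obtains L where "L > 0" "(\<lambda>k. cmod (p k (u k)) * (\<Prod>l<c. cmod (X k l) ^ k)
      * cmod (det (mat n n (\<lambda>(i, l). X k l ^ i)))) \<longlonglongrightarrow> L"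
proof -
  define R where "R = complex_of_real r"
  have R: "R \<noteq> 0" "cmod R = r"
    using r by (auto simp: R_def)
  have X0: "X k l \<noteq> 0" if "l < n" for k l
    using roots[OF that, of k] by (metis poly_Q_0 zero_neq_one)
  define H where "H k = (\<lambda>(i, l). if i < c then sol (u k) (X k l) i else X k l ^ (k + i))" for k
  \<comment> \<open>Only rows and columns from \<open>c\<close> on are scaled. The off-diagonal
    blocks then carry \<open>(R / X k l) ^ k\<close> and \<open>(X k l / R) ^ k\<close>, which decay
    because \<open>r\<close> separates the moduli; in the lower right block all \<open>k\<close>-th
    powers cancel.\<close>
  define a where "a k i = (if i < c then 1 else 1 / R ^ k)" for k i
  define b where "b k l = (if l < c then 1 else (R / X k l) ^ k)" for k l
  define G where "G = (\<lambda>(i, l). if i < c then (if l < c then sol v (x l) i else 0)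
    else (if l < c then 0 else x l ^ i))"
  have lim: "(\<lambda>k. det (mat n n (\<lambda>(i, l). a k i * H k (i, l) * b k l))) \<longlonglongrightarrow> det (mat n n G)"
  proof (rule tendsto_det)
    fix i j assume ij: "i < n" "j < n"
    have S: "(\<lambda>k. sol (u k) (X k j) i) \<longlonglongrightarrow> sol v (x j) i"
      by (intro sol_tendsto u X ij)
    consider "i < c" "j < c" | "i < c" "c \<le> j" | "c \<le> i" "j < c" | "c \<le> i" "c \<le> j"
      by linarith
    then show "(\<lambda>k. (\<lambda>(i, l). a k i * H k (i, l) * b k l) (i, j)) \<longlonglongrightarrow> G (i, j)"
    proof cases
      case 1
      then show ?thesis
        using S by (simp add: a_def b_def H_def G_def)
    next
      case 2
      have "x j \<noteq> 0"
        using large[of j] 2 ij r by auto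
      moreover have "cmod (R / x j) < 1"
        using large[of j] 2 ij r by (auto simp: norm_divide R divide_simps)
      ultimately have "(\<lambda>k. (R / X k j) ^ k) \<longlonglongrightarrow> 0"
        using ij by (intro power_seq_tendsto_0[where l = "R / x j"] tendsto_intros X) auto
      from tendsto_mult[OF S this] show ?thesis
        using 2 by (simp add: a_def b_def H_def G_def)
    next
      case 3
      have "cmod (x j / R) < 1"
        using small[of j] 3 ij r by (auto simp: norm_divide R divide_simps)
      then have "(\<lambda>k. (X k j / R) ^ k) \<longlonglongrightarrow> 0"
        using ij R by (intro power_seq_tendsto_0[where l = "x j / R"] tendsto_intros X) auto
      from tendsto_mult[OF this tendsto_power[OF X[OF ij(2)], of i]]
      have "(\<lambda>k. (X k j / R) ^ k * X k j ^ i) \<longlonglongrightarrow> 0"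
        by simp
      then show ?thesis
        using 3 by (simp add: a_def b_def H_def G_def power_add power_divide)
    next
      case 4
      have "1 / R ^ k * X k j ^ (k + i) * (R / X k j) ^ k = X k j ^ i" for k
        using R X0[OF ij(2), of k] by (simp add: power_add power_divide)
      then show ?thesis
        using 4 tendsto_power[OF X[OF ij(2)], of i] by (simp add: a_def b_def H_def G_def)
    qed
  qed
  define V where "V = mat (n - c) (n - c) (\<lambda>(i, l). x (l + c) ^ (i + c))"
  have "mat n n G = four_block_mat (mat c c (\<lambda>(i, j). sol v (x j) i)) (0\<^sub>m c (n - c)) (0\<^sub>m (n - c) c) V"
    using c_less by (intro eq_matI) (auto simp: G_def V_def)
  then have "det (mat n n G) = E v x * det V"
    unfolding E_def by (metis det_four_block_mat_lower_left_zero V_def mat_carrier zero_carrier_mat)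
  moreover have "det V \<noteq> 0"
  proof -
    have "V = mat (n - c) (n - c) (\<lambda>(i, l). 1 * (\<lambda>(i, l). x (l + c) ^ i) (i, l) * x (l + c) ^ c)"
      by (intro eq_matI) (auto simp: V_def power_add)
    then have "det V = det (mat (n - c) (n - c) (\<lambda>(i, l). x (l + c) ^ i)) * (\<Prod>l<n-c. x (l + c) ^ c)"
      using det_scale_rows_cols[of "n - c" "\<lambda>_. 1" "\<lambda>(i, l). x (l + c) ^ i" "\<lambda>l. x (l + c) ^ c"]
      by simp
    moreover have "(\<Prod>l<n-c. x (l + c) ^ c) \<noteq> 0"
    proof -
      have "r < cmod (x (l + c))" if "l < n - c" for l
        using that by (intro large) auto
      then have "x (l + c) \<noteq> 0" if "l < n - c" for l
        using that r by fastforce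
      then show ?thesis
        by simp
    qed
    moreover have "inj_on (\<lambda>l. x (l + c)) {..<n-c}"
    proof (rule inj_onI)
      fix a b assume "a \<in> {..<n-c}" "b \<in> {..<n-c}" "x (a + c) = x (b + c)"
      then show "a = b"
        using inj_onD[OF inj, of "a + c" "b + c"] by auto
    qed
    then have "det (mat (n - c) (n - c) (\<lambda>(i, l). x (l + c) ^ i)) \<noteq> 0"
      by (rule det_vandermonde_nonzero)
    ultimately show ?thesis
      by simp
  qed
  ultimately have nz: "det (mat n n G) \<noteq> 0"
    using E by simp
  show ?thesis
  proof
    show "cmod (det (mat n n G)) > 0"
      using nz by simp
    have ev: "eventually (\<lambda>k. cmod (det (mat n n (\<lambda>(i, l). a k i * H k (i, l) * b k l))) =
        cmod (p k (u k)) * (\<Prod>l<c. cmod (X k l) ^ k) * cmod (det (mat n n (\<lambda>(i, l). X k l ^ i)))) sequentially"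
      using eventually_ge_at_top[of g]
    proof eventually_elim
      case (elim k)
      have split: "(\<Prod>l<n. h l) = (\<Prod>l<c. h l) * (\<Prod>l\<in>{c..<n}. h l)" for h :: "nat \<Rightarrow> complex"
        using c_less by (simp add: lessThan_atLeast0 prod.atLeastLessThan_concat)
      have "det (mat n n (\<lambda>(i, l). a k i * H k (i, l) * b k l))
          = (\<Prod>l\<in>{c..<n}. 1 / R ^ k) * det (mat n n (H k)) * (\<Prod>l\<in>{c..<n}. (R / X k l) ^ k)"
        using det_scale_rows_cols[of n "a k" "H k" "b k"] by (simp add: a_def b_def split)
      also have "\<dots> = det (mat n n (H k)) * (\<Prod>l\<in>{c..<n}. 1 / R ^ k * (R / X k l) ^ k)"
        unfolding prod.distrib by (simp only: mult_ac)
      also have "(\<Prod>l\<in>{c..<n}. 1 / R ^ k * (R / X k l) ^ k) = (\<Prod>l\<in>{c..<n}. 1 / X k l ^ k)"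
        using R by (intro prod.cong) (auto simp: power_divide)
      also have "det (mat n n (H k)) = (-1) ^ (k * c) * p k (u k) * (\<Prod>l<n. X k l ^ k)
          * det (mat n n (\<lambda>(i, l). X k l ^ i))"
        unfolding H_def by (rule det_identity[symmetric]) (auto simp: elim roots)
      also have "(\<Prod>l<n. X k l ^ k) = (\<Prod>l<c. X k l ^ k) * (\<Prod>l\<in>{c..<n}. X k l ^ k)"
        by (rule split)
      finally have "det (mat n n (\<lambda>(i, l). a k i * H k (i, l) * b k l)) =
          (-1) ^ (k * c) * p k (u k) * (\<Prod>l<c. X k l ^ k) * det (mat n n (\<lambda>(i, l). X k l ^ i))
          * ((\<Prod>l\<in>{c..<n}. X k l ^ k) * (\<Prod>l\<in>{c..<n}. 1 / X k l ^ k))"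
        by (simp add: mult_ac)
      also have "(\<Prod>l\<in>{c..<n}. X k l ^ k) * (\<Prod>l\<in>{c..<n}. 1 / X k l ^ k) = 1"
        by (simp add: X0 flip: prod.distrib)
      finally show ?case
        by (simp add: norm_mult norm_power prod_norm[symmetric])
    qed
    show "(\<lambda>k. cmod (p k (u k)) * (\<Prod>l<c. cmod (X k l) ^ k)
      * cmod (det (mat n n (\<lambda>(i, l). X k l ^ i)))) \<longlonglongrightarrow> cmod (det (mat n n G))"
      using Lim_transform_eventually[OF tendsto_norm[OF lim] ev] .
  qed
qed

end

section \<open>Nonvanishing of \<open>E\<close> for large \<open>v\<close>\<close>

text \<open>The coefficients are, up to sign, elementary symmetric functions of degree
  \<open>m - i\<close>. The weight \<open>B ^ i\<close> makes the bound uniform in \<open>i\<close>,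
  and each further linear factor at most doubles it.\<close>

lemma norm_coeff_prod_linear_le:
  fixes x :: "nat \<Rightarrow> complex"
  assumes "\<And>j. j < m \<Longrightarrow> cmod (x j) \<le> B" "0 \<le> B"
  shows "cmod (coeff (\<Prod>j<m. [:- x j, 1:]) i) * B ^ i \<le> 2 ^ m * B ^ m"
  using assms(1)
proof (induction m arbitrary: i)
  case 0
  then show ?case
    by (cases i) (auto simp: coeff_pCons)
next
  case (Suc m)
  let ?p = "\<Prod>j<m. [:- x j, 1:]"
  have IH: "cmod (coeff ?p i) * B ^ i \<le> 2 ^ m * B ^ m" for i
    using Suc by simp
  have low: "cmod (x m * coeff ?p i) * B ^ i \<le> 2 ^ m * B ^ Suc m" for i
  proof -
    have "cmod (x m * coeff ?p i) * B ^ i = cmod (x m) * (cmod (coeff ?p i) * B ^ i)"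
      by (simp add: norm_mult)
    also have "\<dots> \<le> B * (2 ^ m * B ^ m)"
      using Suc.prems assms(2) by (intro mult_mono IH) auto
    finally show ?thesis
      by (simp add: mult_ac)
  qed
  show ?case
  proof (cases i)
    case 0
    have "2 ^ m * B ^ Suc m \<le> 2 ^ Suc m * B ^ Suc m"
      using assms(2) by (intro mult_right_mono) auto
    then show ?thesis
      using order_trans[OF low[of 0]] 0 by simp
  next
    case (Suc i')
    have "cmod (coeff (\<Prod>j<Suc m. [:- x j, 1:]) i) * B ^ i
        = cmod (coeff ?p i' - x m * coeff ?p i) * B ^ i"
      using Suc by (simp add: algebra_simps)
    also have "\<dots> \<le> (cmod (coeff ?p i') + cmod (x m * coeff ?p i)) * B ^ i"
      using assms(2) by (intro mult_right_mono norm_triangle_ineq4) auto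
    also have "\<dots> = B * (cmod (coeff ?p i') * B ^ i') + cmod (x m * coeff ?p i) * B ^ i"
      using Suc by (simp add: algebra_simps)
    also have "\<dots> \<le> B * (2 ^ m * B ^ m) + 2 ^ m * B ^ Suc m"
      using assms(2) by (intro add_mono mult_left_mono IH low) auto
    finally show ?thesis
      by (simp add: mult_ac)
  qed
qed

lemma degree_prod_linear: "degree (\<Prod>j\<in>A. [:- x j, 1:] :: complex poly) = card A"
  by (subst degree_prod_eq_sum_degree) auto

lemma coeff_card_prod_linear: "coeff (\<Prod>j\<in>A. [:- x j, 1:] :: complex poly) (card A) = 1"
  using lead_coeff_prod[of "\<lambda>j. [:- x j, 1:]" A] by (simp add: degree_prod_linear)

text \<open>A difference operator with characteristic polynomial \<open>q\<close> multiplies each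
  exponential by the value of \<open>q\<close> at its base. A \<open>q\<close> vanishing at all
  bases gives a recurrence; one vanishing at all but one base isolates a coefficient.\<close>

lemma sum_coeff_exponential_combination:
  fixes q :: "complex poly"
  assumes "degree q \<le> m"
  shows "(\<Sum>i\<le>m. coeff q i * (\<Sum>j\<in>A. \<kappa> j * x j ^ (a + i))) = (\<Sum>j\<in>A. \<kappa> j * x j ^ a * poly q (x j))"
proof -
  have P: "poly q z = (\<Sum>i\<le>m. coeff q i * z ^ i)" for z
    unfolding poly_altdef using assms by (intro sum.mono_neutral_left) (auto intro: coeff_eq_0)
  show ?thesis
    unfolding P sum_distrib_left sum_distrib_right
    by (subst sum.swap) (simp add: power_add mult_ac)
qed

context banded_toeplitz
begin

definition coeff_bound :: real where
  "coeff_bound = (\<Sum>l=0..n. cmod (s (int l)))"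

lemma norm_s_le: "cmod (s i) \<le> coeff_bound"
proof (cases "i < 0 \<or> i > int n")
  case False
  have "cmod (s (int (nat i))) \<le> coeff_bound"
    unfolding coeff_bound_def using False by (intro member_le_sum) auto
  then show ?thesis
    using False by simp
qed (auto simp: s_out coeff_bound_def sum_nonneg)

lemma coeff_bound_ge_1: "1 \<le> coeff_bound"
  using norm_s_le[of 0] by (simp add: s_0)

text \<open>Chosen so that \<open>root_bound * cmod (s (int n))\<close> exceeds
  \<open>coeff_bound + 1\<close>, the weight of all other terms of \<open>Q v\<close> in
  \<open>norm_root_le\<close>.\<close>

definition root_bound :: real where
  "root_bound = (coeff_bound + 1) / cmod (s (int n)) + 1"

lemma root_bound_ge_1: "1 \<le> root_bound"
  using coeff_bound_ge_1 by (simp add: root_bound_def)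

text \<open>If \<open>cmod z > B\<close>, the term \<open>v * z ^ c\<close> is at most
  \<open>cmod z ^ n / root_bound\<close>, and the terms of degree below \<open>n\<close> add at most
  \<open>coeff_bound\<close> times that; together they cannot cancel the leading term.\<close>

lemma norm_root_le:
  assumes "poly (Q v) z = 0" "1 \<le> cmod v" "0 \<le> B" "B ^ (n - c) = root_bound ^ (n - c) * cmod v"
  shows "cmod z \<le> B"
proof (rule ccontr)
  assume "\<not> cmod z \<le> B"
  then have z: "B < cmod z"
    by simp
  have "root_bound ^ (n - c) \<le> B ^ (n - c)"
    using assms root_bound_ge_1 by simp
  then have "root_bound \<le> B"
    using power_mono_iff[of root_bound B "n - c"] assms(3) root_bound_ge_1 c_less by simp
  then have Kz: "root_bound \<le> cmod z" "1 \<le> cmod z"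
    using z root_bound_ge_1 by auto
  have "root_bound * cmod v \<le> root_bound ^ (n - c) * cmod v"
    using self_le_power[of root_bound "n - c"] root_bound_ge_1 c_less by (intro mult_right_mono) auto
  also have "\<dots> \<le> cmod z ^ (n - c)"
    using power_mono[of B "cmod z" "n - c"] assms(3,4) z by simp
  finally have "root_bound * cmod v * cmod z ^ c \<le> cmod z ^ (n - c) * cmod z ^ c"
    by (intro mult_right_mono) auto
  then have v: "root_bound * (cmod v * cmod z ^ c) \<le> cmod z ^ n"
    using c_less by (simp add: mult_ac flip: power_add)
  have "(\<Sum>l<n. cmod (s (int l)) * cmod z ^ l) \<le> (\<Sum>l<n. cmod (s (int l)) * cmod z ^ (n - 1))"
    using Kz by (intro sum_mono mult_left_mono power_increasing) auto
  also have "\<dots> \<le> coeff_bound * cmod z ^ (n - 1)"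
    unfolding sum_distrib_right[symmetric] coeff_bound_def
    by (intro mult_right_mono sum_mono2) auto
  finally have "root_bound * (\<Sum>l<n. cmod (s (int l)) * cmod z ^ l) \<le> cmod z * (coeff_bound * cmod z ^ (n - 1))"
    using Kz root_bound_ge_1 by (intro mult_mono) (auto intro!: sum_nonneg)
  also have "\<dots> = coeff_bound * cmod z ^ n"
    using c_less power_Suc[of "cmod z" "n - 1"] by (simp add: mult_ac)
  finally have low: "root_bound * (\<Sum>l<n. cmod (s (int l)) * cmod z ^ l) \<le> coeff_bound * cmod z ^ n" .
  have "0 = (\<Sum>l=0..n. s (int l) * z ^ l) - v * z ^ c"
    using assms(1) by (simp add: Qpoly_def poly_sum poly_monom)
  also have "(\<Sum>l=0..n. s (int l) * z ^ l) = s (int n) * z ^ n + (\<Sum>l<n. s (int l) * z ^ l)"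
    by (simp add: atLeast0AtMost atMost_Suc lessThan_Suc_atMost[symmetric] add.commute)
  finally have "s (int n) * z ^ n = v * z ^ c - (\<Sum>l<n. s (int l) * z ^ l)"
    by (simp add: algebra_simps)
  then have "cmod (s (int n)) * cmod z ^ n \<le> cmod (v * z ^ c) + cmod (\<Sum>l<n. s (int l) * z ^ l)"
    by (metis norm_mult norm_power norm_triangle_ineq4)
  also have "\<dots> \<le> cmod v * cmod z ^ c + (\<Sum>l<n. cmod (s (int l)) * cmod z ^ l)"
    by (intro add_mono norm_sum[THEN order_trans]) (auto simp: norm_mult norm_power)
  finally have "root_bound * (cmod (s (int n)) * cmod z ^ n)
      \<le> root_bound * (cmod v * cmod z ^ c + (\<Sum>l<n. cmod (s (int l)) * cmod z ^ l))"
    using root_bound_ge_1 by (intro mult_left_mono) auto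
  also have "\<dots> \<le> cmod z ^ n + coeff_bound * cmod z ^ n"
    using v low by (simp add: distrib_left)
  finally have "(root_bound * cmod (s (int n))) * cmod z ^ n \<le> (1 + coeff_bound) * cmod z ^ n"
    by (simp add: algebra_simps)
  moreover have "0 < cmod z ^ n"
    using Kz by (intro zero_less_power) linarith
  ultimately have "root_bound * cmod (s (int n)) \<le> 1 + coeff_bound"
    by (rule mult_right_le_imp_le)
  moreover have "root_bound * cmod (s (int n)) = coeff_bound + 1 + cmod (s (int n))"
    using s_n by (simp add: root_bound_def field_simps)
  ultimately show False
    using s_n by simp
qed

text \<open>Behind \<open>g\<close>, one step of the recurrence of length \<open>c\<close> sums
  \<open>c\<close> terms with coefficients at most \<open>2 ^ c\<close>, measured in powers of
  \<open>B\<close>; a row reaches at most \<open>n\<close> steps.\<close>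

definition growth :: real where
  "growth = (real c * 2 ^ c) ^ n"

definition row_bound :: real where
  "row_bound = real (Suc n) * coeff_bound * growth"

text \<open>The summands yield \<open>1 \<le> cmod v\<close>, \<open>2 * row_bound < cmod v\<close>
  and, by the definition of \<open>B\<close> below,
  \<open>2 * row_bound * root_bound ^ (n - c) \<le> B\<close>.\<close>

definition large_radius :: real where
  "large_radius = 1 + 2 * row_bound + (2 * row_bound * root_bound ^ (n - c)) ^ (n - c)"

lemma c2_ge_1: "1 \<le> real c * 2 ^ c"
  using c_pos mult_mono[of 1 "real c" 1 "2 ^ c"] by simp

lemma growth_ge_1: "1 \<le> growth"
  unfolding growth_def by (rule one_le_power[OF c2_ge_1])

lemma row_bound_ge_1: "1 \<le> row_bound"
proof -
  have "1 * 1 * 1 \<le> real (Suc n) * coeff_bound * growth"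
    using coeff_bound_ge_1 growth_ge_1 by (intro mult_mono) auto
  then show ?thesis
    by (simp add: row_bound_def)
qed

text \<open>Suppose a combination \<open>y\<close> of the \<open>c\<close> solutions vanishes at the first \<open>c\<close> places. Behind position \<open>g\<close>
  it is governed by its values at \<open>g, \<dots>, g + c - 1\<close>, which are measured by \<open>N\<close> in powers of a bound
  \<open>B\<close> for the zeros, where \<open>B\<close> is of order \<open>|v|\<close> to the power \<open>1 / (n - c)\<close>. A row that reaches across the
  last gap has bandwidth at most \<open>n - 1\<close> in the new numbering, so there the term \<open>v y (i + c)\<close> dominates
  all others. This bounds \<open>N\<close> and \<open>u = max |y i|\<close> over \<open>i < g\<close> by \<open>u\<close> times a multiple of \<open>1 / |v|\<close>.\<close>

theorem E_nonzero_of_large: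
  assumes v: "large_radius < cmod v" and inj: "inj_on x {..<c}"
    and roots: "\<And>j. j < c \<Longrightarrow> poly (Q v) (x j) = 0"
  shows "E v x \<noteq> 0"
proof
  assume "E v x = 0"
  then obtain \<kappa> where \<kappa>: "\<exists>j<c. \<kappa> j \<noteq> 0"
    and ker: "\<And>i. i < c \<Longrightarrow> (\<Sum>j<c. sol v (x j) i * \<kappa> j) = 0"
    unfolding E_def by (rule det_eq_0_imp_kernel) auto
  define y where "y i = (\<Sum>j<c. \<kappa> j * sol v (x j) i)" for i
  have y_tail: "y (g + m) = (\<Sum>j<c. \<kappa> j * x j ^ (g + m))" for m
    by (simp add: y_def sol_tail)
  have y_init: "y i = 0" if "i < c" for i
    using ker[OF that] by (simp add: y_def mult.commute)
  have y_rec: "(\<Sum>l=0..n. T v i (i + l) * y (i + l)) = 0" for i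
  proof -
    have "(\<Sum>l=0..n. T v i (i + l) * y (i + l))
        = (\<Sum>j<c. \<kappa> j * (\<Sum>l=0..n. T v i (i + l) * sol v (x j) (i + l)))"
      unfolding y_def sum_distrib_left by (subst sum.swap) (simp add: mult_ac)
    also have "\<dots> = 0"
      by (intro sum.neutral) (auto simp: T_sol roots)
    finally show ?thesis .
  qed
  have x0: "x j \<noteq> 0" if "j < c" for j
    using roots[OF that] by (metis poly_Q_0 zero_neq_one)
  \<comment> \<open>An exponential sum with distinct nonzero bases cannot vanish at \<open>c\<close>
    consecutive places unless all \<open>\<kappa> j\<close> are zero: \<open>q\<close> removes every
    term except \<open>j0\<close>.\<close>
  have contr: False if zero: "\<And>m. m < c \<Longrightarrow> y (g + m) = 0"
  proof -
    obtain j0 where j0: "j0 < c" "\<kappa> j0 \<noteq> 0"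
      using \<kappa> by blast
    define q where "q = (\<Prod>j\<in>{..<c}-{j0}. [:- x j, 1:])"
    have "degree q \<le> c - 1"
      using j0 by (simp add: q_def degree_prod_linear)
    from sum_coeff_exponential_combination[OF this, of \<kappa> x g "{..<c}"]
    have "(\<Sum>j<c. \<kappa> j * x j ^ g * poly q (x j)) = (\<Sum>i\<le>c - 1. coeff q i * y (g + i))"
      by (simp add: y_tail)
    also have "\<dots> = 0"
      using zero c_pos by (intro sum.neutral) auto
    also have "(\<Sum>j<c. \<kappa> j * x j ^ g * poly q (x j)) = \<kappa> j0 * x j0 ^ g * poly q (x j0)"
      using j0 by (subst sum.remove[of _ j0]) (auto intro!: sum.neutral simp: q_def poly_prod)
    finally have "poly q (x j0) = 0"
      using j0 x0 by simp
    then show False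
      using j0 inj by (auto simp: q_def poly_prod inj_on_def)
  qed
  show False
  proof (cases "g = 0")
    case True
    then show ?thesis
      using y_init by (intro contr) simp
  next
    case False
    then have g: "c \<le> g" "e (g - 1) + 2 \<le> e g"
      using gap by auto
    define B where "B = root (n - c) (root_bound ^ (n - c) * cmod v)"
    have v1: "1 \<le> cmod v" "2 * row_bound < cmod v" "(2 * row_bound * root_bound ^ (n - c)) ^ (n - c) \<le> cmod v"
    proof -
      have "0 \<le> (2 * row_bound * root_bound ^ (n - c)) ^ (n - c)"
        using row_bound_ge_1 root_bound_ge_1 by simp
      then show "1 \<le> cmod v" "2 * row_bound < cmod v" "(2 * row_bound * root_bound ^ (n - c)) ^ (n - c) \<le> cmod v"
        using v row_bound_ge_1 unfolding large_radius_def by linarith+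
    qed
    have Kn: "1 \<le> root_bound ^ (n - c)"
      using root_bound_ge_1 by simp
    have B_pow: "B ^ (n - c) = root_bound ^ (n - c) * cmod v"
      using c_less root_bound_ge_1 by (simp add: B_def)
    have "0 \<le> B"
      using root_bound_ge_1 by (simp add: B_def real_root_ge_zero)
    have "(2 * row_bound * root_bound ^ (n - c)) ^ (n - c) \<le> B ^ (n - c)"
      using v1(3) Kn mult_mono[of 1 "root_bound ^ (n - c)" "(2 * row_bound * root_bound ^ (n - c)) ^ (n - c)" "cmod v"] row_bound_ge_1
      by (simp add: B_pow)
    then have B: "2 * row_bound * root_bound ^ (n - c) \<le> B"
      using power_mono_iff[of "2 * row_bound * root_bound ^ (n - c)" B "n - c"] \<open>0 \<le> B\<close> Kn row_bound_ge_1 c_less by simp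
    have B1: "1 \<le> B"
      using B Kn row_bound_ge_1 mult_mono[of 1 "2 * row_bound" 1 "root_bound ^ (n - c)"] by simp
    have xB: "cmod (x j) \<le> B" if "j < c" for j
      by (rule norm_root_le[OF roots[OF that] v1(1) \<open>0 \<le> B\<close> B_pow])
    define N where "N = Max ((\<lambda>m. cmod (y (g + m)) / B ^ m) ` {..<c})"
    have N_ge: "cmod (y (g + m)) \<le> N * B ^ m" if "m < c" for m
    proof -
      have "cmod (y (g + m)) / B ^ m \<le> N"
        unfolding N_def using that by (intro Max_ge) auto
      then show ?thesis
        using B1 by (simp add: field_simps)
    qed
    obtain m0 where m0: "m0 < c" "N = cmod (y (g + m0)) / B ^ m0"
    proof -
      have "N \<in> (\<lambda>m. cmod (y (g + m)) / B ^ m) ` {..<c}"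
        unfolding N_def using c_pos by (intro Max_in) auto
      then show ?thesis
        using that by auto
    qed
    have "0 \<le> N"
      using m0 B1 by simp
    \<comment> \<open>Behind \<open>g\<close> only the \<open>c\<close> chosen zeros enter
      \<open>y\<close>, so it obeys a recurrence of length \<open>c\<close> instead of
      \<open>n\<close>, and the \<open>c\<close> values measured by \<open>N\<close> control all
      later ones.\<close>
    define q where "q = (\<Prod>j<c. [:- x j, 1:])"
    have q_rec: "y (g + c + m) = - (\<Sum>i<c. coeff q i * y (g + m + i))" for m
    proof -
      have deg: "degree q \<le> c"
        by (simp add: q_def degree_prod_linear)
      have "(\<Sum>i\<le>c. coeff q i * y (g + m + i)) = (\<Sum>j<c. \<kappa> j * x j ^ (g + m) * poly q (x j))"
        using sum_coeff_exponential_combination[OF deg, of \<kappa> x "g + m" "{..<c}"]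
        by (simp add: y_tail add.assoc)
      also have "\<dots> = 0"
        by (intro sum.neutral) (auto simp: q_def poly_prod)
      finally have "(\<Sum>i<c. coeff q i * y (g + m + i)) + coeff q c * y (g + m + c) = 0"
        by (simp flip: lessThan_Suc_atMost)
      moreover have "coeff q c = 1"
        using coeff_card_prod_linear[of x "{..<c}"] by (simp add: q_def)
      ultimately show ?thesis
        by (simp add: eq_neg_iff_add_eq_0 add_ac)
    qed
    have y_le': "cmod (y (g + m)) \<le> N * (real c * 2 ^ c) ^ m * B ^ m" for m
    proof (induction m rule: less_induct)
      case (less m)
      show ?case
      proof (cases "m < c")
        case True
        have "N * B ^ m * 1 \<le> N * B ^ m * (real c * 2 ^ c) ^ m"
          using c2_ge_1 \<open>0 \<le> N\<close> B1 by (intro mult_left_mono) auto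
        then show ?thesis
          using N_ge[OF True] by (simp add: mult_ac)
      next
        case False
        then obtain m' where m': "m = c + m'"
          using le_Suc_ex not_less by blast
        let ?a = "real c * 2 ^ c"
        have "cmod (y (g + m)) \<le> (\<Sum>i<c. cmod (coeff q i * y (g + m' + i)))"
          using q_rec[of m'] norm_sum by (simp add: m' add_ac)
        also have "\<dots> \<le> (\<Sum>i<c. 2 ^ c * N * ?a ^ (m - 1) * B ^ m)"
        proof (rule sum_mono)
          fix i assume "i \<in> {..<c}"
          then have i: "i < c"
            by simp
          have "cmod (coeff q i * y (g + m' + i)) \<le> cmod (coeff q i) * (N * ?a ^ (m' + i) * B ^ (m' + i))"
            using less[of "m' + i"] i by (simp add: norm_mult m' add.assoc mult_left_mono)
          also have "\<dots> = (cmod (coeff q i) * B ^ i) * (N * ?a ^ (m' + i) * B ^ m')"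
            by (simp add: power_add mult_ac)
          also have "\<dots> \<le> (2 ^ c * B ^ c) * (N * ?a ^ (m - 1) * B ^ m')"
          proof (rule mult_mono)
            show "cmod (coeff q i) * B ^ i \<le> 2 ^ c * B ^ c"
              unfolding q_def using xB B1 by (intro norm_coeff_prod_linear_le) auto
            show "N * ?a ^ (m' + i) * B ^ m' \<le> N * ?a ^ (m - 1) * B ^ m'"
              using B1 \<open>0 \<le> N\<close> c2_ge_1 i
              by (intro mult_right_mono mult_left_mono power_increasing) (auto simp: m')
          qed (use B1 \<open>0 \<le> N\<close> c2_ge_1 in auto)
          finally show "cmod (coeff q i * y (g + m' + i)) \<le> 2 ^ c * N * ?a ^ (m - 1) * B ^ m"
            by (simp add: m' power_add mult_ac)
        qed
        also have "\<dots> = N * (?a * ?a ^ (m - 1)) * B ^ m"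
          by (simp add: mult_ac)
        also have "?a * ?a ^ (m - 1) = ?a ^ m"
          using c_pos m' by (metis Suc_diff_1 add_gr_0 power_Suc)
        finally show ?thesis .
      qed
    qed
    have y_le: "cmod (y (g + m)) \<le> N * growth * B ^ m" if "m \<le> n" for m
    proof -
      have "N * (real c * 2 ^ c) ^ m * B ^ m \<le> N * growth * B ^ m"
        unfolding growth_def using that \<open>0 \<le> N\<close> B1 c2_ge_1
        by (intro mult_right_mono mult_left_mono power_increasing) auto
      then show ?thesis
        using y_le' order_trans by blast
    qed
    define u where "u = Max ((\<lambda>i. cmod (y i)) ` {..<g})"
    have u_ge: "cmod (y i) \<le> u" if "i < g" for i
      unfolding u_def using that by (intro Max_ge) auto
    obtain i0 where i0: "i0 < g" "u = cmod (y i0)"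
    proof -
      have "u \<in> (\<lambda>i. cmod (y i)) ` {..<g}"
        unfolding u_def using False by (intro Max_in) auto
      then show ?thesis
        using that by auto
    qed
    have "0 \<le> u"
      using i0 by simp
    \<comment> \<open>Row \<open>i\<close> solved for \<open>v * y (i + c)\<close>. The exponent
      \<open>n - 1 + i - g\<close> bounds how far behind \<open>g\<close> the row reaches, since its
      entry at distance \<open>n\<close> is zero.\<close>
    have row: "cmod v * cmod (y (i + c)) \<le> row_bound * (u + N * B ^ (n - 1 + i - g))" if i: "i < g" for i
    proof -
      define a where "a l = s (int (e (i + l)) - int (e i))" for l
      have "(\<Sum>l=0..n. T v i (i + l) * y (i + l))
          = (\<Sum>l=0..n. a l * y (i + l)) - (\<Sum>l=0..n. if l = c then v * y (i + l) else 0)"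
        unfolding T_def a_def sum_subtractf[symmetric] by (intro sum.cong) (auto simp: algebra_simps)
      then have "v * y (i + c) = (\<Sum>l=0..n. a l * y (i + l))"
        using y_rec[of i] c_less by simp
      then have "cmod v * cmod (y (i + c)) \<le> (\<Sum>l=0..n. cmod (a l * y (i + l)))"
        by (metis norm_mult norm_sum)
      also have "\<dots> \<le> (\<Sum>l=0..n. coeff_bound * growth * (u + N * B ^ (n - 1 + i - g)))"
      proof (rule sum_mono)
        fix l assume "l \<in> {0..n}"
        have a: "cmod (a l) \<le> coeff_bound"
          by (simp add: a_def norm_s_le)
        have u0: "u * 1 \<le> u * growth" "0 \<le> N * growth * B ^ (n - 1 + i - g)"
          using mult_left_mono[OF growth_ge_1 \<open>0 \<le> u\<close>] growth_ge_1 \<open>0 \<le> N\<close> B1 by auto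
        consider "i + l < g" | "g \<le> i + l" "l < n" | "g \<le> i + l" "l = n"
          using \<open>l \<in> {0..n}\<close> by fastforce
        then have "cmod (a l * y (i + l)) \<le> coeff_bound * (growth * (u + N * B ^ (n - 1 + i - g)))"
        proof cases
          case 1
          then have "cmod (y (i + l)) \<le> growth * (u + N * B ^ (n - 1 + i - g))"
            using u_ge[of "i + l"] u0 by (simp add: algebra_simps)
          then show ?thesis
            unfolding norm_mult using a coeff_bound_ge_1 by (intro mult_mono) auto
        next
          case 2
          then obtain m where m: "i + l = g + m"
            using le_Suc_ex by blast
          have "cmod (y (i + l)) \<le> N * growth * B ^ m"
            unfolding m using m 2 i by (intro y_le) simp
          also have "\<dots> \<le> N * growth * B ^ (n - 1 + i - g)"
            using m 2 B1 \<open>0 \<le> N\<close> growth_ge_1 by (intro mult_left_mono power_increasing) auto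
          also have "\<dots> \<le> growth * (u + N * B ^ (n - 1 + i - g))"
            using growth_ge_1 \<open>0 \<le> u\<close> by (simp add: algebra_simps)
          finally show ?thesis
            unfolding norm_mult using a coeff_bound_ge_1 by (intro mult_mono) auto
        next
          case 3
          \<comment> \<open>The step from \<open>g - 1\<close> to \<open>g\<close> skips a deleted
            index, so \<open>e (i + n)\<close> is more than \<open>n\<close> away from
            \<open>e i\<close> and the entry falls outside the band.\<close>
          have "e i + (g - 1 - i) \<le> e (g - 1)"
            using e_add_le[of i "g - 1 - i"] i by simp
          moreover have "e g + (i + n - g) \<le> e (i + n)"
            using e_add_le[of g "i + n - g"] 3 by simp
          ultimately have "e i + n < e (i + n)"
            using g(2) 3 i by linarith
          then have "a l = 0"
            using 3 unfolding a_def by (intro s_out) auto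
          then show ?thesis
            using coeff_bound_ge_1 growth_ge_1 \<open>0 \<le> u\<close> \<open>0 \<le> N\<close> B1 by simp
        qed
        then show "cmod (a l * y (i + l)) \<le> coeff_bound * growth * (u + N * B ^ (n - 1 + i - g))"
          by (simp add: mult.assoc)
      qed
      also have "\<dots> = row_bound * (u + N * B ^ (n - 1 + i - g))"
        by (simp add: row_bound_def mult_ac)
      finally show ?thesis .
    qed
    have BK: "B ^ (n - 1 - c) * B = root_bound ^ (n - c) * cmod v"
    proof -
      have "n - c = Suc (n - 1 - c)"
        using c_less by simp
      then show ?thesis
        using B_pow by (metis power_Suc2)
    qed
    have N_le: "cmod v * N \<le> 2 * row_bound * u"
    proof -
      \<comment> \<open>The row whose dominating term sits where \<open>N\<close> is attained. It
        exists because \<open>c \<le> g\<close>, and it lies before \<open>g\<close> because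
        \<open>m0 < c\<close>.\<close>
      define i where "i = g + m0 - c"
      have i: "i < g" "i + c = g + m0" "n - 1 + i - g = m0 + (n - 1 - c)"
        using m0 g(1) c_less by (auto simp: i_def)
      have Bm: "1 \<le> B ^ m0"
        using B1 by simp
      have "cmod v * (N * B ^ m0) \<le> row_bound * (u + N * B ^ (m0 + (n - 1 - c)))"
      proof -
        have "N * B ^ m0 = cmod (y (g + m0))"
          using m0(2) B1 by simp
        then show ?thesis
          using row[OF i(1)] unfolding i(2,3) by presburger
      qed
      also have "\<dots> \<le> row_bound * (u * B ^ m0 + N * B ^ (m0 + (n - 1 - c)))"
        using row_bound_ge_1 mult_left_mono[OF Bm \<open>0 \<le> u\<close>] by (intro mult_left_mono) auto
      also have "\<dots> = (row_bound * (u + N * B ^ (n - 1 - c))) * B ^ m0"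
        by (simp add: power_add algebra_simps)
      finally have "cmod v * N \<le> row_bound * (u + N * B ^ (n - 1 - c))"
        using B1 by (simp add: mult.assoc[symmetric])
      \<comment> \<open>This is where the lost unit of bandwidth counts:
        \<open>B ^ (n - 1 - c)\<close> is one power of \<open>B\<close> below the order of
        \<open>v\<close>, so the term with \<open>N\<close> is absorbed by the left side.\<close>
      moreover have "2 * (row_bound * (N * B ^ (n - 1 - c))) \<le> cmod v * N"
      proof -
        have "2 * row_bound * root_bound ^ (n - c) * (N * B ^ (n - 1 - c)) \<le> B * (N * B ^ (n - 1 - c))"
          using B \<open>0 \<le> N\<close> B1 by (intro mult_right_mono) auto
        also have "\<dots> = root_bound ^ (n - c) * (cmod v * N)"
          using BK by (metis mult.commute mult.left_commute)
        finally have "root_bound ^ (n - c) * (2 * (row_bound * (N * B ^ (n - 1 - c)))) \<le> root_bound ^ (n - c) * (cmod v * N)"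
          by (simp add: mult_ac)
        then show ?thesis
          using Kn by (simp add: mult_le_cancel_left)
      qed
      ultimately show ?thesis
        by (simp add: algebra_simps)
    qed
    have NB: "N * B ^ (n - 1 - c) \<le> u"
    proof -
      have "N * B ^ (n - 1 - c) * B = root_bound ^ (n - c) * (cmod v * N)"
        using BK by (simp add: mult_ac)
      also have "\<dots> \<le> root_bound ^ (n - c) * (2 * row_bound * u)"
        using N_le Kn by (intro mult_left_mono) auto
      also have "\<dots> = 2 * row_bound * root_bound ^ (n - c) * u"
        by simp
      also have "\<dots> \<le> B * u"
        using B \<open>0 \<le> u\<close> by (rule mult_right_mono)
      finally have "N * B ^ (n - 1 - c) * B \<le> u * B"
        by (simp only: mult.commute[of B u])
      then show ?thesis
        using B1 by simp
    qed
    have "cmod v * u \<le> 2 * row_bound * u"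
    proof (cases "i0 < c")
      case True
      then show ?thesis
        using i0 y_init by simp
    next
      case False
      define i where "i = i0 - c"
      have i: "i < g" "i + c = i0" "n - 1 + i - g \<le> n - 1 - c"
        using i0 False c_pos c_less by (auto simp: i_def)
      have "cmod v * u \<le> row_bound * (u + N * B ^ (n - 1 + i - g))"
        using row[OF i(1)] i(2) i0 by simp
      also have "\<dots> \<le> row_bound * (u + N * B ^ (n - 1 - c))"
        using i(3) row_bound_ge_1 B1 \<open>0 \<le> N\<close> by (intro mult_left_mono add_left_mono power_increasing) auto
      also have "\<dots> \<le> row_bound * (u + u)"
        using NB row_bound_ge_1 by (intro mult_left_mono add_left_mono) auto
      finally show ?thesis
        by simp
    qed
    then have "u = 0"
      using v1(2) \<open>0 \<le> u\<close> by (simp add: mult_le_cancel_right)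
    then have "N = 0"
    proof -
      have "cmod v * N \<le> 0"
        using N_le \<open>u = 0\<close> by simp
      moreover have "1 * N \<le> cmod v * N"
        using v1(1) \<open>0 \<le> N\<close> by (rule mult_right_mono)
      ultimately show ?thesis
        using \<open>0 \<le> N\<close> by simp
    qed
    then have "y (g + m) = 0" if "m < c" for m
      using N_ge[OF that] by simp
    then show False
      by (rule contr)
  qed
qed

end

lemma poly_eq_smult_prod_linear:
  fixes q :: "complex poly"
  assumes "degree q = m" "inj_on x {..<m}" "\<And>l. l < m \<Longrightarrow> poly q (x l) = 0"
  shows "q = Polynomial.smult (lead_coeff q) (\<Prod>l<m. [:- x l, 1:])"
proof (rule ccontr)
  define r where "r = q - Polynomial.smult (lead_coeff q) (\<Prod>l<m. [:- x l, 1:])"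
  assume "\<not> ?thesis"
  then have "r \<noteq> 0"
    by (simp add: r_def)
  have "degree r \<le> m"
    unfolding r_def using assms(1)
    by (intro degree_diff_le order_trans[OF degree_smult_le]) (auto simp: degree_prod_linear)
  moreover have "coeff r m = 0"
    using coeff_card_prod_linear[of x "{..<m}"] assms(1) by (simp add: r_def)
  ultimately have "degree r < m"
    using \<open>r \<noteq> 0\<close> by (metis leading_coeff_0_iff le_neq_implies_less)
  have "x ` {..<m} \<subseteq> {z. poly r z = 0}"
    using assms(3) by (auto simp: r_def poly_prod)
  then have "m \<le> card {z. poly r z = 0}"
    using card_mono[OF poly_roots_finite[OF \<open>r \<noteq> 0\<close>], of "x ` {..<m}"] card_image[OF assms(2)]
    by simp
  then show False
    using card_poly_roots_bound[OF \<open>r \<noteq> 0\<close>] \<open>degree r < m\<close> by simp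
qed

context banded_toeplitz
begin

lemma root_nonzero: "poly (Q v) z = 0 \<Longrightarrow> z \<noteq> 0"
  using poly_Q_0[of v] by auto

lemma Q_root_iff: "z \<noteq> 0 \<Longrightarrow> poly (Q v) z = 0 \<longleftrightarrow> symbol n c s z = v"
  by (simp add: poly_Qpoly)

lemma lead_coeff_Q: "lead_coeff (Q v) = s (int n)"
  using degree_Qpoly[OF c_pos c_less s_0 s_n, of v] c_less
  by (simp add: Qpoly_def coeff_sum coeff_monom)

section \<open>Parametrisation of the zeros\<close>

text \<open>Near \<open>a\<close>, \<open>symbol n c s z - v0\<close> is \<open>(z - a) ^ m\<close>
  times a zero-free factor. An \<open>m\<close>-th root of that factor gives \<open>\<phi>\<close>
  with \<open>\<phi> z ^ m = symbol n c s z - v0\<close> and nonzero derivative at \<open>a\<close>;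
  \<open>\<psi>\<close> is its local inverse.\<close>

lemma local_branch:
  assumes a: "poly (Q v0) a = 0" and "0 < \<epsilon>"
  obtains \<rho> \<psi> where "0 < \<rho>" "\<psi> holomorphic_on ball 0 \<rho>" "inj_on \<psi> (ball 0 \<rho>)"
    "\<And>w. w \<in> ball 0 \<rho> \<Longrightarrow> \<psi> w \<in> ball a \<epsilon>"
    "\<And>w. w \<in> ball 0 \<rho> \<Longrightarrow> poly (Q (v0 + w ^ order a (Q v0))) (\<psi> w) = 0"
proof -
  define m where "m = order a (Q v0)"
  have m: "0 < m"
    using a order_root[of "Q v0" a] by (auto simp: m_def)
  obtain q where q: "Q v0 = [:- a, 1:] ^ m * q" "\<not> [:- a, 1:] dvd q"
    using order_decomp[OF Q_nonzero, of v0 a] by (auto simp: m_def)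
  have qa: "poly q a \<noteq> 0"
    using q(2) by (simp add: poly_eq_0_iff_dvd)
  have a0: "a \<noteq> 0"
    by (rule root_nonzero[OF a])
  define U where "U = {z. poly q z \<noteq> 0} \<inter> (- {0}) \<inter> ball a \<epsilon>"
  have "open {z. poly q z \<noteq> 0}"
    by (intro open_Collect_neq continuous_intros)
  then have "open U"
    by (auto simp: U_def intro!: open_Int)
  moreover have "a \<in> U"
    using qa a0 \<open>0 < \<epsilon>\<close> by (simp add: U_def)
  ultimately obtain r1 where r1: "0 < r1" "ball a r1 \<subseteq> U"
    using open_contains_ball by blast
  have "(\<lambda>z. poly q z / z ^ c) holomorphic_on ball a r1"
    using r1 by (auto simp: U_def intro!: holomorphic_intros)
  moreover have "poly q z / z ^ c \<noteq> 0" if "z \<in> ball a r1" for z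
    using r1 that by (auto simp: U_def)
  ultimately obtain L where L: "L holomorphic_on ball a r1"
    "\<And>z. z \<in> ball a r1 \<Longrightarrow> exp (L z) = poly q z / z ^ c"
    using holomorphic_logarithm_exists[of "ball a r1" "\<lambda>z. poly q z / z ^ c" a] r1(1) by auto
  define \<phi> where "\<phi> z = (z - a) * exp (L z / of_nat m)" for z
  have hol: "\<phi> holomorphic_on ball a r1"
    unfolding \<phi>_def using m by (intro holomorphic_intros L) auto
  have \<phi>_pow: "poly (Q (v0 + \<phi> z ^ m)) z = 0" if z: "z \<in> ball a r1" for z
  proof -
    have z0: "z \<noteq> 0"
      using r1 z by (auto simp: U_def)
    have "exp (L z / of_nat m) ^ m = exp (L z)"
      using m by (simp flip: exp_of_nat_mult)
    then have "\<phi> z ^ m = (z - a) ^ m * (poly q z / z ^ c)"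
      using L(2)[OF z] by (simp add: \<phi>_def power_mult_distrib)
    also have "\<dots> = poly (Q v0) z / z ^ c"
      by (simp add: q(1))
    also have "\<dots> = symbol n c s z - v0"
      using z0 by (simp add: poly_Qpoly)
    finally show ?thesis
      using Q_root_iff[OF z0] by simp
  qed
  have "(\<phi> has_field_derivative (exp (L a / of_nat m))) (at a)"
  proof -
    have "L field_differentiable at a"
      using L(1) r1(1) by (metis centre_in_ball holomorphic_on_imp_differentiable_at open_ball)
    then have "(L has_field_derivative deriv L a) (at a)"
      by (simp add: field_differentiable_derivI)
    then show ?thesis
      unfolding \<phi>_def using m by (auto intro!: derivative_eq_intros)
  qed
  then have "deriv \<phi> a \<noteq> 0"
    by (simp add: DERIV_imp_deriv)
  with r1(1) obtain r where r: "0 < r" "ball a r \<subseteq> ball a r1" "open (\<phi> ` ball a r)" "inj_on \<phi> (ball a r)"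
    using has_complex_derivative_locally_invertible[OF hol, of a] by auto
  obtain \<psi> where \<psi>: "\<psi> holomorphic_on \<phi> ` ball a r" "\<And>z. z \<in> ball a r \<Longrightarrow> \<psi> (\<phi> z) = z"
    using holomorphic_has_inverse[OF holomorphic_on_subset[OF hol r(2)] open_ball r(4)] by metis
  have "0 \<in> \<phi> ` ball a r"
    using r(1) by (intro image_eqI[of _ _ a]) (auto simp: \<phi>_def)
  then obtain \<rho> where \<rho>: "0 < \<rho>" "ball 0 \<rho> \<subseteq> \<phi> ` ball a r"
    using r(3) open_contains_ball by blast
  have ex: "\<exists>z\<in>ball a r. w = \<phi> z \<and> \<psi> w = z" if "w \<in> ball 0 \<rho>" for w
    using \<rho>(2) \<psi>(2) that by blast
  show ?thesis
  proof (rule that[of \<rho> \<psi>])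
    show "\<psi> holomorphic_on ball 0 \<rho>"
      using \<psi>(1) \<rho>(2) holomorphic_on_subset by blast
    show "inj_on \<psi> (ball 0 \<rho>)"
      using ex by (metis inj_onI)
    fix w :: complex assume w: "w \<in> ball 0 \<rho>"
    then obtain z where z: "z \<in> ball a r" "w = \<phi> z" "\<psi> w = z"
      using ex by blast
    then have "z \<in> ball a r1" "z \<in> U"
      using r(2) r1(2) by auto
    then show "\<psi> w \<in> ball a \<epsilon>" "poly (Q (v0 + w ^ order a (Q v0))) (\<psi> w) = 0"
      using z \<phi>_pow by (auto simp: U_def m_def)
  qed (use \<rho> in auto)
qed

text \<open>Puiseux expansion. Since the equation has the form \<open>f(z) = v\<close>, near a zero of multiplicity \<open>m\<close> it reads
  \<open>\<phi>(z)\<^sup>m = v - v0\<close> with \<open>\<phi>\<close> conformal, so after \<open>v = v0 + t\<^sup>N\<close> with \<open>N = n!\<close> all branches are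
  holomorphic in \<open>t\<close>.\<close>

lemma uniformization:
  obtains N :: nat and \<delta> :: real and \<zeta> :: "nat \<Rightarrow> complex \<Rightarrow> complex"
  where "0 < N" "0 < \<delta>" "\<And>l. l < n \<Longrightarrow> \<zeta> l holomorphic_on ball 0 \<delta>"
    "\<And>t. t \<in> ball 0 \<delta> \<Longrightarrow> Q (v0 + t ^ N) = Polynomial.smult (s (int n)) (\<Prod>l<n. [:- \<zeta> l t, 1:])"
    "\<And>t. t \<in> ball 0 \<delta> \<Longrightarrow> t \<noteq> 0 \<Longrightarrow> inj_on (\<lambda>l. \<zeta> l t) {..<n}"
proof -
  define Z where "Z = {z. poly (Q v0) z = 0}"
  define m where "m a = order a (Q v0)" for a
  have finZ: "finite Z"
    unfolding Z_def by (rule poly_roots_finite) simp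
  have m_pos: "0 < m a" if "a \<in> Z" for a
    using that order_root[of "Q v0" a] by (auto simp: m_def Z_def)
  have m_dvd: "m a dvd fact n" if "a \<in> Z" for a
  proof (rule dvd_fact)
    show "m a \<le> n"
      using order_degree[OF Q_nonzero, of a v0] degree_Qpoly[OF c_pos c_less s_0 s_n, of v0]
      by (simp add: m_def)
  qed (use m_pos[OF that] in simp)
  have sum_m: "(\<Sum>a\<in>Z. m a) = n"
    using size_proots_complex[of "Q v0"] degree_Qpoly[OF c_pos c_less s_0 s_n, of v0]
    by (simp add: size_multiset_overloaded_eq m_def Z_def)
  \<comment> \<open>Discs of radius \<open>\<epsilon>\<close> about different zeros are disjoint, so
    branches from different zeros never meet.\<close>
  obtain \<epsilon> where \<epsilon>: "0 < \<epsilon>" "\<And>a b. a \<in> Z \<Longrightarrow> b \<in> Z \<Longrightarrow> a \<noteq> b \<Longrightarrow> 2 * \<epsilon> \<le> dist a b"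
  proof -
    define D where "D = insert 1 ((\<lambda>(a, b). dist a b) ` {(a, b). a \<in> Z \<and> b \<in> Z \<and> a \<noteq> b})"
    have "finite {(a, b). a \<in> Z \<and> b \<in> Z \<and> a \<noteq> b}"
      by (rule finite_subset[of _ "Z \<times> Z"]) (auto simp: finZ)
    then have fin: "finite D"
      by (simp add: D_def)
    show ?thesis
    proof (rule that[of "Min D / 2"])
      have "Min D \<in> D"
        using fin by (intro Min_in) (auto simp: D_def)
      then show "0 < Min D / 2"
        by (auto simp: D_def)
      fix a b assume "a \<in> Z" "b \<in> Z" "a \<noteq> b"
      then have "dist a b \<in> D"
        by (auto simp: D_def)
      then show "2 * (Min D / 2) \<le> dist a b"
        using fin by simp
    qed
  qed
  have "\<forall>a\<in>Z. \<exists>\<rho> \<psi>. 0 < \<rho> \<and> \<psi> holomorphic_on ball 0 \<rho> \<and> inj_on \<psi> (ball 0 \<rho>) \<and>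
      (\<forall>w\<in>ball 0 \<rho>. \<psi> w \<in> ball a \<epsilon> \<and> poly (Q (v0 + w ^ m a)) (\<psi> w) = 0)"
  proof
    fix a assume "a \<in> Z"
    then have "poly (Q v0) a = 0"
      by (simp add: Z_def)
    from local_branch[OF this \<epsilon>(1)] show "\<exists>\<rho> \<psi>. 0 < \<rho> \<and> \<psi> holomorphic_on ball 0 \<rho> \<and> inj_on \<psi> (ball 0 \<rho>) \<and>
      (\<forall>w\<in>ball 0 \<rho>. \<psi> w \<in> ball a \<epsilon> \<and> poly (Q (v0 + w ^ m a)) (\<psi> w) = 0)"
      unfolding m_def by metis
  qed
  then obtain \<rho> where "\<forall>a\<in>Z. \<exists>\<psi>. 0 < \<rho> a \<and> \<psi> holomorphic_on ball 0 (\<rho> a) \<and> inj_on \<psi> (ball 0 (\<rho> a)) \<and>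
      (\<forall>w\<in>ball 0 (\<rho> a). \<psi> w \<in> ball a \<epsilon> \<and> poly (Q (v0 + w ^ m a)) (\<psi> w) = 0)"
    by (rule bchoice[THEN exE])
  then obtain \<psi> where \<psi>: "\<forall>a\<in>Z. 0 < \<rho> a \<and> \<psi> a holomorphic_on ball 0 (\<rho> a) \<and> inj_on (\<psi> a) (ball 0 (\<rho> a)) \<and>
      (\<forall>w\<in>ball 0 (\<rho> a). \<psi> a w \<in> ball a \<epsilon> \<and> poly (Q (v0 + w ^ m a)) (\<psi> a w) = 0)"
    by (rule bchoice[THEN exE])
  define N :: nat where "N = fact n"
  define \<delta> where "\<delta> = Min (insert 1 (\<rho> ` Z))"
  have \<delta>: "0 < \<delta>" "\<delta> \<le> 1" "\<And>a. a \<in> Z \<Longrightarrow> \<delta> \<le> \<rho> a"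
  proof -
    have "\<delta> \<in> insert 1 (\<rho> ` Z)"
      unfolding \<delta>_def by (rule Min_in) (use finZ in auto)
    then show "0 < \<delta>"
      using \<psi> by auto
    show "\<delta> \<le> 1" "\<And>a. a \<in> Z \<Longrightarrow> \<delta> \<le> \<rho> a"
      unfolding \<delta>_def using finZ by auto
  qed
  \<comment> \<open>One index per branch: a zero \<open>a\<close> carries \<open>m a\<close>
    branches, told apart by an \<open>m a\<close>-th root of unity \<open>\<omega>\<close>. Putting
    \<open>w = \<omega> * t ^ (N div m a)\<close> gives \<open>w ^ m a = t ^ N\<close>.\<close>
  define I where "I = (SIGMA a:Z. {\<omega>::complex. \<omega> ^ m a = 1})"
  have "card I = (\<Sum>a\<in>Z. card {\<omega>::complex. \<omega> ^ m a = 1})"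
    unfolding I_def using finZ m_pos by (intro card_SigmaI) (auto intro: finite_roots_unity)
  also have "\<dots> = n"
    unfolding sum_m[symmetric] by (intro sum.cong refl card_roots_unity_eq m_pos)
  finally have "card I = n" .
  moreover have "finite I"
    unfolding I_def using finZ m_pos by (intro finite_SigmaI) (auto intro: finite_roots_unity)
  ultimately obtain h where h: "bij_betw h {..<n} I"
    by (metis bij_betw_iff_card card_lessThan finite_lessThan)
  define \<eta> where "\<eta> l t = snd (h l) * t ^ (N div m (fst (h l)))" for l t
  define \<zeta> where "\<zeta> l t = \<psi> (fst (h l)) (\<eta> l t)" for l t
  have h_in: "fst (h l) \<in> Z" "snd (h l) ^ m (fst (h l)) = 1" if "l < n" for l
    using bij_betwE[OF h, rule_format, of l] that by (auto simp: I_def)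
  have \<eta>_in: "\<eta> l t \<in> ball 0 (\<rho> (fst (h l)))" if l: "l < n" and t: "t \<in> ball 0 \<delta>" for l t
  proof -
    let ?a = "fst (h l)"
    have "cmod (snd (h l)) = 1"
      using h_in[OF l] m_pos by (metis norm_power norm_one power_eq_1_iff norm_ge_zero less_irrefl)
    moreover have "cmod t ^ (N div m ?a) \<le> cmod t"
    proof -
      have "0 < N div m ?a"
        using m_dvd[OF h_in(1)[OF l]] m_pos[OF h_in(1)[OF l]]
        by (simp add: N_def div_greater_zero_iff dvd_imp_le)
      then show ?thesis
        using power_decreasing[of 1 "N div m ?a" "cmod t"] t \<delta>(2) by simp
    qed
    ultimately show ?thesis
      using t \<delta>(3)[OF h_in(1)[OF l]] by (simp add: \<eta>_def norm_mult norm_power)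
  qed
  have \<zeta>_hol: "\<zeta> l holomorphic_on ball 0 \<delta>" if l: "l < n" for l
  proof -
    have "(\<psi> (fst (h l)) \<circ> \<eta> l) holomorphic_on ball 0 \<delta>"
    proof (rule holomorphic_on_compose_gen)
      show "\<eta> l holomorphic_on ball 0 \<delta>"
        unfolding \<eta>_def by (intro holomorphic_intros)
      show "\<psi> (fst (h l)) holomorphic_on ball 0 (\<rho> (fst (h l)))"
        using \<psi> h_in(1)[OF l] by blast
      show "\<eta> l ` ball 0 \<delta> \<subseteq> ball 0 (\<rho> (fst (h l)))"
        using \<eta>_in[OF l] by blast
    qed
    then show ?thesis
      by (simp add: \<zeta>_def[abs_def] o_def)
  qed
  have \<zeta>_root: "poly (Q (v0 + t ^ N)) (\<zeta> l t) = 0" if l: "l < n" and t: "t \<in> ball 0 \<delta>" for l t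
  proof -
    have "\<eta> l t ^ m (fst (h l)) = t ^ N"
      using h_in[OF l] m_dvd by (simp add: \<eta>_def power_mult_distrib N_def flip: power_mult)
    then show ?thesis
      using \<psi> h_in(1)[OF l] \<eta>_in[OF l t] unfolding \<zeta>_def by metis
  qed
  have \<zeta>_inj: "inj_on (\<lambda>l. \<zeta> l t) {..<n}" if t: "t \<in> ball 0 \<delta>" "t \<noteq> 0" for t
  proof (rule inj_onI)
    fix l l' assume "l \<in> {..<n}" "l' \<in> {..<n}" and eq: "\<zeta> l t = \<zeta> l' t"
    then have l: "l < n" "l' < n"
      by auto
    have "\<zeta> l t \<in> ball (fst (h l)) \<epsilon>" "\<zeta> l' t \<in> ball (fst (h l')) \<epsilon>"
      using \<psi> h_in(1) \<eta>_in t(1) l unfolding \<zeta>_def by blast+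
    then have "dist (fst (h l)) (fst (h l')) < 2 * \<epsilon>"
      using eq dist_triangle2[of "fst (h l)" "fst (h l')" "\<zeta> l' t"] by simp
    then have a: "fst (h l) = fst (h l')"
      using \<epsilon>(2) h_in(1) l by fastforce
    have "inj_on (\<psi> (fst (h l))) (ball 0 (\<rho> (fst (h l))))"
      using \<psi> h_in(1)[OF l(1)] by blast
    then have "\<eta> l t = \<eta> l' t"
      using eq a \<eta>_in[OF l(1) t(1)] \<eta>_in[OF l(2) t(1)] by (auto simp: \<zeta>_def dest: inj_onD)
    then have "snd (h l) = snd (h l')"
      using a t(2) by (simp add: \<eta>_def)
    with a have "h l = h l'"
      by (simp add: prod_eq_iff)
    then show "l = l'"
      using h l by (auto simp: bij_betw_def dest: inj_onD)
  qed
  have fact_nz: "Q (v0 + t ^ N) = Polynomial.smult (s (int n)) (\<Prod>l<n. [:- \<zeta> l t, 1:])"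
    if "t \<in> ball 0 \<delta>" "t \<noteq> 0" for t
    using poly_eq_smult_prod_linear[OF degree_Qpoly[OF c_pos c_less s_0 s_n, of "v0 + t ^ N"] \<zeta>_inj[OF that]]
      \<zeta>_root[OF _ that(1)] by (simp only: lead_coeff_Q)
  \<comment> \<open>At the centre branches may coincide, and the factorisation follows by continuity
    in \<open>t\<close> instead of counting distinct zeros.\<close>
  have fact_0: "Q (v0 + 0 ^ N) = Polynomial.smult (s (int n)) (\<Prod>l<n. [:- \<zeta> l 0, 1:])"
  proof (rule poly_eq_poly_eq_iff[THEN iffD1], rule ext)
    fix z
    have lim1: "((\<lambda>t. poly (Q (v0 + t ^ N)) z) \<longlongrightarrow> poly (Q (v0 + 0 ^ N)) z) (at 0)"
      unfolding poly_Q by (intro tendsto_sum tendsto_mult tendsto_diff tendsto_const)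
        (auto intro!: tendsto_eq_intros)
    have lim2: "((\<lambda>t. s (int n) * (\<Prod>l<n. z - \<zeta> l t)) \<longlongrightarrow> s (int n) * (\<Prod>l<n. z - \<zeta> l 0)) (at 0)"
    proof -
      have "(\<zeta> l \<longlongrightarrow> \<zeta> l 0) (at 0)" if "l < n" for l
        using holomorphic_on_imp_continuous_on[OF \<zeta>_hol[OF that]] \<delta>(1)
        by (metis centre_in_ball continuous_on_eq_continuous_at isCont_def open_ball)
      then show ?thesis
        by (intro tendsto_intros) auto
    qed
    have ev: "\<forall>\<^sub>F t in at 0. s (int n) * (\<Prod>l<n. z - \<zeta> l t) = poly (Q (v0 + t ^ N)) z"
      unfolding eventually_at using \<delta>(1) fact_nz
      by (intro exI[of _ \<delta>]) (auto simp: poly_prod)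
    have "poly (Q (v0 + 0 ^ N)) z = s (int n) * (\<Prod>l<n. z - \<zeta> l 0)"
      by (rule tendsto_unique[OF trivial_limit_at lim1 Lim_transform_eventually[OF lim2 ev]])
    then show "poly (Q (v0 + 0 ^ N)) z = poly (Polynomial.smult (s (int n)) (\<Prod>l<n. [:- \<zeta> l 0, 1:])) z"
      by (simp add: poly_prod)
  qed
  show ?thesis
  proof (rule that[of N \<delta> \<zeta>])
    show "Q (v0 + t ^ N) = Polynomial.smult (s (int n)) (\<Prod>l<n. [:- \<zeta> l t, 1:])" if "t \<in> ball 0 \<delta>" for t
      using fact_nz[OF that] fact_0 by (cases "t = 0") auto
  qed (use \<delta> \<zeta>_hol \<zeta>_inj in \<open>auto simp: N_def\<close>)
qed

end

lemma holomorphic_on_det: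
  fixes f :: "complex \<Rightarrow> nat \<times> nat \<Rightarrow> complex"
  assumes "\<And>i j. i < m \<Longrightarrow> j < m \<Longrightarrow> (\<lambda>t. f t (i, j)) holomorphic_on A"
  shows "(\<lambda>t. det (mat m m (f t))) holomorphic_on A"
proof -
  have "(\<lambda>t. det (mat m m (f t)))
      = (\<lambda>t. \<Sum>q | q permutes {0..<m}. signof q * (\<Prod>i = 0..<m. mat m m (f t) $$ (i, q i)))"
    unfolding det_def'[OF mat_carrier] ..
  moreover have "(\<lambda>t. mat m m (f t) $$ (i, q i)) holomorphic_on A"
    if "q permutes {0..<m}" "i \<in> {0..<m}" for q i
  proof -
    have "q i \<in> {0..<m}"
      using permutes_in_image[OF that(1)] that(2) by blast
    then show ?thesis
      using that(2) assms[of i "q i"] by simp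
  qed
  ultimately show ?thesis
    by (auto intro!: holomorphic_intros)
qed

lemma holomorphic_zero_or_nonzero_near:
  fixes f :: "complex \<Rightarrow> complex"
  assumes f: "f holomorphic_on ball a r" and r: "0 < r"
  shows "(\<forall>z\<in>ball a r. f z = 0) \<or> (\<exists>\<rho>>0. \<rho> \<le> r \<and> (\<forall>z\<in>ball a \<rho> - {a}. f z \<noteq> 0))"
proof (rule disjCI)
  assume "\<not> (\<exists>\<rho>>0. \<rho> \<le> r \<and> (\<forall>z\<in>ball a \<rho> - {a}. f z \<noteq> 0))"
  then have no: "\<not> (\<forall>z\<in>ball a \<rho> - {a}. f z \<noteq> 0)" if "0 < \<rho>" "\<rho> \<le> r" for \<rho>
    using that by blast
  have "f a = 0"
  proof (rule ccontr)
    assume "f a \<noteq> 0"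
    have "isCont f a"
      using holomorphic_on_imp_continuous_on[OF f] r
      by (metis centre_in_ball continuous_on_eq_continuous_at open_ball)
    then obtain d where d: "0 < d" "\<And>z. dist a z < d \<Longrightarrow> f z \<noteq> 0"
      using continuous_at_avoid[of a f 0] \<open>f a \<noteq> 0\<close> by blast
    show False
      using no[of "min d r"] d r by auto
  qed
  show "\<forall>z\<in>ball a r. f z = 0"
  proof (rule ccontr)
    assume "\<not> ?thesis"
    then obtain \<beta> where \<beta>: "\<beta> \<in> ball a r" "f \<beta> \<noteq> 0"
      by blast
    obtain \<rho> where \<rho>: "0 < \<rho>" "ball a \<rho> \<subseteq> ball a r" "\<And>z. z \<in> ball a \<rho> - {a} \<Longrightarrow> f z \<noteq> 0"
      using isolated_zeros[OF f open_ball connected_ball _ \<open>f a = 0\<close> \<beta>] r by auto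
    then show False
      using no[of "min \<rho> r"] r by auto
  qed
qed

context banded_toeplitz
begin

section \<open>Only finitely many degenerate values\<close>

lemma sol_holomorphic:
  assumes "u holomorphic_on A" "z holomorphic_on A"
  shows "(\<lambda>t. sol (u t) (z t) i) holomorphic_on A"
proof (induction "g - i" arbitrary: i rule: less_induct)
  case less
  show ?case
  proof (cases "g \<le> i")
    case True
    then show ?thesis
      using assms by (auto simp: sol_tail intro!: holomorphic_intros)
  next
    case False
    have IH: "(\<lambda>t. sol (u t) (z t) (i + l)) holomorphic_on A" if "l \<in> {1..n}" for l
      using False that by (intro less) auto
    have "(\<lambda>t. T (u t) i (i + l)) holomorphic_on A" for l
      using assms by (cases "l = c") (auto simp: T_def intro!: holomorphic_intros)
    then have "(\<lambda>t. - (\<Sum>l=1..n. T (u t) i (i + l) * sol (u t) (z t) (i + l))) holomorphic_on A"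
      using IH by (intro holomorphic_intros) auto
    then show ?thesis
      using False by (simp add: sol.simps[of _ _ i])
  qed
qed

definition nondegenerate :: "complex \<Rightarrow> bool" where
  "nondegenerate v \<longleftrightarrow>
    (\<forall>x. inj_on x {..<c} \<and> (\<forall>j<c. poly (Q v) (x j) = 0) \<longrightarrow> E v x \<noteq> 0)"

text \<open>Simplicity of the zeros is phrased for every enumeration, so that it applies to the
  branches in whatever order they come.\<close>

definition good :: "complex \<Rightarrow> bool" where
  "good v \<longleftrightarrow> nondegenerate v \<and>
    (\<forall>x. Q v = Polynomial.smult (s (int n)) (\<Prod>l<n. [:- x l, 1:]) \<longrightarrow> inj_on x {..<n})"

lemma E_cong: "(\<And>j. j < c \<Longrightarrow> x j = y j) \<Longrightarrow> E v x = E v y"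
  unfolding E_def by (intro arg_cong[where f = det] eq_matI) auto

lemma factorization_roots:
  assumes "Q v = Polynomial.smult (s (int n)) (\<Prod>l<n. [:- x l, 1:])"
  shows "{z. poly (Q v) z = 0} = x ` {..<n}" and "l < n \<Longrightarrow> poly (Q v) (x l) = 0"
  using s_n by (auto simp: assms poly_prod)

lemma inj_on_other_factorization:
  assumes "Q v = Polynomial.smult (s (int n)) (\<Prod>l<n. [:- x l, 1:])" "inj_on x {..<n}"
    and "Q v = Polynomial.smult (s (int n)) (\<Prod>l<n. [:- y l, 1:])"
  shows "inj_on y {..<n}"
proof (rule eq_card_imp_inj_on)
  show "card (y ` {..<n}) = card {..<n}"
    using factorization_roots(1)[OF assms(1)] factorization_roots(1)[OF assms(3)] card_image[OF assms(2)]
    by simp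
qed simp

text \<open>Each of the finitely many injective choices of \<open>c\<close> branches makes
  \<open>E\<close> holomorphic in \<open>t\<close>. If one of these functions vanishes identically,
  all nearby values are degenerate; otherwise none has a zero on a common punctured disc, whose
  image under \<open>t \<mapsto> v0 + t ^ N\<close> covers a punctured disc about
  \<open>v0\<close>.\<close>

lemma good_or_degenerate_near:
  obtains \<delta> where "0 < \<delta>"
    "(\<forall>v. v \<noteq> v0 \<and> dist v v0 < \<delta> \<longrightarrow> good v) \<or> (\<forall>v. v \<noteq> v0 \<and> dist v v0 < \<delta> \<longrightarrow> \<not> nondegenerate v)"
proof -
  obtain N \<delta> \<zeta> where N: "0 < N" and \<delta>: "0 < \<delta>"
    and hol: "\<And>l. l < n \<Longrightarrow> \<zeta> l holomorphic_on ball 0 \<delta>"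
    and fact: "\<And>t. t \<in> ball 0 \<delta> \<Longrightarrow> Q (v0 + t ^ N) = Polynomial.smult (s (int n)) (\<Prod>l<n. [:- \<zeta> l t, 1:])"
    and inj: "\<And>t. t \<in> ball 0 \<delta> \<Longrightarrow> t \<noteq> 0 \<Longrightarrow> inj_on (\<lambda>l. \<zeta> l t) {..<n}"
    using uniformization[of v0] by blast
  define F where "F = {m \<in> {..<c} \<rightarrow>\<^sub>E {..<n}. inj_on m {..<c}}"
  have finF: "finite F"
    unfolding F_def by (rule finite_subset[of _ "{..<c} \<rightarrow>\<^sub>E {..<n}"]) (auto intro: finite_PiE)
  define \<epsilon> where "\<epsilon> m t = E (v0 + t ^ N) (\<lambda>j. \<zeta> (m j) t)" for m t
  have mF: "m j < n" if "m \<in> F" "j < c" for m j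
    using that by (auto simp: F_def PiE_iff)
  have hol_\<epsilon>: "\<epsilon> m holomorphic_on ball 0 \<delta>" if "m \<in> F" for m
    unfolding \<epsilon>_def E_def using mF[OF that]
    by (intro holomorphic_on_det) (auto intro!: sol_holomorphic hol holomorphic_intros)
  have root: "\<exists>t. t ^ N = v - v0 \<and> t \<in> ball 0 \<rho> \<and> t \<noteq> 0" if "0 < \<rho>" "v \<noteq> v0" "dist v v0 < \<rho> ^ N" for v \<rho>
  proof -
    obtain t where t: "v - v0 = t ^ N"
      using exists_complex_root[of N] N by blast
    have "cmod t ^ N < \<rho> ^ N"
      using that(3) by (simp add: dist_norm t norm_power)
    then have "cmod t < \<rho>"
      using that(1) by (meson less_imp_le power_less_imp_less_base)
    moreover have "t \<noteq> 0"
      using t that(2) N by (auto simp: zero_power)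
    ultimately show ?thesis
      using t by auto
  qed
  show ?thesis
  proof (cases "\<exists>m\<in>F. \<forall>t\<in>ball 0 \<delta>. \<epsilon> m t = 0")
    case True
    then obtain m where m: "m \<in> F" "\<And>t. t \<in> ball 0 \<delta> \<Longrightarrow> \<epsilon> m t = 0"
      by blast
    show ?thesis
    proof (rule that[of "\<delta> ^ N"])
      show "(\<forall>v. v \<noteq> v0 \<and> dist v v0 < \<delta> ^ N \<longrightarrow> good v) \<or>
          (\<forall>v. v \<noteq> v0 \<and> dist v v0 < \<delta> ^ N \<longrightarrow> \<not> nondegenerate v)"
      proof (intro disjI2 allI impI)
        fix v assume "v \<noteq> v0 \<and> dist v v0 < \<delta> ^ N"
        then obtain t where t: "t ^ N = v - v0" "t \<in> ball 0 \<delta>" "t \<noteq> 0"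
          using root[OF \<delta>] by blast
        have v: "v0 + t ^ N = v"
          using t(1) by simp
        have "inj_on (\<lambda>j. \<zeta> (m j) t) {..<c}"
          using comp_inj_on[of m "{..<c}" "\<lambda>l. \<zeta> l t"] inj_on_subset[OF inj[OF t(2,3)], of "m ` {..<c}"] m(1) mF[OF m(1)]
          by (auto simp: F_def o_def)
        moreover have "\<forall>j<c. poly (Q v) (\<zeta> (m j) t) = 0"
          using factorization_roots(2)[OF fact[OF t(2)]] mF[OF m(1)] v by simp
        moreover have "E v (\<lambda>j. \<zeta> (m j) t) = 0"
          using m(2)[OF t(2)] v by (simp add: \<epsilon>_def)
        ultimately show "\<not> nondegenerate v"
          unfolding nondegenerate_def by blast
      qed
    qed (use \<delta> in simp)
  next
    case False
    then have "\<forall>m\<in>F. \<exists>\<rho>>0. \<rho> \<le> \<delta> \<and> (\<forall>t\<in>ball 0 \<rho> - {0}. \<epsilon> m t \<noteq> 0)"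
      using holomorphic_zero_or_nonzero_near[OF hol_\<epsilon> \<delta>] by blast
    then obtain \<rho> where \<rho>: "\<forall>m\<in>F. 0 < \<rho> m \<and> \<rho> m \<le> \<delta> \<and> (\<forall>t\<in>ball 0 (\<rho> m) - {0}. \<epsilon> m t \<noteq> 0)"
      by (rule bchoice[THEN exE])
    define r where "r = Min (insert \<delta> (\<rho> ` F))"
    have "r \<in> insert \<delta> (\<rho> ` F)"
      unfolding r_def by (rule Min_in) (use finF in auto)
    then have r: "0 < r"
      using \<rho> \<delta> by auto
    have r_le: "r \<le> \<delta>" "\<And>m. m \<in> F \<Longrightarrow> r \<le> \<rho> m"
      unfolding r_def using finF by auto
    show ?thesis
    proof (rule that[of "r ^ N"])
      show "(\<forall>v. v \<noteq> v0 \<and> dist v v0 < r ^ N \<longrightarrow> good v) \<or>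
          (\<forall>v. v \<noteq> v0 \<and> dist v v0 < r ^ N \<longrightarrow> \<not> nondegenerate v)"
      proof (intro disjI1 allI impI)
        fix v assume "v \<noteq> v0 \<and> dist v v0 < r ^ N"
        then obtain t where t: "t ^ N = v - v0" "t \<in> ball 0 r" "t \<noteq> 0"
          using root[OF r] by blast
        have v: "v0 + t ^ N = v"
          using t(1) by simp
        have t\<delta>: "t \<in> ball 0 \<delta>"
          using t(2) r_le(1) by simp
        note Qv = fact[OF t\<delta>, unfolded v]
        have "E v x \<noteq> 0" if x: "inj_on x {..<c}" "\<forall>j<c. poly (Q v) (x j) = 0" for x
        proof -
          have "\<forall>j\<in>{..<c}. \<exists>l. l < n \<and> x j = \<zeta> l t"
            using x(2) factorization_roots(1)[OF Qv] by blast
          then obtain m where m: "\<forall>j\<in>{..<c}. m j < n \<and> x j = \<zeta> (m j) t"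
            by (rule bchoice[THEN exE])
          define m' where "m' = restrict m {..<c}"
          have "inj_on m {..<c}"
            using x(1) m by (auto simp: inj_on_def)
          then have "m' \<in> F"
            using m by (auto simp: F_def m'_def inj_on_def)
          then have "\<epsilon> m' t \<noteq> 0"
            using \<rho> t r_le(2)[of m'] by auto
          moreover have "\<epsilon> m' t = E v x"
            unfolding \<epsilon>_def v using m by (intro E_cong) (simp add: m'_def)
          ultimately show ?thesis
            by simp
        qed
        moreover have "inj_on x {..<n}" if "Q v = Polynomial.smult (s (int n)) (\<Prod>l<n. [:- x l, 1:])" for x
          using inj_on_other_factorization[OF Qv inj[OF t\<delta> t(3)] that] .
        ultimately show "good v"
          by (simp add: good_def nondegenerate_def)
      qed
    qed (use r in simp)
  qed
qed

text \<open>A multiple zero \<open>z\<close> of \<open>Q v\<close> is a zero of \<open>z Q' - c Q\<close>, which does not depend on \<open>v\<close>.\<close>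

lemma finite_multiple_roots:
  "finite {v. \<exists>x. Q v = Polynomial.smult (s (int n)) (\<Prod>l<n. [:- x l, 1:]) \<and> \<not> inj_on x {..<n}}"
proof -
  define P where "P = (\<Sum>l=0..n. monom ((of_nat l - of_nat c) * s (int l)) l)"
  have "poly P 0 \<noteq> 0"
    using c_pos by (simp add: P_def poly_0_coeff_0 coeff_sum coeff_monom s_0 if_distrib cong: if_cong)
  then have "P \<noteq> 0"
    by auto
  have key: "z * poly (pderiv (Q v)) z - of_nat c * poly (Q v) z = poly P z" for v z
  proof -
    have "z * (of_nat l * z ^ (l - 1)) = of_nat l * z ^ l" for l
      by (cases l) auto
    then have "z * poly (pderiv (monom a l)) z = of_nat l * a * z ^ l" for a l
      by (simp add: pderiv_monom poly_monom mult_ac)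
    then have "z * poly (pderiv (Q v)) z = (\<Sum>l=0..n. of_nat l * s (int l) * z ^ l) - of_nat c * v * z ^ c"
      by (simp add: Qpoly_def pderiv_diff pderiv_sum poly_sum right_diff_distrib sum_distrib_left)
    moreover have "of_nat c * poly (Q v) z = (\<Sum>l=0..n. of_nat c * s (int l) * z ^ l) - of_nat c * v * z ^ c"
      by (simp add: Qpoly_def poly_sum poly_monom right_diff_distrib sum_distrib_left mult.assoc)
    ultimately show ?thesis
      by (simp add: P_def poly_sum poly_monom left_diff_distrib sum_subtractf)
  qed
  have "{v. \<exists>x. Q v = Polynomial.smult (s (int n)) (\<Prod>l<n. [:- x l, 1:]) \<and> \<not> inj_on x {..<n}}
      \<subseteq> symbol n c s ` {z. poly P z = 0}"
  proof safe
    fix v x assume Qv: "Q v = Polynomial.smult (s (int n)) (\<Prod>l<n. [:- x l, 1:])"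
      and "\<not> inj_on x {..<n}"
    then obtain i j where ij: "i < n" "j < n" "i \<noteq> j" "x i = x j"
      by (auto simp: inj_on_def)
    define r where "r = Polynomial.smult (s (int n)) (\<Prod>l\<in>{..<n}-{i}-{j}. [:- x l, 1:])"
    define L where "L = [:- x i, 1:]"
    have "Q v = L * (L * r)"
      unfolding Qv r_def L_def using ij prod.remove[of "{..<n}" i "\<lambda>l. [:- x l, 1:]"]
        prod.remove[of "{..<n} - {i}" j "\<lambda>l. [:- x l, 1:]"] by simp
    moreover have "poly L (x i) = 0"
      by (simp add: L_def)
    ultimately have "poly (Q v) (x i) = 0" "poly (pderiv (Q v)) (x i) = 0"
      by (simp_all add: pderiv_mult)
    then have "poly P (x i) = 0" "symbol n c s (x i) = v"
      using key[of "x i" v] Q_root_iff[OF root_nonzero, of v "x i" v] by simp_all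
    then show "v \<in> symbol n c s ` {z. poly P z = 0}"
      by blast
  qed
  then show ?thesis
    using finite_subset poly_roots_finite[OF \<open>P \<noteq> 0\<close>] by blast
qed

text \<open>The points with a punctured neighbourhood of degenerate values form an open and closed set which
  contains no large \<open>v\<close>.\<close>

lemma good_near: obtains \<delta> where "0 < \<delta>" "\<And>v. v \<noteq> v0 \<Longrightarrow> dist v v0 < \<delta> \<Longrightarrow> good v"
proof -
  define Deg where "Deg = {w. \<exists>\<delta>>0. \<forall>v. v \<noteq> w \<and> dist v w < \<delta> \<longrightarrow> \<not> nondegenerate v}"
  have split: "\<exists>\<delta>>0. \<forall>v. v \<noteq> w \<and> dist v w < \<delta> \<longrightarrow> good v" if "w \<notin> Deg" for w
  proof -
    obtain \<delta> where "0 < \<delta>" "(\<forall>v. v \<noteq> w \<and> dist v w < \<delta> \<longrightarrow> good v) \<or>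
        (\<forall>v. v \<noteq> w \<and> dist v w < \<delta> \<longrightarrow> \<not> nondegenerate v)"
      by (rule good_or_degenerate_near)
    then show ?thesis
      using that unfolding Deg_def by blast
  qed
  have near: "\<exists>\<delta>'>0. \<forall>v. dist v w' < \<delta>' \<longrightarrow> v \<noteq> w \<and> dist v w < \<delta>" if "w' \<noteq> w" "dist w' w < \<delta>" for w w' :: complex and \<delta>
  proof (intro exI conjI allI impI)
    show "0 < min (dist w' w) (\<delta> - dist w' w)"
      using that by simp
    fix v assume "dist v w' < min (dist w' w) (\<delta> - dist w' w)"
    then show "v \<noteq> w" "dist v w < \<delta>"
      using dist_triangle[of v w w'] by (auto simp: dist_commute)
  qed
  have "open Deg"
    unfolding open_dist
  proof
    fix w assume "w \<in> Deg"
    then obtain \<delta> where \<delta>: "0 < \<delta>" "\<And>v. v \<noteq> w \<Longrightarrow> dist v w < \<delta> \<Longrightarrow> \<not> nondegenerate v"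
      unfolding Deg_def by blast
    have "w' \<in> Deg" if "dist w' w < \<delta>" for w'
    proof (cases "w' = w")
      case False
      then show ?thesis
        using near[OF False that] \<delta>(2) unfolding Deg_def by blast
    qed (use \<open>w \<in> Deg\<close> in simp)
    then show "\<exists>e>0. \<forall>w'. dist w' w < e \<longrightarrow> w' \<in> Deg"
      using \<delta>(1) by blast
  qed
  moreover have "open (- Deg)"
    unfolding open_dist
  proof
    fix w assume w: "w \<in> - Deg"
    then obtain \<delta> where \<delta>: "0 < \<delta>" "\<And>v. v \<noteq> w \<Longrightarrow> dist v w < \<delta> \<Longrightarrow> good v"
      using split by blast
    have "w' \<in> - Deg" if w': "dist w' w < \<delta>" for w'
    proof (cases "w' = w")
      case False
      obtain \<delta>' where \<delta>': "0 < \<delta>'" "\<And>v. dist v w' < \<delta>' \<Longrightarrow> good v"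
        using near[OF False w'] \<delta>(2) by blast
      have "\<exists>v. v \<noteq> w' \<and> dist v w' < min e \<delta>' \<and> nondegenerate v" if "0 < e" for e
      proof -
        have "w' islimpt UNIV"
          by simp
        then obtain v where "v \<noteq> w'" "dist v w' < min e \<delta>'"
          unfolding islimpt_approachable using \<open>0 < e\<close> \<delta>'(1) by (meson min_less_iff_conj)
        then show ?thesis
          using \<delta>'(2) by (auto simp: good_def)
      qed
      then show ?thesis
        unfolding Deg_def by fastforce
    qed (use w in simp)
    then show "\<exists>e>0. \<forall>w'. dist w' w < e \<longrightarrow> w' \<in> - Deg"
      using \<delta>(1) by blast
  qed
  moreover have "Deg \<noteq> UNIV"
  proof
    assume "Deg = UNIV"
    \<comment> \<open>Membership in \<open>Deg\<close> says nothing about \<open>w\<close> itself,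
      so a point next to \<open>w\<close> is used; the surplus 2 leaves room for a shift of at most
      1.\<close>
    define w where "w = complex_of_real (\<bar>large_radius\<bar> + 2)"
    have w: "cmod w = \<bar>large_radius\<bar> + 2"
      unfolding w_def norm_of_real by simp
    obtain e where e: "0 < e" "\<And>v. v \<noteq> w \<Longrightarrow> dist v w < e \<Longrightarrow> \<not> nondegenerate v"
      using \<open>Deg = UNIV\<close> unfolding Deg_def by blast
    define v where "v = w + complex_of_real (min 1 (e / 2))"
    have d: "dist v w = min 1 (e / 2)"
      using e(1) by (simp add: v_def dist_norm)
    then have "v \<noteq> w" "dist v w < e"
      using e(1) by auto
    moreover have "large_radius < cmod v"
      using norm_triangle_ineq2[of w "w - v"] d w by (auto simp: dist_norm norm_minus_commute)
    then have "nondegenerate v"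
      unfolding nondegenerate_def using E_nonzero_of_large by blast
    ultimately show False
      using e(2) by blast
  qed
  ultimately have "Deg = {}"
    using clopen[of Deg] by (simp add: closed_def)
  then show ?thesis
    using split[of v0] that by blast
qed

text \<open>By \<open>good_near\<close> there is no accumulation in a compact disc; outside it,
  \<open>E_nonzero_of_large\<close> leaves only values with a multiple zero.\<close>

lemma finite_not_good: "finite {v. \<not> good v}"
proof -
  have "finite (cball 0 large_radius \<inter> {v. \<not> good v})"
  proof (rule finite_not_islimpt_in_compact)
    fix z
    obtain \<delta> where "0 < \<delta>" "\<And>v. v \<noteq> z \<Longrightarrow> dist v z < \<delta> \<Longrightarrow> good v"
      using good_near[of z] by blast
    then show "\<not> z islimpt {v. \<not> good v}"
      unfolding islimpt_approachable by blast
  qed simp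
  moreover have "{v. \<not> good v} \<subseteq> (cball 0 large_radius \<inter> {v. \<not> good v}) \<union>
      {v. \<exists>x. Q v = Polynomial.smult (s (int n)) (\<Prod>l<n. [:- x l, 1:]) \<and> \<not> inj_on x {..<n}}"
  proof
    fix v assume "v \<in> {v. \<not> good v}"
    moreover have "nondegenerate v" if "\<not> cmod v \<le> large_radius"
      unfolding nondegenerate_def using E_nonzero_of_large that by (meson not_le)
    ultimately show "v \<in> (cball 0 large_radius \<inter> {v. \<not> good v}) \<union>
      {v. \<exists>x. Q v = Polynomial.smult (s (int n)) (\<Prod>l<n. [:- x l, 1:]) \<and> \<not> inj_on x {..<n}}"
      by (auto simp: good_def)
  qed
  ultimately show ?thesis
    using finite_multiple_roots finite_subset by blast
qed

end

text \<open>Multiplication by \<open>G\<close> acts freely on \<open>Y\<close>, as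
  \<open>0 \<notin> Y\<close>, so every orbit has \<open>card G\<close> elements.\<close>

lemma card_dvd_of_mult_closed:
  fixes G Y :: "complex set"
  assumes "finite Y" "0 \<notin> Y"
    and G1: "1 \<in> G" and Gm: "\<And>a b. a \<in> G \<Longrightarrow> b \<in> G \<Longrightarrow> a * b \<in> G"
    and Gi: "\<And>a. a \<in> G \<Longrightarrow> a \<noteq> 0 \<and> inverse a \<in> G"
    and closed: "\<And>a y. a \<in> G \<Longrightarrow> y \<in> Y \<Longrightarrow> a * y \<in> Y"
  shows "card G dvd card Y"
proof -
  define r where "r = {(y, y'). y \<in> Y \<and> y' \<in> Y \<and> (\<exists>a\<in>G. y' = a * y)}"
  have "equiv Y r"
  proof (rule equivI)
    show "r \<subseteq> Y \<times> Y"
      by (auto simp: r_def)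
    show "refl_on Y r"
      using G1 by (auto simp: r_def refl_on_def intro!: bexI[of _ 1])
    show "sym r"
    proof (rule symI)
      fix y y' assume "(y, y') \<in> r"
      then obtain a where "y \<in> Y" "y' \<in> Y" "a \<in> G" "y' = a * y"
        by (auto simp: r_def)
      moreover have "y = inverse a * (a * y)"
        using Gi[OF \<open>a \<in> G\<close>] by simp
      ultimately show "(y', y) \<in> r"
        using Gi unfolding r_def by blast
    qed
    show "trans r"
    proof (rule transI)
      fix x y z assume "(x, y) \<in> r" "(y, z) \<in> r"
      then obtain a b where "x \<in> Y" "z \<in> Y" "a \<in> G" "b \<in> G" "z = b * (a * x)"
        by (auto simp: r_def)
      then show "(x, z) \<in> r"
        using Gm[of b a] unfolding r_def by (auto simp: mult.assoc[symmetric])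
    qed
  qed
  moreover have "card G dvd card X" if "X \<in> Y // r" for X
  proof -
    obtain y where y: "y \<in> Y" "X = r `` {y}"
      using \<open>X \<in> Y // r\<close> by (rule quotientE)
    then have "X = (\<lambda>a. a * y) ` G"
      using closed by (auto simp: r_def)
    moreover have "inj_on (\<lambda>a. a * y) G"
      using y(1) \<open>0 \<notin> Y\<close> by (auto simp: inj_on_def)
    ultimately show ?thesis
      by (simp add: card_image)
  qed
  ultimately show ?thesis
    using equiv_imp_dvd_card[OF \<open>finite Y\<close>] by blast
qed

text \<open>On \<open>U\<close> the quotient has modulus 1, so its modulus has an interior local
  maximum and the quotient is constant on \<open>S\<close>.\<close>

lemma same_modulus_imp_const_ratio:
  fixes f h :: "complex \<Rightarrow> complex"
  assumes "f holomorphic_on S" "h holomorphic_on S" "open S" "connected S"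
    and nz: "\<And>t. t \<in> S \<Longrightarrow> h t \<noteq> 0"
    and U: "open U" "U \<subseteq> S" "U \<noteq> {}" "\<And>t. t \<in> U \<Longrightarrow> cmod (f t) = cmod (h t)"
  obtains \<omega> where "\<And>t. t \<in> S \<Longrightarrow> f t = \<omega> * h t"
proof -
  obtain \<xi> where \<xi>: "\<xi> \<in> U"
    using U(3) by blast
  have "(\<lambda>t. f t / h t) constant_on S"
  proof (rule maximum_modulus_principle[OF _ assms(3,4) U(1,2) \<xi>])
    show "(\<lambda>t. f t / h t) holomorphic_on S"
      using assms(1,2) nz by (intro holomorphic_intros) auto
    show "cmod (f z / h z) \<le> cmod (f \<xi> / h \<xi>)" if "z \<in> U" for z
      using U(2,4) nz that \<xi> by (simp add: norm_divide subset_iff)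
  qed
  then obtain \<omega> where "\<And>t. t \<in> S \<Longrightarrow> f t / h t = \<omega>"
    unfolding constant_on_def by blast
  then have "f t = \<omega> * h t" if "t \<in> S" for t
    using nz[OF that] that by (metis nonzero_eq_divide_eq)
  then show ?thesis
    by (rule that)
qed

text \<open>The pairs are separated one after the other, each time on a smaller nonempty open set;
  this is why \<open>ex\<close> speaks of every open subset of \<open>U\<close>.\<close>

lemma open_subset_distinct_moduli:
  fixes f h :: "'i \<Rightarrow> complex \<Rightarrow> complex"
  assumes "finite I" "open U" "U \<noteq> {}"
    and cont: "\<And>i. i \<in> I \<Longrightarrow> continuous_on U (f i)" "\<And>i. i \<in> I \<Longrightarrow> continuous_on U (h i)"
    and ex: "\<And>i V. i \<in> I \<Longrightarrow> open V \<Longrightarrow> V \<subseteq> U \<Longrightarrow> V \<noteq> {} \<Longrightarrow> \<exists>t\<in>V. cmod (f i t) \<noteq> cmod (h i t)"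
  shows "\<exists>V. open V \<and> V \<subseteq> U \<and> V \<noteq> {} \<and> (\<forall>i\<in>I. \<forall>t\<in>V. cmod (f i t) \<noteq> cmod (h i t))"
  using \<open>finite I\<close> cont ex
proof (induction I)
  case empty
  then show ?case
    using assms(2,3) by blast
next
  case (insert i I)
  then obtain V where V: "open V" "V \<subseteq> U" "V \<noteq> {}" "\<forall>i\<in>I. \<forall>t\<in>V. cmod (f i t) \<noteq> cmod (h i t)"
  proof -
    have "\<exists>V. open V \<and> V \<subseteq> U \<and> V \<noteq> {} \<and> (\<forall>i\<in>I. \<forall>t\<in>V. cmod (f i t) \<noteq> cmod (h i t))"
      by (rule insert.IH) (use insert.prems in blast)+
    then show ?thesis
      using that by blast
  qed
  define V' where "V' = {t \<in> V. cmod (f i t) - cmod (h i t) \<in> - {0}}"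
  have "continuous_on V (\<lambda>t. cmod (f i t) - cmod (h i t))"
    using insert.prems(1,2)[of i] V(2) by (auto intro!: continuous_intros intro: continuous_on_subset)
  then have "open V'"
    unfolding V'_def using V(1) by (metis (no_types) Collect_conj_eq Collect_mem_eq continuous_open_preimage open_Compl closed_singleton vimage_def)
  moreover have "V' \<noteq> {}"
    using insert.prems(3)[of i V] V by (auto simp: V'_def)
  ultimately show ?case
    using V by (intro exI[of _ V']) (auto simp: V'_def)
qed

context banded_toeplitz
begin

section \<open>Ties between moduli\<close>

definition tied :: "complex \<Rightarrow> bool" where
  "tied v \<longleftrightarrow> root_modulus n c s v c = root_modulus n c s v (c + 1)"

text \<open>Links the sorted list \<open>root_moduli\<close> to an arbitrary enumeration of the
  zeros. Positions count from 0, so the moduli numbered \<open>c\<close> and \<open>c + 1\<close>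
  sit at \<open>\<sigma> (c - 1)\<close> and \<open>\<sigma> c\<close>.\<close>

lemma sorted_factorization:
  assumes "Q v = Polynomial.smult (s (int n)) (\<Prod>l<n. [:- x l, 1:])"
  obtains \<sigma> where "bij_betw \<sigma> {..<n} {..<n}"
    "\<And>i j. i \<le> j \<Longrightarrow> j < n \<Longrightarrow> cmod (x (\<sigma> i)) \<le> cmod (x (\<sigma> j))"
    "tied v \<longleftrightarrow> cmod (x (\<sigma> (c - 1))) = cmod (x (\<sigma> c))"
proof -
  define xs where "xs = sort_key (\<lambda>l. cmod (x l)) [0..<n]"
  have xs: "length xs = n" "set xs = {..<n}" "distinct xs"
    by (auto simp: xs_def)
  have "proots (Q v) = (\<Sum>l<n. {#x l#})"
    unfolding assms using s_n by (simp add: proots_prod)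
  also have "\<dots> = image_mset x (mset [0..<n])"
    by (simp add: sum_unfold_sum_mset lessThan_atLeast0 flip: image_mset_def)
  finally have pr: "proots (Q v) = image_mset x (mset [0..<n])" .
  have "root_moduli n c s v = sort (map (\<lambda>l. cmod (x l)) [0..<n])"
  proof -
    have "image_mset cmod (image_mset x (mset [0..<n])) = mset (map (\<lambda>l. cmod (x l)) [0..<n])"
      by (simp only: mset_map image_mset.compositionality o_def)
    then show ?thesis
      unfolding root_moduli_def pr by (simp only: sorted_list_of_multiset_mset)
  qed
  also have "\<dots> = map (\<lambda>l. cmod (x l)) xs"
    by (rule properties_for_sort) (auto simp: xs_def)
  finally have rm: "root_moduli n c s v = map (\<lambda>l. cmod (x l)) xs" .
  show ?thesis
  proof (rule that[of "\<lambda>i. xs ! i"])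
    show "bij_betw (\<lambda>i. xs ! i) {..<n} {..<n}"
      using bij_betw_nth[OF xs(3)] xs(1,2) by auto
    show "cmod (x (xs ! i)) \<le> cmod (x (xs ! j))" if "i \<le> j" "j < n" for i j
      using sorted_nth_mono[of "map (\<lambda>l. cmod (x l)) xs" i j] that xs(1) by (simp add: xs_def)
    show "tied v \<longleftrightarrow> cmod (x (xs ! (c - 1))) = cmod (x (xs ! c))"
      using c_less xs(1) by (simp add: tied_def root_modulus_def rm)
  qed
qed

text \<open>Generically two zeros have equal modulus only if their ratio \<open>\<omega>\<close> is constant, hence
  \<open>f(\<omega> z) = f(z)\<close>. These \<open>\<omega>\<close> form a group \<open>G\<close> of \<open>c\<close>-th roots of unity that acts freely on the zeros, so
  each modulus occurs exactly \<open>card G\<close> times; as \<open>card G\<close> divides \<open>c\<close>, no such block straddles the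
  positions \<open>c\<close> and \<open>c + 1\<close>.\<close>

lemma exists_not_tied:
  assumes "0 < \<epsilon>"
  shows "\<exists>v. dist v v0 < \<epsilon> \<and> \<not> tied v"
proof -
  obtain N \<delta> \<zeta> where N: "0 < N" and \<delta>: "0 < \<delta>"
    and hol: "\<And>l. l < n \<Longrightarrow> \<zeta> l holomorphic_on ball 0 \<delta>"
    and fact: "\<And>t. t \<in> ball 0 \<delta> \<Longrightarrow> Q (v0 + t ^ N) = Polynomial.smult (s (int n)) (\<Prod>l<n. [:- \<zeta> l t, 1:])"
    and inj: "\<And>t. t \<in> ball 0 \<delta> \<Longrightarrow> t \<noteq> 0 \<Longrightarrow> inj_on (\<lambda>l. \<zeta> l t) {..<n}"
    using uniformization[of v0] by blast
  have root: "poly (Q (v0 + t ^ N)) (\<zeta> l t) = 0" if "l < n" "t \<in> ball 0 \<delta>" for l t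
    using factorization_roots(2)[OF fact] that by blast
  have nz: "\<zeta> l t \<noteq> 0" if "l < n" "t \<in> ball 0 \<delta>" for l t
    using root_nonzero[OF root[OF that]] .
  define U where "U = ball 0 (min \<delta> (min 1 \<epsilon>)) - {0::complex}"
  have U: "open U" "U \<noteq> {}" "U \<subseteq> ball 0 \<delta>"
  proof -
    show "open U"
      by (simp add: U_def open_delete)
    have "complex_of_real (min \<delta> (min 1 \<epsilon>) / 2) \<in> U"
      using \<delta> assms by (auto simp: U_def)
    then show "U \<noteq> {}"
      by blast
  qed (auto simp: U_def)
  define I where "I = {(i, j). i < n \<and> j < n \<and> \<not> (\<exists>\<omega>. \<forall>t\<in>ball 0 \<delta>. \<zeta> i t = \<omega> * \<zeta> j t)}"
  have cont: "continuous_on U (\<zeta> l)" if "l < n" for l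
    using holomorphic_on_imp_continuous_on[OF hol[OF that]] U(3) continuous_on_subset by blast
  have finI: "finite I"
    by (rule finite_subset[of _ "{..<n} \<times> {..<n}"]) (auto simp: I_def)
  have "\<exists>V. open V \<and> V \<subseteq> U \<and> V \<noteq> {} \<and> (\<forall>q\<in>I. \<forall>t\<in>V. cmod (\<zeta> (fst q) t) \<noteq> cmod (\<zeta> (snd q) t))"
  proof (rule open_subset_distinct_moduli[OF finI U(1,2)])
    fix q V assume q: "q \<in> I" and V: "open V" "V \<subseteq> U" "V \<noteq> {}"
    then have ij: "fst q < n" "snd q < n" "\<not> (\<exists>\<omega>. \<forall>t\<in>ball 0 \<delta>. \<zeta> (fst q) t = \<omega> * \<zeta> (snd q) t)"
      by (auto simp: I_def)
    show "\<exists>t\<in>V. cmod (\<zeta> (fst q) t) \<noteq> cmod (\<zeta> (snd q) t)"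
    proof (rule ccontr)
      assume no: "\<not> ?thesis"
      have "V \<subseteq> ball 0 \<delta>"
        using V(2) U(3) by blast
      obtain \<omega> where "\<And>t. t \<in> ball 0 \<delta> \<Longrightarrow> \<zeta> (fst q) t = \<omega> * \<zeta> (snd q) t"
        by (rule same_modulus_imp_const_ratio[OF hol[OF ij(1)] hol[OF ij(2)] open_ball connected_ball
            nz[OF ij(2)] V(1) \<open>V \<subseteq> ball 0 \<delta>\<close> V(3)]) (use no in auto)
      then show False
        using ij(3) by blast
    qed
  qed (auto simp: I_def intro: cont)
  then obtain t where t: "t \<in> U" and sep: "\<And>q. q \<in> I \<Longrightarrow> cmod (\<zeta> (fst q) t) \<noteq> cmod (\<zeta> (snd q) t)"
    by blast
  have tb: "t \<in> ball 0 \<delta>" "t \<noteq> 0" "cmod t < 1" "cmod t < \<epsilon>"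
    using t U(3) by (auto simp: U_def)
  define v where "v = v0 + t ^ N"
  define x where "x l = \<zeta> l t" for l
  have Qv: "Q v = Polynomial.smult (s (int n)) (\<Prod>l<n. [:- x l, 1:])"
    using fact[OF tb(1)] by (simp add: v_def x_def)
  have inj_x: "inj_on x {..<n}"
    using inj[OF tb(1,2)] by (simp add: x_def[abs_def])
  \<comment> \<open>Together the conditions express invariance of \<open>symbol n c s\<close> under
    \<open>z \<mapsto> \<omega> * z\<close>, coefficient by coefficient.\<close>
  define G where "G = {\<omega>. \<omega> ^ c = 1 \<and> (\<forall>l\<in>{0..n}. s (int l) * \<omega> ^ l = s (int l))}"
  have G_norm: "cmod \<omega> = 1" "\<omega> \<noteq> 0" if "\<omega> \<in> G" for \<omega>
  proof -
    have "\<omega> ^ c = 1"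
      using that by (simp add: G_def)
    then show "cmod \<omega> = 1"
      using c_pos by (metis less_irrefl norm_ge_zero norm_one norm_power power_eq_1_iff)
    then show "\<omega> \<noteq> 0"
      by auto
  qed
  have G_grp: "1 \<in> G" "\<And>a b. a \<in> G \<Longrightarrow> b \<in> G \<Longrightarrow> a * b \<in> G" "\<And>a. a \<in> G \<Longrightarrow> a \<noteq> 0 \<and> inverse a \<in> G"
  proof -
    show "1 \<in> G"
      by (simp add: G_def)
    show "a * b \<in> G" if "a \<in> G" "b \<in> G" for a b
      using that by (fastforce simp: G_def power_mult_distrib)
    show "a \<noteq> 0 \<and> inverse a \<in> G" if "a \<in> G" for a
      using that G_norm[OF that] by (auto simp: G_def power_inverse field_simps)
  qed
  have G_root: "poly (Q w) (\<omega> * z) = poly (Q w) z" if "\<omega> \<in> G" for \<omega> w z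
  proof -
    have "(s (int l) - (if l = c then w else 0)) * (\<omega> * z) ^ l = (s (int l) - (if l = c then w else 0)) * z ^ l"
      if "l \<in> {0..n}" for l
    proof -
      have "s (int l) * \<omega> ^ l = s (int l)" "\<omega> ^ c = 1"
        using that \<open>\<omega> \<in> G\<close> by (auto simp: G_def)
      then show ?thesis
        by (cases "l = c") (auto simp: power_mult_distrib mult.assoc[symmetric])
    qed
    then show ?thesis
      unfolding poly_Q by (intro sum.cong) auto
  qed
  have ratio: "x i / x j \<in> G" if ij: "i < n" "j < n" and eq: "cmod (x i) = cmod (x j)" for i j
  proof -
    have "(i, j) \<notin> I"
      using sep[of "(i, j)"] eq by (auto simp: x_def)
    then obtain \<omega> where \<omega>: "\<And>t. t \<in> ball 0 \<delta> \<Longrightarrow> \<zeta> i t = \<omega> * \<zeta> j t"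
      using ij unfolding I_def by blast
    have \<omega>0: "\<omega> \<noteq> 0"
      using \<omega>[OF tb(1)] nz[OF ij(1) tb(1)] by auto
    \<comment> \<open>\<open>P\<close> vanishes on the range of \<open>\<zeta> j\<close>, which is
      infinite since the branch is not constant; so \<open>P = 0\<close>, and its constant term
      forces \<open>\<omega> ^ c = 1\<close>.\<close>
    define P where "P = (\<Sum>l=0..n. monom (s (int l) * (\<omega> ^ l - \<omega> ^ c)) l)"
    have P0: "poly P (\<zeta> j t) = 0" if t: "t \<in> ball 0 \<delta>" for t
    proof -
      define z w where "z = \<zeta> j t" and "w = v0 + t ^ N"
      have Qw: "(\<Sum>l=0..n. s (int l) * y ^ l) = poly (Q w) y + w * y ^ c" for y
        by (simp add: Qpoly_def poly_sum poly_monom)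
      have roots: "poly (Q w) z = 0" "poly (Q w) (\<omega> * z) = 0"
        using root[OF ij(2) t] root[OF ij(1) t] \<omega>[OF t] by (simp_all add: z_def w_def)
      have "poly P z = (\<Sum>l=0..n. s (int l) * (\<omega> * z) ^ l) - \<omega> ^ c * (\<Sum>l=0..n. s (int l) * z ^ l)"
        by (simp add: P_def poly_sum poly_monom sum_distrib_left sum_subtractf[symmetric] algebra_simps
            power_mult_distrib)
      then show ?thesis
        unfolding Qw roots by (simp add: power_mult_distrib z_def)
    qed
    have "P = 0"
    proof (rule ccontr)
      assume "P \<noteq> 0"
      have "\<zeta> j constant_on ball 0 \<delta>"
      proof (rule continuous_finite_range_constant)
        show "continuous_on (ball 0 \<delta>) (\<zeta> j)"
          using hol[OF ij(2)] by (rule holomorphic_on_imp_continuous_on)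
        have "\<zeta> j ` ball 0 \<delta> \<subseteq> {z. poly P z = 0}"
          using P0 by blast
        then show "finite (\<zeta> j ` ball 0 \<delta>)"
          using poly_roots_finite[OF \<open>P \<noteq> 0\<close>] finite_subset by blast
      qed simp
      then have same: "\<zeta> j t = \<zeta> j 0"
        unfolding constant_on_def using tb(1) \<delta> by (metis centre_in_ball)
      have "symbol n c s (\<zeta> j t) = v0 + t ^ N" "symbol n c s (\<zeta> j 0) = v0 + 0 ^ N"
        using Q_root_iff[OF nz[OF ij(2)]] root[OF ij(2)] tb(1) \<delta> by auto
      then show False
        using same N tb(2) by (simp add: zero_power)
    qed
    then have coeffs: "s (int l) * (\<omega> ^ l - \<omega> ^ c) = 0" if "l \<in> {0..n}" for l
    proof -
      have "coeff P l = s (int l) * (\<omega> ^ l - \<omega> ^ c)"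
        using that by (simp add: P_def coeff_sum coeff_monom)
      then show ?thesis
        using \<open>P = 0\<close> by simp
    qed
    have "\<omega> ^ c = 1"
      using coeffs[of 0] by (simp add: s_0)
    then have "\<omega> \<in> G"
      using coeffs by (auto simp: G_def right_diff_distrib)
    moreover have "x i / x j = \<omega>"
      using \<omega>[OF tb(1)] nz[OF ij(2) tb(1)] by (simp add: x_def)
    ultimately show ?thesis
      by simp
  qed
  define X where "X = x ` {..<n}"
  have X_roots: "X = {z. poly (Q v) z = 0}"
    unfolding X_def using factorization_roots(1)[OF Qv] by simp
  have X: "finite X" "0 \<notin> X" "\<And>\<omega> y. \<omega> \<in> G \<Longrightarrow> y \<in> X \<Longrightarrow> \<omega> * y \<in> X"
    using G_root by (auto simp: X_roots) (auto simp: X_def X_roots[symmetric])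
  have dvd_c: "card G dvd c"
  proof -
    have "card G dvd card {z::complex. z ^ c = 1}"
    proof (rule card_dvd_of_mult_closed[OF _ _ G_grp])
      show "finite {z::complex. z ^ c = 1}"
        using c_pos by (intro finite_roots_unity) auto
    qed (use c_pos in \<open>auto simp: G_def power_mult_distrib zero_power\<close>)
    then show ?thesis
      by (simp add: card_roots_unity_eq c_pos)
  qed
  have "\<not> tied v"
  proof
    assume "tied v"
    obtain \<sigma> where \<sigma>: "bij_betw \<sigma> {..<n} {..<n}"
      "\<And>i j. i \<le> j \<Longrightarrow> j < n \<Longrightarrow> cmod (x (\<sigma> i)) \<le> cmod (x (\<sigma> j))"
      "tied v \<longleftrightarrow> cmod (x (\<sigma> (c - 1))) = cmod (x (\<sigma> c))"
      using sorted_factorization[OF Qv] by blast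
    have \<sigma>n: "\<sigma> i < n" if "i < n" for i
      using bij_betwE[OF \<sigma>(1)] that by blast
    have inj\<sigma>: "inj_on (\<lambda>i. x (\<sigma> i)) {..<n}"
      using comp_inj_on[of \<sigma> "{..<n}" x] \<sigma>(1) inj_x by (simp add: bij_betw_def o_def)
    have X\<sigma>: "X = (\<lambda>i. x (\<sigma> i)) ` {..<n}"
      using \<sigma>(1) by (metis X_def bij_betw_imp_surj_on image_image)
    define \<rho> where "\<rho> = cmod (x (\<sigma> c))"
    have tie: "cmod (x (\<sigma> (c - 1))) = \<rho>"
      using \<open>tied v\<close> \<sigma>(3) by (simp add: \<rho>_def)
    define Y1 where "Y1 = {y \<in> X. cmod y < \<rho>}"
    define Y2 where "Y2 = {y \<in> X. cmod y = \<rho>}"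
    have "card G dvd card Y1"
      by (rule card_dvd_of_mult_closed[OF _ _ G_grp])
        (use X G_norm in \<open>auto simp: Y1_def norm_mult\<close>)
    have "Y1 \<subseteq> (\<lambda>i. x (\<sigma> i)) ` {..<c - 1}"
    proof
      fix y assume "y \<in> Y1"
      then obtain i where i: "i < n" "y = x (\<sigma> i)" "cmod (x (\<sigma> i)) < \<rho>"
        by (auto simp: Y1_def X\<sigma>)
      have "i < c - 1"
        using \<sigma>(2)[of "c - 1" i] i tie by (meson not_le)
      then show "y \<in> (\<lambda>i. x (\<sigma> i)) ` {..<c - 1}"
        using i by blast
    qed
    then have "card Y1 \<le> c - 1"
      using surj_card_le[of "{..<c - 1}" Y1] by simp
    have "card Y2 \<le> card G"
    proof -
      have "finite G"
        unfolding G_def using c_pos by (intro finite_subset[OF _ finite_roots_unity[of c]]) auto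
      moreover have "Y2 \<subseteq> (\<lambda>\<omega>. \<omega> * x (\<sigma> c)) ` G"
      proof
        fix y assume "y \<in> Y2"
        then obtain i where i: "i < n" "y = x i" "cmod (x i) = \<rho>"
          by (auto simp: Y2_def X_def)
        have "x i / x (\<sigma> c) \<in> G"
          using i \<sigma>n c_less by (intro ratio) (auto simp: \<rho>_def)
        moreover have "x (\<sigma> c) \<noteq> 0"
          using nz[OF \<sigma>n[OF c_less] tb(1)] by (simp add: x_def)
        ultimately show "y \<in> (\<lambda>\<omega>. \<omega> * x (\<sigma> c)) ` G"
          using i(2) by (intro image_eqI[of _ _ "x i / x (\<sigma> c)"]) auto
      qed
      ultimately show ?thesis
        by (rule surj_card_le)
    qed
    \<comment> \<open>Both \<open>card Y1 < c\<close> and \<open>c\<close> are multiples of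
      \<open>card G\<close>, so \<open>card Y1 + card G \<le> c\<close>; yet these
      \<open>c + 1\<close> distinct zeros all have modulus at most \<open>\<rho>\<close>.\<close>
    have sub: "(\<lambda>i. x (\<sigma> i)) ` {..c} \<subseteq> Y1 \<union> Y2"
      using \<sigma>(2)[of _ c] c_less by (force simp: Y1_def Y2_def X\<sigma> \<rho>_def)
    have fin: "finite (Y1 \<union> Y2)"
      using X(1) by (simp add: Y1_def Y2_def)
    have "card ((\<lambda>i. x (\<sigma> i)) ` {..c}) = Suc c"
    proof -
      have "{..c} \<subseteq> {..<n}"
        using c_less by auto
      then show ?thesis
        using card_image[OF inj_on_subset[OF inj\<sigma>]] by simp
    qed
    then have "Suc c \<le> card Y1 + card Y2"
      using card_mono[OF fin sub] card_Un_le[of Y1 Y2] by linarith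
    then have "Suc c \<le> card Y1 + card G"
      using \<open>card Y2 \<le> card G\<close> by simp
    moreover obtain a where a: "card Y1 = card G * a"
      using \<open>card G dvd card Y1\<close> by blast
    moreover obtain b where b: "c = card G * b"
      using dvd_c by blast
    moreover have "a < b"
      using a b \<open>card Y1 \<le> c - 1\<close> c_pos by (metis One_nat_def Suc_pred less_Suc_eq_le mult_less_cancel1)
    then have "card G * Suc a \<le> card G * b"
      by (intro mult_le_mono2) simp
    ultimately show False
      by simp
  qed
  moreover have "dist v v0 < \<epsilon>"
  proof -
    have "cmod t ^ N \<le> cmod t"
      using power_decreasing[of 1 N "cmod t"] tb(3) N by simp
    then show ?thesis
      using tb(4) by (simp add: v_def dist_norm norm_power)
  qed
  ultimately show ?thesis
    by blast
qed

text \<open>Choosing \<open>t k\<close> with \<open>t k ^ N = u k - v\<close> makes the zeros along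
  \<open>u\<close> converge to those at \<open>v\<close>; the asymptotics then have a positive
  limit, although every term would be zero.\<close>

lemma not_eigenvalue_limit:
  assumes "good v" "\<not> tied v" "u \<longlonglongrightarrow> v"
  shows "\<not> (\<forall>k\<ge>1. p k (u k) = 0)"
proof
  assume zero: "\<forall>k\<ge>1. p k (u k) = 0"
  obtain N \<delta> \<zeta> where N: "0 < N" and \<delta>: "0 < \<delta>"
    and hol: "\<And>l. l < n \<Longrightarrow> \<zeta> l holomorphic_on ball 0 \<delta>"
    and fact: "\<And>t. t \<in> ball 0 \<delta> \<Longrightarrow> Q (v + t ^ N) = Polynomial.smult (s (int n)) (\<Prod>l<n. [:- \<zeta> l t, 1:])"
    and "\<And>t. t \<in> ball 0 \<delta> \<Longrightarrow> t \<noteq> 0 \<Longrightarrow> inj_on (\<lambda>l. \<zeta> l t) {..<n}"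
    using uniformization[of v] by blast
  have "\<exists>t. t ^ N = u k - v" for k
  proof -
    obtain t where "u k - v = t ^ N"
      using exists_complex_root[of N] N by blast
    then show ?thesis
      by (intro exI[of _ t]) simp
  qed
  then have "\<exists>t. \<forall>k. t k ^ N = u k - v"
    by (intro choice) blast
  then obtain t where t: "\<And>k. t k ^ N = u k - v"
    by blast
  have "(\<lambda>k. root N (cmod (u k - v))) \<longlonglongrightarrow> root N (cmod (v - v))"
    by (intro tendsto_intros assms(3))
  moreover have "root N (cmod (u k - v)) = cmod (t k)" for k
    using N by (simp add: t[symmetric] norm_power real_root_power_cancel)
  ultimately have t0: "t \<longlonglongrightarrow> 0"
    by (simp add: tendsto_norm_zero_iff)
  \<comment> \<open>Outside the disc of the branches \<open>t k\<close> is replaced by the harmless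
    value 0; only finitely many \<open>k\<close> are affected.\<close>
  define t' where "t' k = (if cmod (t k) < \<delta> then t k else 0)" for k
  have "eventually (\<lambda>k. cmod (t k) < \<delta>) sequentially"
    using order_tendstoD(2)[OF tendsto_norm[OF t0], of \<delta>] \<delta> by simp
  then have ev: "eventually (\<lambda>k. t' k = t k) sequentially"
    by eventually_elim (simp add: t'_def)
  have t'0: "t' \<longlonglongrightarrow> 0"
    using Lim_transform_eventually[OF t0] ev by (metis (mono_tags, lifting) eventually_mono)
  have t'_in: "t' k \<in> ball 0 \<delta>" for k
    using \<delta> by (simp add: t'_def)
  have Q0: "Q v = Polynomial.smult (s (int n)) (\<Prod>l<n. [:- \<zeta> l 0, 1:])"
    using fact[of 0] \<delta> N by (simp add: zero_power)
  obtain \<sigma> where \<sigma>: "bij_betw \<sigma> {..<n} {..<n}"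
    "\<And>i j. i \<le> j \<Longrightarrow> j < n \<Longrightarrow> cmod (\<zeta> (\<sigma> i) 0) \<le> cmod (\<zeta> (\<sigma> j) 0)"
    "tied v \<longleftrightarrow> cmod (\<zeta> (\<sigma> (c - 1)) 0) = cmod (\<zeta> (\<sigma> c) 0)"
    using sorted_factorization[OF Q0] by blast
  have \<sigma>n: "\<sigma> i < n" if "i < n" for i
    using bij_betwE[OF \<sigma>(1)] that by blast
  have "cmod (\<zeta> (\<sigma> (c - 1)) 0) < cmod (\<zeta> (\<sigma> c) 0)"
    using \<sigma>(2)[of "c - 1" c] \<sigma>(3) assms(2) c_less by auto
  then obtain r where r: "cmod (\<zeta> (\<sigma> (c - 1)) 0) < r" "r < cmod (\<zeta> (\<sigma> c) 0)"
    using dense by blast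
  have inj: "inj_on (\<lambda>l. \<zeta> (\<sigma> l) 0) {..<n}"
    using comp_inj_on[of \<sigma> "{..<n}" "\<lambda>l. \<zeta> l 0"] \<sigma>(1) Q0 assms(1)
    by (simp add: bij_betw_def o_def good_def)
  have roots0: "poly (Q v) (\<zeta> (\<sigma> l) 0) = 0" if "l < n" for l
    using factorization_roots(2)[OF Q0] \<sigma>n[OF that] by blast
  obtain L where L: "L > 0" "(\<lambda>k. cmod (p k (v + t' k ^ N)) * (\<Prod>l<c. cmod (\<zeta> (\<sigma> l) (t' k)) ^ k)
      * cmod (det (mat n n (\<lambda>(i, l). \<zeta> (\<sigma> l) (t' k) ^ i)))) \<longlonglongrightarrow> L"
  proof (rule p_asymptotics[of "\<lambda>k. v + t' k ^ N" v "\<lambda>k l. \<zeta> (\<sigma> l) (t' k)" "\<lambda>l. \<zeta> (\<sigma> l) 0" r])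
    show "(\<lambda>k. v + t' k ^ N) \<longlonglongrightarrow> v"
      using t'0 N by (auto intro!: tendsto_eq_intros)
    show "(\<lambda>k. \<zeta> (\<sigma> l) (t' k)) \<longlonglongrightarrow> \<zeta> (\<sigma> l) 0" if "l < n" for l
    proof -
      have "isCont (\<zeta> (\<sigma> l)) 0"
        using holomorphic_on_imp_continuous_on[OF hol[OF \<sigma>n[OF that]]] \<delta>
        by (metis centre_in_ball continuous_on_eq_continuous_at open_ball)
      then show ?thesis
        using t'0 by (rule isCont_tendsto_compose)
    qed
    show "poly (Q (v + t' k ^ N)) (\<zeta> (\<sigma> l) (t' k)) = 0" if "l < n" for k l
      using factorization_roots(2)[OF fact[OF t'_in]] \<sigma>n[OF that] by blast
    show "cmod (\<zeta> (\<sigma> l) 0) < r" if "l < c" for l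
      using \<sigma>(2)[of l "c - 1"] r(1) that c_less by force
    show "r < cmod (\<zeta> (\<sigma> l) 0)" if "c \<le> l" "l < n" for l
      using \<sigma>(2)[OF that] r(2) by linarith
    show "0 < r"
      using r(1) norm_ge_zero order_le_less_trans by blast
    show "inj_on (\<lambda>l. \<zeta> (\<sigma> l) 0) {c..<n}"
      using inj by (rule inj_on_subset) auto
    have "inj_on (\<lambda>l. \<zeta> (\<sigma> l) 0) {..<c}"
      using inj by (rule inj_on_subset) (use c_less in auto)
    then show "E v (\<lambda>l. \<zeta> (\<sigma> l) 0) \<noteq> 0"
      using assms(1) roots0 c_less unfolding good_def nondegenerate_def by simp
  qed blast
  have ev0: "eventually (\<lambda>k. cmod (p k (v + t' k ^ N)) * (\<Prod>l<c. cmod (\<zeta> (\<sigma> l) (t' k)) ^ k)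
      * cmod (det (mat n n (\<lambda>(i, l). \<zeta> (\<sigma> l) (t' k) ^ i))) = 0) sequentially"
    using ev eventually_ge_at_top[of 1]
    by eventually_elim (use zero in \<open>simp add: t\<close>)
  have "L = 0"
    by (rule LIMSEQ_unique[OF L(2) tendsto_eventually[OF ev0]])
  then show False
    using L(1) by simp
qed

end

text \<open>The expanded product runs over all maps of the index set into itself, the Leibniz
  formula only over the permutations. Unlike a bound by the largest entry, this costs no
  factorial.\<close>

lemma norm_det_le_prod_row_sums:
  fixes f :: "nat \<times> nat \<Rightarrow> 'a::real_normed_field"
  shows "norm (det (mat m m f)) \<le> (\<Prod>i = 0..<m. \<Sum>j = 0..<m. norm (f (i, j)))"
proof -
  let ?P = "{q. q permutes {0..<m}}"
  have entry: "mat m m f $$ (i, q i) = f (i, q i)" if "q permutes {0..<m}" "i \<in> {0..<m}" for q i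
  proof -
    have "q i \<in> {0..<m}"
      using permutes_in_image[OF that(1)] that(2) by blast
    then show ?thesis
      using that(2) by simp
  qed
  have sgn: "norm (signof q * y) = norm y" for q :: "nat \<Rightarrow> nat" and y :: 'a
    by (simp add: sign_def)
  have "norm (det (mat m m f)) \<le> (\<Sum>q\<in>?P. norm (signof q * (\<Prod>i = 0..<m. mat m m f $$ (i, q i))))"
    unfolding det_def'[OF mat_carrier] by (rule norm_sum)
  also have "\<dots> = (\<Sum>q\<in>?P. \<Prod>i = 0..<m. norm (f (i, restrict q {0..<m} i)))"
    using entry by (intro sum.cong) (auto simp: sgn prod_norm[symmetric] intro!: prod.cong)
  also have "\<dots> = (\<Sum>h\<in>(\<lambda>q. restrict q {0..<m}) ` ?P. \<Prod>i = 0..<m. norm (f (i, h i)))"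
  proof (subst sum.reindex)
    show "inj_on (\<lambda>q. restrict q {0..<m}) ?P"
    proof (rule inj_onI, rule ext)
      fix q q' i assume q: "q \<in> ?P" "q' \<in> ?P" and eq: "restrict q {0..<m} = restrict q' {0..<m}"
      show "q i = q' i"
      proof (cases "i \<in> {0..<m}")
        case True
        then show ?thesis
          using fun_cong[OF eq, of i] by simp
      next
        case False
        then show ?thesis
          using q by (simp add: permutes_not_in)
      qed
    qed
  qed (simp add: o_def)
  also have "\<dots> \<le> (\<Sum>h\<in>{0..<m} \<rightarrow>\<^sub>E {0..<m}. \<Prod>i = 0..<m. norm (f (i, h i)))"
  proof (rule sum_mono2)
    show "(\<lambda>q. restrict q {0..<m}) ` ?P \<subseteq> {0..<m} \<rightarrow>\<^sub>E {0..<m}"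
    proof
      fix h assume "h \<in> (\<lambda>q. restrict q {0..<m}) ` ?P"
      then obtain q where q: "q permutes {0..<m}" "h = restrict q {0..<m}"
        by blast
      then have "q i \<in> {0..<m}" if "i \<in> {0..<m}" for i
        using permutes_in_image[OF q(1)] that by blast
      then show "h \<in> {0..<m} \<rightarrow>\<^sub>E {0..<m}"
        unfolding q(2) by auto
    qed
  qed (auto intro!: finite_PiE prod_nonneg)
  also have "\<dots> = (\<Prod>i = 0..<m. \<Sum>j = 0..<m. norm (f (i, j)))"
    by (rule prod_sum_PiE[symmetric]) auto
  finally show ?thesis .
qed

text \<open>The factors outside the intersection are compared along a bijection from
  \<open>M - M'\<close> to \<open>M' - M\<close>.\<close>

lemma prod_le_of_dominated:
  fixes a :: "'i \<Rightarrow> real"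
  assumes "finite M" "finite M'" "card M = card M'"
    and pos: "\<And>l. l \<in> M \<union> M' \<Longrightarrow> 0 < a l"
    and le: "\<And>l l'. l \<in> M \<Longrightarrow> l' \<in> M' - M \<Longrightarrow> a l \<le> a l'"
  shows "prod a M \<le> prod a M'"
    and "M \<noteq> M' \<Longrightarrow> (\<And>l l'. l \<in> M \<Longrightarrow> l' \<in> M' - M \<Longrightarrow> a l < a l') \<Longrightarrow> prod a M < prod a M'"
proof -
  have "card (M - M') = card (M' - M)"
    using assms(1-3) card_Int_Diff[of M M'] card_Int_Diff[of M' M] by (simp add: Int_commute)
  then obtain h where h: "bij_betw h (M - M') (M' - M)"
    using assms(1,2) by (metis bij_betw_iff_card finite_Diff)
  have h_in: "h l \<in> M' - M" if "l \<in> M - M'" for l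
    using bij_betwE[OF h] that by blast
  have eq: "prod a (M' - M) = (\<Prod>l\<in>M - M'. a (h l))"
    using prod.reindex_bij_betw[OF h, of a] by simp
  have split: "prod a M = prod a (M \<inter> M') * prod a (M - M')" "prod a M' = prod a (M \<inter> M') * prod a (M' - M)"
    using assms(1,2) prod.Int_Diff[of M a M'] prod.Int_Diff[of M' a M] by (simp_all add: Int_commute)
  have pI: "0 < prod a (M \<inter> M')"
    using pos by (intro prod_pos) auto
  have "prod a (M - M') \<le> prod a (M' - M)"
    unfolding eq
  proof (rule prod_mono)
    fix l assume l: "l \<in> M - M'"
    then show "0 \<le> a l \<and> a l \<le> a (h l)"
      using le[OF _ h_in[OF l]] less_imp_le[OF pos[of l]] by auto
  qed
  then show "prod a M \<le> prod a M'"
    unfolding split using pI by simp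
  assume "M \<noteq> M'" and less: "\<And>l l'. l \<in> M \<Longrightarrow> l' \<in> M' - M \<Longrightarrow> a l < a l'"
  have "M - M' \<noteq> {}"
    using \<open>M \<noteq> M'\<close> assms(1-3) by (metis Diff_eq_empty_iff card_subset_eq)
  then obtain i where i: "i \<in> M - M'"
    by blast
  have "prod a (M - M') < prod a (M' - M)"
    unfolding eq
  proof (rule prod_mono_strict[OF i])
    show "a i < a (h i)"
      using less[OF _ h_in[OF i]] i by blast
    fix l assume l: "l \<in> M - M'"
    then show "0 \<le> a l \<and> a l \<le> a (h l)"
      using le[OF _ h_in[OF l]] less_imp_le[OF pos[of l]] by auto
    show "0 < a (h l)"
      using h_in[OF l] pos by blast
  qed (use assms(1) in auto)
  then show "prod a M < prod a M'"
    unfolding split using pI by simp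
qed

lemma isCont_ball_of_holomorphic:
  assumes "f holomorphic_on S" "open S" "a \<in> S"
  shows "isCont f a"
  using assms holomorphic_on_imp_continuous_on continuous_on_eq_continuous_at by blast

context banded_toeplitz
begin

section \<open>Eigenvalues accumulate at ties\<close>

lemma p_holomorphic: "p k holomorphic_on A"
proof -
  have "(\<lambda>v. det (mat k k ((\<lambda>v (i, j). T v i (j + c)) v))) holomorphic_on A"
  proof (rule holomorphic_on_det)
    fix i j
    show "(\<lambda>v. (\<lambda>(i, j). T v i (j + c)) (i, j)) holomorphic_on A"
      by (cases "i = j") (auto simp: T_def intro!: holomorphic_intros)
  qed
  then show ?thesis
    by (simp add: p_def[abs_def])
qed

text \<open>A row has at most \<open>n + 1\<close> nonzero entries whatever \<open>k\<close> is, so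
  the \<open>k\<close>-th roots of \<open>p k\<close> are locally bounded, as Montel's theorem
  requires.\<close>

lemma norm_p_le: "cmod (p k v) \<le> (real (Suc n) * (coeff_bound + cmod v)) ^ k"
proof -
  have T: "cmod (T v i j) \<le> coeff_bound + cmod v" for i j
    unfolding T_def by (rule order_trans[OF norm_triangle_ineq4 add_mono[OF norm_s_le]]) simp
  have row: "(\<Sum>j = 0..<k. cmod (T v i (j + c))) \<le> real (Suc n) * (coeff_bound + cmod v)" for i
  proof -
    have "(\<Sum>j = 0..<k. cmod (T v i (j + c))) = (\<Sum>m\<in>{c..<k+c}. cmod (T v i m))"
      by (rule sum.reindex_bij_witness[of _ "\<lambda>m. m - c" "\<lambda>j. j + c"]) auto
    also have "\<dots> = (\<Sum>m\<in>{c..<k+c} \<inter> {i..i+n}. cmod (T v i m))"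
    proof (rule sum.mono_neutral_right)
      show "\<forall>m\<in>{c..<k+c} - {c..<k+c} \<inter> {i..i+n}. cmod (T v i m) = 0"
      proof
        fix m assume "m \<in> {c..<k+c} - {c..<k+c} \<inter> {i..i+n}"
        then have "m < i \<or> i + n < m"
          by auto
        then show "cmod (T v i m) = 0"
          using T_lower T_upper by auto
      qed
    qed auto
    also have "\<dots> \<le> (\<Sum>m\<in>{i..i+n}. cmod (T v i m))"
      by (intro sum_mono2) auto
    also have "\<dots> \<le> (\<Sum>m\<in>{i..i+n}. coeff_bound + cmod v)"
      by (intro sum_mono T)
    finally show ?thesis
      by simp
  qed
  have "cmod (p k v) \<le> (\<Prod>i = 0..<k. \<Sum>j = 0..<k. cmod (T v i (j + c)))"
    using norm_det_le_prod_row_sums[of k "\<lambda>(i, j). T v i (j + c)"] by (simp add: p_def)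
  also have "\<dots> \<le> (\<Prod>i = 0..<k. real (Suc n) * (coeff_bound + cmod v))"
    using row by (intro prod_mono) (auto intro!: sum_nonneg)
  finally show ?thesis
    by simp
qed

text \<open>\<open>p_asymptotics\<close> along a constant sequence, divided by the nonzero
  Vandermonde factor; \<open>M\<close> collects the \<open>c\<close> smallest zeros.\<close>

lemma p_growth:
  assumes "good v" "\<not> tied v" and Qv: "Q v = Polynomial.smult (s (int n)) (\<Prod>l<n. [:- x l, 1:])"
  obtains M L where "M \<subseteq> {..<n}" "card M = c"
    "\<And>l l'. l \<in> M \<Longrightarrow> l' \<in> {..<n} - M \<Longrightarrow> cmod (x l) < cmod (x l')"
    "0 < L" "(\<lambda>k. cmod (p k v) * (\<Prod>l\<in>M. cmod (x l)) ^ k) \<longlonglongrightarrow> L"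
proof -
  obtain \<sigma> where \<sigma>: "bij_betw \<sigma> {..<n} {..<n}"
    "\<And>i j. i \<le> j \<Longrightarrow> j < n \<Longrightarrow> cmod (x (\<sigma> i)) \<le> cmod (x (\<sigma> j))"
    "tied v \<longleftrightarrow> cmod (x (\<sigma> (c - 1))) = cmod (x (\<sigma> c))"
    using sorted_factorization[OF Qv] by blast
  have \<sigma>n: "\<sigma> i < n" if "i < n" for i
    using bij_betwE[OF \<sigma>(1)] that by blast
  have inj\<sigma>: "inj_on \<sigma> {..<n}"
    using \<sigma>(1) by (simp add: bij_betw_def)
  have sub: "{..<c} \<subseteq> {..<n}"
    using c_less by auto
  have "cmod (x (\<sigma> (c - 1))) < cmod (x (\<sigma> c))"
    using \<sigma>(2)[of "c - 1" c] \<sigma>(3) assms(2) c_less by auto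
  then obtain r where r: "cmod (x (\<sigma> (c - 1))) < r" "r < cmod (x (\<sigma> c))"
    using dense by blast
  have small: "cmod (x (\<sigma> l)) < r" if "l < c" for l
    using \<sigma>(2)[of l "c - 1"] r(1) that c_less by force
  have large: "r < cmod (x (\<sigma> l))" if "c \<le> l" "l < n" for l
    using \<sigma>(2)[OF that] r(2) by linarith
  have inj: "inj_on (\<lambda>l. x (\<sigma> l)) {..<n}"
    using comp_inj_on[of \<sigma> "{..<n}" x] \<sigma>(1) Qv assms(1) by (simp add: bij_betw_def o_def good_def)
  have roots: "poly (Q v) (x (\<sigma> l)) = 0" if "l < n" for l
    using factorization_roots(2)[OF Qv] \<sigma>n[OF that] by blast
  obtain L where L: "L > 0" "(\<lambda>k. cmod (p k v) * (\<Prod>l<c. cmod (x (\<sigma> l)) ^ k)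
      * cmod (det (mat n n (\<lambda>(i, l). x (\<sigma> l) ^ i)))) \<longlonglongrightarrow> L"
  proof (rule p_asymptotics[of "\<lambda>k. v" v "\<lambda>k l. x (\<sigma> l)" "\<lambda>l. x (\<sigma> l)" r])
    show "0 < r"
      using r(1) norm_ge_zero order_le_less_trans by blast
    show "inj_on (\<lambda>l. x (\<sigma> l)) {c..<n}"
      using inj by (rule inj_on_subset) auto
    have "inj_on (\<lambda>l. x (\<sigma> l)) {..<c}"
      using inj sub by (rule inj_on_subset)
    then show "E v (\<lambda>l. x (\<sigma> l)) \<noteq> 0"
      using assms(1) roots c_less unfolding good_def nondegenerate_def by simp
  qed (use small large roots in auto)
  define V where "V = cmod (det (mat n n (\<lambda>(i, l). x (\<sigma> l) ^ i)))"
  have V: "0 < V"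
    using det_vandermonde_nonzero[OF inj] by (simp add: V_def)
  have W: "(\<Prod>l\<in>\<sigma> ` {..<c}. cmod (x l)) ^ k = (\<Prod>l<c. cmod (x (\<sigma> l)) ^ k)" for k
    using inj_on_subset[OF inj\<sigma> sub] by (simp add: prod.reindex prod_power_distrib)
  show ?thesis
  proof (rule that[of "\<sigma> ` {..<c}" "L / V"])
    show "\<sigma> ` {..<c} \<subseteq> {..<n}"
      using \<sigma>n c_less by auto
    show "card (\<sigma> ` {..<c}) = c"
      using card_image[OF inj_on_subset[OF inj\<sigma> sub]] by simp
    show "cmod (x l) < cmod (x l')" if l: "l \<in> \<sigma> ` {..<c}" and l': "l' \<in> {..<n} - \<sigma> ` {..<c}" for l l'
    proof -
      obtain i where i: "i < c" "l = \<sigma> i"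
        using l by blast
      obtain j where j: "j < n" "l' = \<sigma> j"
        using l' \<sigma>(1) by (auto simp: bij_betw_def)
      have "c \<le> j"
        using l' j by (meson DiffD2 imageI lessThan_iff not_le)
      then show ?thesis
        using small[of i] large[of j] i j by simp
    qed
    show "0 < L / V"
      using L V by simp
    have "(\<lambda>k. cmod (p k v) * (\<Prod>l<c. cmod (x (\<sigma> l)) ^ k) * V / V) \<longlonglongrightarrow> L / V"
      using L(2) V unfolding V_def[symmetric] by (intro tendsto_divide tendsto_const) auto
    then show "(\<lambda>k. cmod (p k v) * (\<Prod>l\<in>\<sigma> ` {..<c}. cmod (x l)) ^ k) \<longlonglongrightarrow> L / V"
      using V unfolding W by simp
  qed
qed

lemma exists_good_not_tied:
  assumes "open V" "V \<noteq> {}"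
  shows "\<exists>v\<in>V. good v \<and> \<not> tied v"
proof -
  have "infinite V"
    using assms finite_imp_not_open by blast
  then have "infinite (V - {v. \<not> good v})"
    using finite_not_good by (rule Diff_infinite_finite[rotated])
  then have "V - {v. \<not> good v} \<noteq> {}"
    by (metis finite.emptyI)
  moreover have "open (V - {v. \<not> good v})"
    by (intro open_Diff assms(1) finite_imp_closed finite_not_good)
  ultimately obtain w e where w: "0 < e" "ball w e \<subseteq> V - {v. \<not> good v}"
    unfolding open_contains_ball by blast
  obtain v where "dist v w < e" "\<not> tied v"
    using exists_not_tied[OF w(1)] by blast
  moreover from this have "v \<in> ball w e"
    by (simp add: dist_commute)
  ultimately show ?thesis
    using w(2) by blast
qed

text \<open>The \<open>k\<close>-th root of a sequence with positive limit tends to 1, so the value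
  of \<open>L\<close> leaves no trace.\<close>

lemma limit_of_kth_roots:
  fixes a w :: real and b q :: "nat \<Rightarrow> real" and \<kappa> :: "nat \<Rightarrow> nat"
  assumes \<kappa>: "filterlim \<kappa> at_top sequentially" and L: "0 < L" "(\<lambda>k. q k * w ^ k) \<longlonglongrightarrow> L"
    and w: "0 < w" and b: "\<And>m. 0 < b m" "\<And>m. b m ^ \<kappa> m = q (\<kappa> m)" and lim: "b \<longlonglongrightarrow> a"
  shows "a * w = 1"
proof -
  have lnL: "(\<lambda>k. ln (q k * w ^ k)) \<longlonglongrightarrow> ln L"
    using L by (intro tendsto_ln) auto
  have "(\<lambda>k. ln (q k * w ^ k) / real k) \<longlonglongrightarrow> 0"
    by (rule tendsto_divide_0[OF lnL filterlim_mono[OF filterlim_real_sequentially]])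
      (auto intro: at_top_le_at_infinity)
  then have "(\<lambda>m. ln (q (\<kappa> m) * w ^ \<kappa> m) / real (\<kappa> m)) \<longlonglongrightarrow> 0"
    using \<kappa> by (rule filterlim_compose)
  then have "(\<lambda>m. exp (ln (q (\<kappa> m) * w ^ \<kappa> m) / real (\<kappa> m))) \<longlonglongrightarrow> exp 0"
    by (rule tendsto_exp)
  moreover have "eventually (\<lambda>m. exp (ln (q (\<kappa> m) * w ^ \<kappa> m) / real (\<kappa> m)) = b m * w) sequentially"
    using filterlim_at_top[THEN iffD1, OF \<kappa>, rule_format, of 1]
  proof eventually_elim
    case (elim m)
    have "q (\<kappa> m) * w ^ \<kappa> m = (b m * w) ^ \<kappa> m"
      by (simp add: b(2) power_mult_distrib)
    then show ?case
      using elim b(1)[of m] w by (simp add: ln_realpow)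
  qed
  ultimately have "(\<lambda>m. b m * w) \<longlonglongrightarrow> exp 0"
    by (rule Lim_transform_eventually)
  moreover have "(\<lambda>m. b m * w) \<longlonglongrightarrow> a * w"
    using lim by (intro tendsto_intros)
  ultimately show ?thesis
    using LIMSEQ_unique by fastforce
qed

text \<open>On a disc where infinitely many \<open>p k\<close> have no zero, the \<open>k\<close>-th roots form a normal family; a limit \<open>H\<close>
  satisfies \<open>|H v| = 1 / (\<rho>\<^sub>1(v) \<cdots> \<rho>\<^sub>c(v))\<close> at generic \<open>v\<close>.\<close>

lemma zero_free_imp_limit:
  fixes \<kappa> :: "nat \<Rightarrow> nat"
  assumes "0 < \<epsilon>" and \<kappa>: "strict_mono \<kappa>"
    and nz: "\<And>m v. v \<in> ball v0 \<epsilon> \<Longrightarrow> p (\<kappa> m) v \<noteq> 0"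
  obtains H where "H holomorphic_on ball v0 \<epsilon>"
    "\<And>v x. v \<in> ball v0 \<epsilon> \<Longrightarrow> good v \<Longrightarrow> \<not> tied v \<Longrightarrow>
      Q v = Polynomial.smult (s (int n)) (\<Prod>l<n. [:- x l, 1:]) \<Longrightarrow>
      \<exists>M\<subseteq>{..<n}. card M = c \<and> cmod (H v) * (\<Prod>l\<in>M. cmod (x l)) = 1 \<and>
        (\<forall>l\<in>M. \<forall>l'\<in>{..<n} - M. cmod (x l) < cmod (x l'))"
proof -
  have "\<exists>h. h holomorphic_on ball v0 \<epsilon> \<and> (\<forall>v\<in>ball v0 \<epsilon>. h v \<noteq> 0 \<and> (0 < \<kappa> m \<longrightarrow> h v ^ \<kappa> m = p (\<kappa> m) v))" for m
  proof -
    obtain g where g: "g holomorphic_on ball v0 \<epsilon>" "\<And>v. v \<in> ball v0 \<epsilon> \<Longrightarrow> exp (g v) = p (\<kappa> m) v"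
      using holomorphic_logarithm_exists[of "ball v0 \<epsilon>" "p (\<kappa> m)" v0] p_holomorphic nz \<open>0 < \<epsilon>\<close>
      by (metis centre_in_ball convex_ball open_ball)
    have "(\<lambda>v. exp (g v * (1 / of_nat (\<kappa> m)))) holomorphic_on ball v0 \<epsilon>"
      using g(1) by (intro holomorphic_intros)
    moreover have "exp (g v * (1 / of_nat (\<kappa> m))) ^ \<kappa> m = p (\<kappa> m) v" if "v \<in> ball v0 \<epsilon>" "0 < \<kappa> m" for v
      using g(2)[OF that(1)] that(2) by (simp flip: exp_of_nat_mult)
    ultimately show ?thesis
      by (intro exI[of _ "\<lambda>v. exp (g v * (1 / of_nat (\<kappa> m)))"]) auto
  qed
  then have "\<exists>h. \<forall>m. h m holomorphic_on ball v0 \<epsilon> \<and>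
      (\<forall>v\<in>ball v0 \<epsilon>. h m v \<noteq> 0 \<and> (0 < \<kappa> m \<longrightarrow> h m v ^ \<kappa> m = p (\<kappa> m) v))"
    by (intro choice) blast
  then obtain h where h: "\<And>m. h m holomorphic_on ball v0 \<epsilon>"
    "\<And>m v. v \<in> ball v0 \<epsilon> \<Longrightarrow> h m v \<noteq> 0"
    "\<And>m v. v \<in> ball v0 \<epsilon> \<Longrightarrow> 0 < \<kappa> m \<Longrightarrow> h m v ^ \<kappa> m = p (\<kappa> m) v"
    by blast
  \<comment> \<open>The shift skips a possible \<open>\<kappa> 0 = 0\<close>, where there is no root
    to take.\<close>
  define \<F> where "\<F> m = h (Suc m)" for m
  have \<kappa>_pos: "0 < \<kappa> (Suc m)" for m
    using strict_mono_less[OF \<kappa>, of m "Suc m"] by simp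
  define Mb where "Mb = real (Suc n) * (coeff_bound + (cmod v0 + \<epsilon>))"
  have bound: "cmod (\<F> m v) \<le> Mb" if v: "v \<in> ball v0 \<epsilon>" for m v
  proof -
    have "cmod v \<le> cmod v0 + \<epsilon>"
      using v norm_triangle_ineq2[of v v0] by (simp add: dist_norm norm_minus_commute)
    then have le: "real (Suc n) * (coeff_bound + cmod v) \<le> Mb"
      unfolding Mb_def by (intro mult_left_mono) auto
    have "0 \<le> real (Suc n) * (coeff_bound + cmod v)"
      using coeff_bound_ge_1 by (intro mult_nonneg_nonneg) auto
    have "cmod (\<F> m v) ^ \<kappa> (Suc m) = cmod (p (\<kappa> (Suc m)) v)"
      using h(3)[OF v \<kappa>_pos] by (simp add: \<F>_def flip: norm_power)
    also have "\<dots> \<le> (real (Suc n) * (coeff_bound + cmod v)) ^ \<kappa> (Suc m)"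
      by (rule norm_p_le)
    also have "\<dots> \<le> Mb ^ \<kappa> (Suc m)"
      using le \<open>0 \<le> _\<close> by (rule power_mono)
    finally show ?thesis
      using power_mono_iff[of "cmod (\<F> m v)" Mb "\<kappa> (Suc m)"] \<kappa>_pos le \<open>0 \<le> _\<close> by simp
  qed
  obtain H r where H: "H holomorphic_on ball v0 \<epsilon>" "strict_mono (r :: nat \<Rightarrow> nat)"
    "\<And>v. v \<in> ball v0 \<epsilon> \<Longrightarrow> (\<lambda>m. \<F> (r m) v) \<longlonglongrightarrow> H v"
  proof (rule Montel[of "ball v0 \<epsilon>" "range \<F>" \<F>])
    show "\<exists>B. \<forall>h\<in>range \<F>. \<forall>z\<in>K. cmod (h z) \<le> B" if "K \<subseteq> ball v0 \<epsilon>" for K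
      using bound that by (intro exI[of _ Mb]) blast
  qed (use h(1) in \<open>auto simp: \<F>_def\<close>)
  show ?thesis
  proof (rule that[OF H(1)])
    fix v x assume v: "v \<in> ball v0 \<epsilon>" "good v" "\<not> tied v"
      and Qv: "Q v = Polynomial.smult (s (int n)) (\<Prod>l<n. [:- x l, 1:])"
    obtain M L where M: "M \<subseteq> {..<n}" "card M = c"
      "\<And>l l'. l \<in> M \<Longrightarrow> l' \<in> {..<n} - M \<Longrightarrow> cmod (x l) < cmod (x l')"
      "0 < L" "(\<lambda>k. cmod (p k v) * (\<Prod>l\<in>M. cmod (x l)) ^ k) \<longlonglongrightarrow> L"
      using p_growth[OF v(2,3) Qv] by blast
    have "cmod (H v) * (\<Prod>l\<in>M. cmod (x l)) = 1"
    proof (rule limit_of_kth_roots[of "\<lambda>m. \<kappa> (Suc (r m))" L "\<lambda>k. cmod (p k v)" _ "\<lambda>m. cmod (\<F> (r m) v)"])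
      show "filterlim (\<lambda>m. \<kappa> (Suc (r m))) at_top sequentially"
        using \<kappa> H(2) by (intro filterlim_subseq) (auto simp: strict_mono_def)
      show "0 < (\<Prod>l\<in>M. cmod (x l))"
      proof (rule prod_pos)
        fix l assume "l \<in> M"
        then have "poly (Q v) (x l) = 0"
          using factorization_roots(2)[OF Qv] M(1) by blast
        then show "0 < cmod (x l)"
          using root_nonzero by simp
      qed
      show "0 < cmod (\<F> (r m) v)" for m
        using h(2)[OF v(1)] by (simp add: \<F>_def)
      show "cmod (\<F> (r m) v) ^ \<kappa> (Suc (r m)) = cmod (p (\<kappa> (Suc (r m))) v)" for m
        using h(3)[OF v(1) \<kappa>_pos] by (simp add: \<F>_def flip: norm_power)
      show "(\<lambda>m. cmod (\<F> (r m) v)) \<longlonglongrightarrow> cmod (H v)"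
        by (intro tendsto_norm H(3) v(1))
    qed (use M in auto)
    then show "\<exists>M\<subseteq>{..<n}. card M = c \<and> cmod (H v) * (\<Prod>l\<in>M. cmod (x l)) = 1 \<and>
        (\<forall>l\<in>M. \<forall>l'\<in>{..<n} - M. cmod (x l) < cmod (x l'))"
      using M by blast
  qed
qed

text \<open>In the parameter \<open>t\<close>, every product \<open>f M = H \<Prod>\<^bsub>l\<in>M\<^esub> \<zeta> l\<close> with \<open>card M = c\<close> is holomorphic and has modulus
  at least 1. At a tie two different \<open>M\<close> attain modulus 1 in the centre, so by the maximum principle
  for \<open>1 / f M\<close> both have modulus 1 on the whole disc; this contradicts that the minimising \<open>M\<close> is unique
  at generic points.\<close>

lemma tied_imp_not_zero_free:
  fixes \<kappa> :: "nat \<Rightarrow> nat"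
  assumes "tied v0" "0 < \<epsilon>" and \<kappa>: "strict_mono \<kappa>"
  shows "\<exists>m. \<exists>v\<in>ball v0 \<epsilon>. p (\<kappa> m) v = 0"
proof (rule ccontr)
  assume "\<not> ?thesis"
  then have nz: "\<And>m v. v \<in> ball v0 \<epsilon> \<Longrightarrow> p (\<kappa> m) v \<noteq> 0"
    by blast
  obtain H where H: "H holomorphic_on ball v0 \<epsilon>"
    and H_val: "\<And>v x. v \<in> ball v0 \<epsilon> \<Longrightarrow> good v \<Longrightarrow> \<not> tied v \<Longrightarrow>
      Q v = Polynomial.smult (s (int n)) (\<Prod>l<n. [:- x l, 1:]) \<Longrightarrow>
      \<exists>M\<subseteq>{..<n}. card M = c \<and> cmod (H v) * (\<Prod>l\<in>M. cmod (x l)) = 1 \<and>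
        (\<forall>l\<in>M. \<forall>l'\<in>{..<n} - M. cmod (x l) < cmod (x l'))"
    by (rule zero_free_imp_limit[of \<epsilon> \<kappa> v0, OF assms(2) \<kappa>], erule nz, rule that)
  obtain N \<delta>' \<zeta> where N: "0 < N" and \<delta>': "0 < \<delta>'"
    and hol': "\<And>l. l < n \<Longrightarrow> \<zeta> l holomorphic_on ball 0 \<delta>'"
    and fact': "\<And>t. t \<in> ball 0 \<delta>' \<Longrightarrow> Q (v0 + t ^ N) = Polynomial.smult (s (int n)) (\<Prod>l<n. [:- \<zeta> l t, 1:])"
    and "\<And>t. t \<in> ball 0 \<delta>' \<Longrightarrow> t \<noteq> 0 \<Longrightarrow> inj_on (\<lambda>l. \<zeta> l t) {..<n}"
    using uniformization[of v0] by blast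
  define \<delta> where "\<delta> = min \<delta>' (min 1 \<epsilon>)"
  define \<B> where "\<B> = ball (0::complex) \<delta>"
  have \<delta>: "0 < \<delta>"
    using \<delta>' assms(2) by (simp add: \<delta>_def)
  have \<B>: "open \<B>" "connected \<B>" "0 \<in> \<B>" "\<B> \<subseteq> ball 0 \<delta>'"
    using \<delta> by (auto simp: \<B>_def \<delta>_def)
  have hol: "\<zeta> l holomorphic_on \<B>" if "l < n" for l
    using hol'[OF that] \<B>(4) by (rule holomorphic_on_subset)
  have fact: "Q (v0 + t ^ N) = Polynomial.smult (s (int n)) (\<Prod>l<n. [:- \<zeta> l t, 1:])" if "t \<in> \<B>" for t
    using fact' that \<B>(4) by blast
  have in_ball: "v0 + t ^ N \<in> ball v0 \<epsilon>" if "t \<in> \<B>" for t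
  proof -
    have "cmod t < 1" "cmod t < \<epsilon>"
      using that by (auto simp: \<B>_def \<delta>_def)
    then show ?thesis
      using power_decreasing[of 1 N "cmod t"] N by (simp add: dist_norm norm_power)
  qed
  have \<zeta>0: "\<zeta> l t \<noteq> 0" if "l < n" "t \<in> \<B>" for l t
    using factorization_roots(2)[OF fact[OF that(2)] that(1)] root_nonzero by blast
  define \<M> where "\<M> = {M. M \<subseteq> {..<n} \<and> card M = c}"
  have fin\<M>: "finite \<M>"
    by (rule finite_subset[of _ "Pow {..<n}"]) (auto simp: \<M>_def)
  define f where "f M t = H (v0 + t ^ N) * (\<Prod>l\<in>M. \<zeta> l t)" for M t
  have cmod_f: "cmod (f M t) = cmod (H (v0 + t ^ N)) * (\<Prod>l\<in>M. cmod (\<zeta> l t))" for M t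
    by (simp add: f_def norm_mult prod_norm)
  have hol_f: "f M holomorphic_on \<B>" if "M \<in> \<M>" for M
  proof -
    have "(H \<circ> (\<lambda>t. v0 + t ^ N)) holomorphic_on \<B>"
      by (rule holomorphic_on_compose_gen[OF _ H]) (use in_ball in \<open>auto intro!: holomorphic_intros\<close>)
    then have "(\<lambda>t. H (v0 + t ^ N)) holomorphic_on \<B>"
      by (simp add: o_def)
    then show ?thesis
      unfolding f_def using that by (auto simp: \<M>_def intro!: holomorphic_intros hol)
  qed
  define sep where "sep M t \<longleftrightarrow> M \<in> \<M> \<and> cmod (f M t) = 1 \<and>
      (\<forall>l\<in>M. \<forall>l'\<in>{..<n} - M. cmod (\<zeta> l t) < cmod (\<zeta> l' t))" for M t
  \<comment> \<open>\<open>t \<mapsto> v0 + t ^ N\<close> is an open map, so every nonempty open set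
    of parameters covers a generic \<open>v\<close>.\<close>
  have dense: "\<exists>t\<in>U. \<exists>M. sep M t" if U: "open U" "U \<subseteq> \<B>" "U \<noteq> {}" for U
  proof -
    have "open ((\<lambda>t. v0 + t ^ N) ` U)"
    proof (rule open_mapping_thm[of _ UNIV])
      show "\<not> (\<lambda>t. v0 + t ^ N) constant_on (UNIV :: complex set)"
      proof
        assume "(\<lambda>t. v0 + t ^ N) constant_on (UNIV :: complex set)"
        then have "v0 + 0 ^ N = v0 + 1 ^ N"
          unfolding constant_on_def by (metis UNIV_I)
        then show False
          using N by (simp add: zero_power)
      qed
    qed (use U in \<open>auto intro!: holomorphic_intros\<close>)
    then obtain t where t: "t \<in> U" "good (v0 + t ^ N)" "\<not> tied (v0 + t ^ N)"
      using exists_good_not_tied[of "(\<lambda>t. v0 + t ^ N) ` U"] U(3) by blast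
    then have "t \<in> \<B>"
      using U(2) by blast
    then obtain M where "M \<subseteq> {..<n}" "card M = c"
        "cmod (H (v0 + t ^ N)) * (\<Prod>l\<in>M. cmod (\<zeta> l t)) = 1"
        "\<forall>l\<in>M. \<forall>l'\<in>{..<n} - M. cmod (\<zeta> l t) < cmod (\<zeta> l' t)"
      using H_val[OF in_ball t(2,3) fact] by blast
    then have "sep M t"
      by (simp add: sep_def \<M>_def cmod_f)
    then show ?thesis
      using t(1) by blast
  qed
  have prod_less: "cmod (f M t) < cmod (f M' t)" if "sep M t" "t \<in> \<B>" "M' \<in> \<M>" "M \<noteq> M'" for M M' t
  proof -
    have M: "M \<subseteq> {..<n}" "card M = c" "M' \<subseteq> {..<n}" "card M' = c"
      and H0: "H (v0 + t ^ N) \<noteq> 0"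
      using that by (auto simp: sep_def \<M>_def f_def)
    have "(\<Prod>l\<in>M. cmod (\<zeta> l t)) < (\<Prod>l\<in>M'. cmod (\<zeta> l t))"
    proof (rule prod_le_of_dominated(2))
      show "finite M" "finite M'"
        using M finite_subset by blast+
      show "0 < cmod (\<zeta> l t)" if "l \<in> M \<union> M'" for l
        using \<zeta>0[OF _ \<open>t \<in> \<B>\<close>] that M by auto
      show "cmod (\<zeta> l t) < cmod (\<zeta> l' t)" if "l \<in> M" "l' \<in> M' - M" for l l'
        using \<open>sep M t\<close> that M by (auto simp: sep_def)
      then show "cmod (\<zeta> l t) \<le> cmod (\<zeta> l' t)" if "l \<in> M" "l' \<in> M' - M" for l l'
        using that less_imp_le by blast
    qed (use M \<open>M \<noteq> M'\<close> in auto)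
    then show ?thesis
      unfolding cmod_f using H0 by simp
  qed
  have contf: "isCont (f M) t" if "M \<in> \<M>" "t \<in> \<B>" for M t
    by (rule isCont_ball_of_holomorphic[OF hol_f \<B>(1)]) (use that in auto)
  \<comment> \<open>Otherwise the modulus is below 1 on an open set; there \<open>dense\<close>
    provides a point where the minimum over all choices equals 1.\<close>
  have ge1: "1 \<le> cmod (f M t)" if M: "M \<in> \<M>" and t: "t \<in> \<B>" for M t
  proof (rule ccontr)
    assume "\<not> 1 \<le> cmod (f M t)"
    define U where "U = \<B> \<inter> (\<lambda>t. cmod (f M t)) -` {..<1}"
    have "continuous_on \<B> (\<lambda>t. cmod (f M t))"
      using hol_f[OF M] by (intro continuous_intros holomorphic_on_imp_continuous_on)
    then have "open U"
      unfolding U_def by (rule continuous_open_preimage[OF _ \<B>(1) open_lessThan])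
    moreover have "t \<in> U"
      using \<open>\<not> 1 \<le> cmod (f M t)\<close> t by (simp add: U_def)
    then have "U \<noteq> {}"
      by blast
    moreover have "U \<subseteq> \<B>"
      by (auto simp: U_def)
    ultimately obtain t' M' where t': "t' \<in> U" "sep M' t'"
      using dense[of U] by blast
    have "cmod (f M' t') \<le> cmod (f M t')"
      using prod_less[OF t'(2) _ M] t'(1) by (cases "M' = M") (auto simp: U_def)
    then show False
      using t' by (auto simp: U_def sep_def)
  qed
  have "\<exists>M\<in>\<M>. cmod (f M 0) = 1"
  proof (rule ccontr)
    assume "\<not> ?thesis"
    then have gt: "1 < cmod (f M 0)" if "M \<in> \<M>" for M
      using ge1[OF that \<B>(3)] that by force
    have "eventually (\<lambda>t. 1 < cmod (f M t)) (nhds 0)" if "M \<in> \<M>" for M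
    proof -
      have "((\<lambda>t. cmod (f M t)) \<longlongrightarrow> cmod (f M 0)) (nhds 0)"
        using contf[OF that \<B>(3)] by (intro tendsto_norm) (simp add: isCont_def flip: tendsto_at_iff_tendsto_nhds)
      then show ?thesis
        using gt[OF that] by (rule order_tendstoD)
    qed
    then have "eventually (\<lambda>t. \<forall>M\<in>\<M>. 1 < cmod (f M t)) (nhds 0)"
      using fin\<M> by (simp add: eventually_ball_finite)
    moreover have "eventually (\<lambda>t. t \<in> \<B>) (nhds 0)"
      using \<B>(1,3) by (rule eventually_nhds_in_open)
    ultimately have "eventually (\<lambda>t. (\<forall>M\<in>\<M>. 1 < cmod (f M t)) \<and> t \<in> \<B>) (nhds 0)"
      by (rule eventually_conj)
    then obtain U where U: "open U" "0 \<in> U" "\<And>t. t \<in> U \<Longrightarrow> (\<forall>M\<in>\<M>. 1 < cmod (f M t)) \<and> t \<in> \<B>"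
      unfolding eventually_nhds by blast
    then obtain t M where "t \<in> U" "sep M t"
      using dense[of U] by blast
    then show False
      using U(3)[of t] by (auto simp: sep_def)
  qed
  then obtain M0 where M0: "M0 \<in> \<M>" "cmod (f M0 0) = 1"
    by blast
  have f_one: "cmod (f M t) = 1" if M: "M \<in> \<M>" "cmod (f M 0) \<le> 1" and t: "t \<in> \<B>" for M t
  proof -
    have "(\<lambda>t. inverse (f M t)) constant_on \<B>"
    proof (rule maximum_modulus_principle[OF _ \<B>(1,2) \<B>(1) subset_refl \<B>(3)])
      have "f M t \<noteq> 0" if "t \<in> \<B>" for t
        using ge1[OF M(1) that] by auto
      then show "(\<lambda>t. inverse (f M t)) holomorphic_on \<B>"
        using hol_f[OF M(1)] by (intro holomorphic_intros) auto
      show "cmod (inverse (f M t)) \<le> cmod (inverse (f M 0))" if "t \<in> \<B>" for t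
        using ge1[OF M(1) that] ge1[OF M(1) \<B>(3)] M(2) by (simp add: norm_inverse inverse_le_1_iff)
    qed
    then have "inverse (f M t) = inverse (f M 0)"
      unfolding constant_on_def using t \<B>(3) by metis
    then show ?thesis
      using M(2) ge1[OF M(1) \<B>(3)] by simp
  qed
  have Q0: "Q v0 = Polynomial.smult (s (int n)) (\<Prod>l<n. [:- \<zeta> l 0, 1:])"
    using fact[OF \<B>(3)] N by (simp add: zero_power)
  obtain \<sigma> where \<sigma>: "bij_betw \<sigma> {..<n} {..<n}"
    "\<And>i j. i \<le> j \<Longrightarrow> j < n \<Longrightarrow> cmod (\<zeta> (\<sigma> i) 0) \<le> cmod (\<zeta> (\<sigma> j) 0)"
    "tied v0 \<longleftrightarrow> cmod (\<zeta> (\<sigma> (c - 1)) 0) = cmod (\<zeta> (\<sigma> c) 0)"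
    using sorted_factorization[OF Q0] by blast
  have \<sigma>n: "\<sigma> i < n" if "i < n" for i
    using bij_betwE[OF \<sigma>(1)] that by blast
  have inj\<sigma>: "inj_on \<sigma> {..<n}"
    using \<sigma>(1) by (simp add: bij_betw_def)
  define R where "R = \<sigma> ` {..<c - 1}"
  \<comment> \<open>Two choices of \<open>c\<close> smallest zeros at \<open>v0\<close>, which
    differ only in which of the two tied zeros they contain.\<close>
  define M1 M2 where "M1 = insert (\<sigma> (c - 1)) R" and "M2 = insert (\<sigma> c) R"
  have R: "finite R" "R \<subseteq> {..<n}" "\<sigma> (c - 1) \<notin> R" "\<sigma> c \<notin> R" "card R = c - 1" "\<sigma> (c - 1) \<noteq> \<sigma> c"
  proof -
    show "finite R" "R \<subseteq> {..<n}"
      using \<sigma>n c_less by (auto simp: R_def)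
    have "\<sigma> i \<notin> R" if i: "c - 1 \<le> i" "i < n" for i
    proof
      assume "\<sigma> i \<in> R"
      then obtain j where j: "j < c - 1" "\<sigma> i = \<sigma> j"
        by (auto simp: R_def)
      then show False
        using inj_onD[OF inj\<sigma>, of i j] i by auto
    qed
    then show "\<sigma> (c - 1) \<notin> R" "\<sigma> c \<notin> R"
      using c_less by auto
    have "{..<c - 1} \<subseteq> {..<n}"
      using c_less by auto
    from card_image[OF inj_on_subset[OF inj\<sigma> this]] show "card R = c - 1"
      by (simp add: R_def)
    show "\<sigma> (c - 1) \<noteq> \<sigma> c"
    proof
      assume "\<sigma> (c - 1) = \<sigma> c"
      moreover have "c - 1 \<in> {..<n}" "c \<in> {..<n}"
        using c_less by auto
      ultimately have "c - 1 = c"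
        by (rule inj_onD[OF inj\<sigma>])
      then show False
        using c_pos by simp
    qed
  qed
  have M12: "M1 \<in> \<M>" "M2 \<in> \<M>" "M1 \<noteq> M2"
  proof -
    show "M1 \<in> \<M>" "M2 \<in> \<M>"
      using R \<sigma>n c_less c_pos by (auto simp: \<M>_def M1_def M2_def)
    show "M1 \<noteq> M2"
      using R by (auto simp: M1_def M2_def)
  qed
  have "(\<Prod>l\<in>M1. cmod (\<zeta> l 0)) \<le> (\<Prod>l\<in>M0. cmod (\<zeta> l 0))"
  proof (rule prod_le_of_dominated(1))
    show "finite M1" "finite M0"
      using M12 M0 finite_subset by (auto simp: \<M>_def)
    show "card M1 = card M0"
      using M12 M0 by (simp add: \<M>_def)
    show "0 < cmod (\<zeta> l 0)" if "l \<in> M1 \<union> M0" for l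
      using \<zeta>0[OF _ \<B>(3)] that M12 M0 by (auto simp: \<M>_def)
    show "cmod (\<zeta> l 0) \<le> cmod (\<zeta> l' 0)" if l: "l \<in> M1" and l': "l' \<in> M0 - M1" for l l'
    proof -
      have "{..<c} = insert (c - 1) {..<c - 1}"
        using c_pos by auto
      then have "M1 = \<sigma> ` {..<c}"
        by (simp add: M1_def R_def)
      then obtain i where i: "i < c" "l = \<sigma> i"
        using l by blast
      have "l' \<in> {..<n}"
        using l' M0 by (auto simp: \<M>_def)
      then obtain j where j: "j < n" "l' = \<sigma> j"
        using \<sigma>(1) by (auto simp: bij_betw_def)
      have "c \<le> j"
      proof (rule ccontr)
        assume "\<not> c \<le> j"
        then have "j = c - 1 \<or> j \<in> {..<c - 1}"
          by auto
        then show False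
          using l' j by (auto simp: M1_def R_def)
      qed
      then show ?thesis
        using \<sigma>(2)[of i j] i j by simp
    qed
  qed
  then have "cmod (f M1 0) \<le> cmod (f M0 0)"
    unfolding cmod_f by (rule mult_left_mono) simp
  then have f1: "cmod (f M1 0) \<le> 1"
    using M0 by simp
  moreover have "cmod (f M1 0) = cmod (f M2 0)"
    unfolding cmod_f M1_def M2_def using R \<sigma>(3) assms(1) by simp
  ultimately have f2: "cmod (f M2 0) \<le> 1"
    by simp
  obtain t M where t: "t \<in> \<B>" "sep M t"
    using dense[of \<B>] \<B> by blast
  have "M1 = M"
    using prod_less[OF t(2,1) M12(1)] f_one[OF M12(1) f1 t(1)] t(2) by (auto simp: sep_def)
  moreover have "M2 = M"
    using prod_less[OF t(2,1) M12(2)] f_one[OF M12(2) f2 t(1)] t(2) by (auto simp: sep_def)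
  ultimately show False
    using M12(3) by simp
qed

lemma p_eq_det_char: "p k v = det (mat k k (\<lambda>(i, j). s (int (e (j + c)) - int (e i))) - v \<cdot>\<^sub>m 1\<^sub>m k)"
  unfolding p_def by (intro arg_cong[where f = det] eq_matI) (auto simp: T_def)

lemma p_has_zero:
  assumes "1 \<le> k"
  shows "\<exists>v. p k v = 0"
proof -
  define A where "A = mat k k (\<lambda>(i, j). s (int (e (j + c)) - int (e i)))"
  have A: "A \<in> carrier_mat k k"
    by (simp add: A_def)
  obtain v where "eigenvalue A v"
    using spectrum_non_empty[OF A] assms by (auto simp: spectrum_def)
  then have "det (char_matrix A v) = 0"
    using eigenvalue_det[OF A] by simp
  moreover have "char_matrix A v = A - v \<cdot>\<^sub>m 1\<^sub>m k"
    using A by (intro eq_matI) (auto simp: char_matrix_def)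
  ultimately show ?thesis
    unfolding p_eq_det_char A_def by auto
qed

text \<open>If the closest zeros \<open>u k\<close> stay at distance \<open>\<epsilon>\<close> from
  \<open>v\<close> for infinitely many \<open>k\<close>, those \<open>p k\<close> have no zero in
  the disc, against \<open>tied_imp_not_zero_free\<close>.\<close>

lemma tied_imp_eigenvalue_limit:
  assumes "tied v"
  obtains u where "\<And>k. 1 \<le> k \<Longrightarrow> p k (u k) = 0" "u \<longlonglongrightarrow> v"
proof -
  have "\<exists>z. 1 \<le> k \<longrightarrow> p k z = 0 \<and> (\<forall>y. p k y = 0 \<longrightarrow> dist v z \<le> dist v y)" for k
  proof (cases "1 \<le> k")
    case True
    have "continuous_on UNIV (p k)"
      using p_holomorphic by (rule holomorphic_on_imp_continuous_on)
    then have "closed {z. p k z = 0}"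
      by (intro closed_Collect_eq) auto
    moreover have "{z. p k z = 0} \<noteq> {}"
      using p_has_zero[OF True] by blast
    ultimately obtain z where "z \<in> {z. p k z = 0}" "\<And>y. y \<in> {z. p k z = 0} \<Longrightarrow> dist v z \<le> dist v y"
      using distance_attains_inf[of "{z. p k z = 0}" v] by blast
    then show ?thesis
      by (intro exI[of _ z]) simp
  qed auto
  then have "\<exists>u. \<forall>k. 1 \<le> k \<longrightarrow> p k (u k) = 0 \<and> (\<forall>y. p k y = 0 \<longrightarrow> dist v (u k) \<le> dist v y)"
    by (rule choice[OF allI])
  then obtain u where u: "\<And>k. 1 \<le> k \<Longrightarrow> p k (u k) = 0"
    "\<And>k y. 1 \<le> k \<Longrightarrow> p k y = 0 \<Longrightarrow> dist v (u k) \<le> dist v y"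
    by blast
  have "u \<longlonglongrightarrow> v"
  proof (rule ccontr)
    assume "\<not> u \<longlonglongrightarrow> v"
    then obtain \<epsilon> where \<epsilon>: "0 < \<epsilon>" "\<forall>N. \<exists>k\<ge>N. \<epsilon> \<le> dist (u k) v"
      unfolding lim_sequentially by (meson not_le)
    define B where "B = {k. 1 \<le> k \<and> \<epsilon> \<le> dist (u k) v}"
    have "infinite B"
      unfolding infinite_nat_iff_unbounded_le
    proof
      fix m
      obtain k where "max 1 m \<le> k" "\<epsilon> \<le> dist (u k) v"
        using \<epsilon>(2) by blast
      then show "\<exists>k\<ge>m. k \<in> B"
        by (auto simp: B_def)
    qed
    then have "strict_mono (enumerate B)" and B: "\<And>m. enumerate B m \<in> B"
      by (auto simp: strict_mono_def enumerate_mono enumerate_in_set)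
    then obtain m w where w: "w \<in> ball v \<epsilon>" "p (enumerate B m) w = 0"
      using tied_imp_not_zero_free[OF assms \<epsilon>(1)] by blast
    have "dist v (u (enumerate B m)) \<le> dist v w" "\<epsilon> \<le> dist (u (enumerate B m)) v"
      using u(2)[OF _ w(2)] B[of m] by (auto simp: B_def)
    then show False
      using w(1) by (simp add: dist_commute)
  qed
  with u(1) show ?thesis
    by (rule that)
qed

theorem limit_eigenvalues_eq:
  "\<exists>W. finite W \<and> {v. \<exists>u. (\<forall>k\<ge>1. p k (u k) = 0) \<and> u \<longlonglongrightarrow> v} = {v. tied v} \<union> W"
proof -
  let ?B = "{v. \<exists>u. (\<forall>k\<ge>1. p k (u k) = 0) \<and> u \<longlonglongrightarrow> v}"
  have "{v. tied v} \<subseteq> ?B"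
    using tied_imp_eigenvalue_limit by blast
  moreover have "?B - {v. tied v} \<subseteq> {v. \<not> good v}"
    using not_eigenvalue_limit by blast
  ultimately show ?thesis
    using finite_subset[OF _ finite_not_good] by (intro exI[of _ "?B - {v. tied v}"]) auto
qed

end

section \<open>Reduction of the theorem to the locale\<close>

lemma enumerate_Diff_initial:
  fixes S :: "nat set"
  assumes "infinite S" "\<And>i. i < c \<Longrightarrow> enumerate S i = Suc i" "0 \<notin> S"
  shows "enumerate (S - {1..c}) j = enumerate S (j + c)"
  using assms(2)
proof (induction c arbitrary: j)
  case (Suc c)
  have inf: "infinite (S - {1..c})"
    using assms(1) by simp
  have eq: "enumerate (S - {1..c}) j = enumerate S (j + c)" for j
    using Suc by simp
  have "enumerate (S - {1..c}) 0 = Suc c"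
    using eq[of 0] Suc.prems[of c] by simp
  then have "enumerate (S - {1..c}) (Suc j) = enumerate (S - {1..c} - {Suc c}) j"
    by (simp add: enumerate_Suc')
  moreover have "S - {1..c} - {Suc c} = S - {1..Suc c}"
    by (auto simp: le_Suc_eq)
  ultimately show ?case
    using eq[of "Suc j"] by simp
qed simp

theorem theorem6:
  fixes n c :: nat and s :: "int \<Rightarrow> complex" and \<gamma> \<alpha> \<beta> :: "nat list"
    and D :: "nat \<Rightarrow> complex mat" and B C :: "complex set"
  assumes "2 \<le> n" and "0 < c" and "c < n"
    and "s 0 = 1" and "s (int n) \<noteq> 0"
    and "\<And>i. i < 0 \<or> i > int n \<Longrightarrow> s i = 0"
    and "sorted_wrt (<) \<gamma>" and "\<forall>g\<in>set \<gamma>. c < g"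
    and "\<alpha> = \<gamma>" and "\<beta> = [1..<Suc c] @ \<gamma>"
    and "\<And>k. D k = leading_submatrix (toeplitz s) \<alpha> \<beta> k"
    and "B = limit_eigenvalues D"
    and "C = {v. root_modulus n c s v c = root_modulus n c s v (c + 1)}"
  shows "\<exists>W. finite W \<and> B = C \<union> W"
proof -
  define S where "S = {1..} - set \<gamma>"
  define e where "e = enumerate S"
  have inf: "infinite S"
    unfolding S_def using Diff_infinite_finite[OF _ infinite_Ici] by blast
  have mono: "strict_mono e"
    using inf by (simp add: e_def strict_mono_def)
  have e_Suc: "e (Suc i) = Suc (e i)" if "Suc (e i) \<in> S" for i
    unfolding e_def enumerate_Suc''[OF inf]
    by (rule Least_equality) (use that in \<open>auto simp: e_def\<close>)
  have e_init: "e i = Suc i" if "i < c" for i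
    using that
  proof (induction i)
    case 0
    have "(LEAST x. x \<in> S) = 1"
      using assms(2,8) by (intro Least_equality) (auto simp: S_def)
    then show ?case
      by (simp add: e_def enumerate_0)
  next
    case (Suc i)
    have "Suc (e i) \<in> S"
      using Suc assms(8) by (auto simp: S_def)
    then show ?case
      using e_Suc Suc by simp
  qed
  define G where "G = Suc (Max (insert 0 (set \<gamma>)))"
  have above: "x \<in> S" if "G \<le> x" for x
  proof -
    have "y < x" if "y \<in> set \<gamma>" for y
    proof -
      have "y \<le> Max (insert 0 (set \<gamma>))"
        using that by (intro Max_ge) auto
      then show ?thesis
        using \<open>G \<le> x\<close> by (simp add: G_def)
    qed
    then show ?thesis
      using that by (auto simp: S_def G_def)
  qed
  define d where "d = e G - G"
  have le: "i \<le> e i" for i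
    using mono by (simp add: strict_mono_imp_increasing)
  have tail: "e i = i + d" if "G \<le> i" for i
    using that
  proof (induction i rule: dec_induct)
    case base
    then show ?case
      using le[of G] by (simp add: d_def)
  next
    case (step i)
    then show ?case
      using e_Suc[OF above] by simp
  qed
  define P where "P h \<longleftrightarrow> (\<forall>i\<ge>h. e i = i + d)" for h
  \<comment> \<open>The locale requires a gap just before \<open>g\<close>, which may fail for the
    crude bound \<open>G\<close>; minimality provides it.\<close>
  define g where "g = (LEAST h. P h)"
  have "P G"
    using tail by (simp add: P_def)
  then have "P g"
    unfolding g_def by (rule LeastI)
  have gap: "g = 0 \<or> c \<le> g \<and> e (g - 1) + 2 \<le> e g"
  proof (cases g)
    case (Suc h)
    have "\<not> P h"
      using not_less_Least[of h P] Suc by (simp add: g_def)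
    then have "e h \<noteq> h + d"
      using \<open>P g\<close> Suc unfolding P_def by (metis le_SucE le_antisym not_less_eq_eq)
    moreover have "e g = Suc h + d"
      using \<open>P g\<close> Suc by (simp add: P_def)
    moreover have "e h < e g"
      using mono Suc by (simp add: strict_mono_def)
    ultimately have two: "e h + 2 \<le> e g"
      by simp
    moreover have "c \<le> g"
    proof (rule ccontr)
      assume "\<not> c \<le> g"
      then show False
        using two e_init[of h] e_init[of g] Suc by simp
    qed
    ultimately show ?thesis
      using Suc by simp
  qed simp
  interpret banded_toeplitz n c g d s e
    using assms(2-6) mono gap \<open>P g\<close> by unfold_locales (auto simp: P_def)
  have "set \<beta> = {1..c} \<union> set \<gamma>"
    using assms(10) by auto
  then have cols: "{1..} - set \<beta> = S - {1..c}"
    by (auto simp: S_def)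
  have "0 \<notin> S"
    by (simp add: S_def)
  have "D k = mat k k (\<lambda>(i, j). s (int (e (j + c)) - int (e i)))" for k
    unfolding assms(11) leading_submatrix_def cols assms(9) S_def[symmetric] toeplitz_def
    using enumerate_Diff_initial[OF inf _ \<open>0 \<notin> S\<close>, of c] e_init by (simp add: e_def)
  then have "det (D k - v \<cdot>\<^sub>m 1\<^sub>m k) = p k v" for k v
    by (simp only: p_eq_det_char)
  then have "B = {v. \<exists>u. (\<forall>k\<ge>1. p k (u k) = 0) \<and> u \<longlonglongrightarrow> v}"
    by (simp add: assms(12) limit_eigenvalues_def)
  moreover have "C = {v. tied v}"
    by (simp add: assms(13) tied_def)
  ultimately show ?thesis
    using limit_eigenvalues_eq by simp
qed

end
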